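(* Let $X$ be a compact metrizable Hausdorff space and $\varphi:X\to X$ a continuous locally injective map. For $k,l\in\mathbb N$ set $X_{k,l}=\{x\in X:\#\varphi^{-k}(\varphi^k(x))=l\}$. Assume that $\varphi$ is surjective and not injective. The following conditions are equivalent: 1) $C^*_r(\Gamma_\varphi)$ is simple. 2) For every open subset $U\subseteq X$ and $k,l\in\mathbb N$ such that $U\cap X_{k,l}\neq\emptyset$ there is an $m\in\mathbb N$ such that $\bigcup_{j=0}^m\varphi^j(U\cap X_{k,l})=X$.
   Context: Here $\mathbb N=\{0,1,2,\dots\}$ and $\varphi^{-k}(\cdot)$ denotes preimage under $\varphi^k$. The groupoid. $\Gamma_\varphi=\{(x,k,y)\in X\times\mathbb Z\times X:\ \exists a,b\in\mathbb N,\ k=a-b,\ \varphi^a(x)=\varphi^b(y)\}$ with product $(x,k,y)(y,k',y')=(x,k+k',y')$ and inverse $(x,k,y)^{-1}=(y,-k,x)$. For $k\in\mathbb Z$, $n\in\mathbb N$, $n+k\ge0$, let $\Gamma_\varphi(k,n)=\{(x,k,y):\varphi^{k+i}(x)=\varphi^i(y)\ \forall i\ge n\}$ with the relative topology from $X\times\mathbb Z\times X$; it is open in $\Gamma_\varphi(k,n+1)$. $\Gamma_\varphi(k)=\bigcup_n\Gamma_\varphi(k,n)$ has the inductive limit topology and $\Gamma_\varphi=\bigsqcup_{k}\Gamma_\varphi(k)$ has the topology in which each $\Gamma_\varphi(k)$ is open and closed. This is a locally compact Hausdorff groupoid with locally injective range map (a semi étale groupoid), with unit space $X$ via $x\mapsto(x,0,x)$.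 The $C^*$-algebra. For a locally compact Hausdorff groupoid $G$ with locally injective range map $r$ (source map $s$, unit space $G^0$), $B_c(G)$ is the $*$-algebra of bounded compactly supported (not necessarily continuous) functions $G\to\mathbb C$ with product $(f\star g)(\gamma)=\sum_{\gamma_1\gamma_2=\gamma}f(\gamma_1)g(\gamma_2)$ and involution $f^*(\gamma)=\overline{f(\gamma^{-1})}$. For $x\in G^0$, $\pi_x$ is the representation on $l^2(s^{-1}(x))$ with $(\pi_x(f)\psi)(\gamma)=\sum_{\gamma_1\gamma_2=\gamma}f(\gamma_1)\psi(\gamma_2)$. $B^*_r(G)$ is the completion of $B_c(G)$ in $\|f\|=\sup_x\|\pi_x(f)\|$, and $C^*_r(G)$ is the $C^*$-subalgebra of $B^*_r(G)$ generated by the continuous compactly supported functions $C_c(G)$. *)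

theory Defs
  imports "HOL-Analysis.Analysis"
begin

record 'b normed_star_algebra =
  elements :: "'b set"
  azero :: 'b
  aadd :: "'b \<Rightarrow> 'b \<Rightarrow> 'b"
  ascale :: "complex \<Rightarrow> 'b \<Rightarrow> 'b"
  amult :: "'b \<Rightarrow> 'b \<Rightarrow> 'b"
  astar :: "'b \<Rightarrow> 'b"
  anorm :: "'b \<Rightarrow> real"

definition adist :: "'b normed_star_algebra \<Rightarrow> 'b \<Rightarrow> 'b \<Rightarrow> real" where
  "adist A a b = anorm A (aadd A a (ascale A (-1) b))"

definition norm_closed :: "'b normed_star_algebra \<Rightarrow> 'b set \<Rightarrow> bool" where
  "norm_closed A S \<longleftrightarrow>
     (\<forall>a\<in>elements A. (\<forall>e>0. \<exists>b\<in>S. adist A a b < e) \<longrightarrow> a \<in> S)"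

definition linear_subspace :: "'b normed_star_algebra \<Rightarrow> 'b set \<Rightarrow> bool" where
  "linear_subspace A S \<longleftrightarrow>
     S \<subseteq> elements A \<and> azero A \<in> S \<and>
     (\<forall>a\<in>S. \<forall>b\<in>S. aadd A a b \<in> S) \<and> (\<forall>c. \<forall>a\<in>S. ascale A c a \<in> S)"

definition cstar_subalgebra :: "'b normed_star_algebra \<Rightarrow> 'b set \<Rightarrow> bool" where
  "cstar_subalgebra A S \<longleftrightarrow>
     linear_subspace A S \<and> (\<forall>a\<in>S. \<forall>b\<in>S. amult A a b \<in> S) \<and>
     (\<forall>a\<in>S. astar A a \<in> S) \<and> norm_closed A S"

definition cstar_generated :: "'b normed_star_algebra \<Rightarrow> 'b set \<Rightarrow> 'b normed_star_algebra" where
  "cstar_generated A S = A\<lparr>elements := \<Inter>{B. cstar_subalgebra A B \<and> S \<subseteq> B}\<rparr>"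

definition closed_ideal :: "'b normed_star_algebra \<Rightarrow> 'b set \<Rightarrow> bool" where
  "closed_ideal A I \<longleftrightarrow>
     linear_subspace A I \<and>
     (\<forall>a\<in>elements A. \<forall>x\<in>I. amult A a x \<in> I \<and> amult A x a \<in> I) \<and> norm_closed A I"

definition simple_algebra :: "'b normed_star_algebra \<Rightarrow> bool" where
  "simple_algebra A \<longleftrightarrow>
     elements A \<noteq> {azero A} \<and>
     (\<forall>I. closed_ideal A I \<longrightarrow> I = {azero A} \<or> I = elements A)"

definition cauchy_seqs :: "'b normed_star_algebra \<Rightarrow> (nat \<Rightarrow> 'b) set" where
  "cauchy_seqs A = {u. (\<forall>n. u n \<in> elements A) \<and>
     (\<forall>e>0. \<exists>N. \<forall>m\<ge>N. \<forall>n\<ge>N. adist A (u m) (u n) < e)}"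

definition null_rel :: "'b normed_star_algebra \<Rightarrow> ((nat \<Rightarrow> 'b) \<times> (nat \<Rightarrow> 'b)) set" where
  "null_rel A = {(u, v). u \<in> cauchy_seqs A \<and> v \<in> cauchy_seqs A \<and>
     (\<lambda>n. adist A (u n) (v n)) \<longlonglongrightarrow> 0}"

text \<open>The operations on classes are the unions of the classes of the results on representatives,
  as in \<^theory>\<open>HOL.Equiv_Relations\<close>.\<close>

definition completion :: "'b normed_star_algebra \<Rightarrow> (nat \<Rightarrow> 'b) set normed_star_algebra" where
  "completion A =
     \<lparr>elements = cauchy_seqs A // null_rel A,
      azero = null_rel A `` {\<lambda>n. azero A},
      aadd = (\<lambda>P Q. \<Union>p\<in>P. \<Union>q\<in>Q. null_rel A `` {\<lambda>n. aadd A (p n) (q n)}),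
      ascale = (\<lambda>c P. \<Union>p\<in>P. null_rel A `` {\<lambda>n. ascale A c (p n)}),
      amult = (\<lambda>P Q. \<Union>p\<in>P. \<Union>q\<in>Q. null_rel A `` {\<lambda>n. amult A (p n) (q n)}),
      astar = (\<lambda>P. \<Union>p\<in>P. null_rel A `` {\<lambda>n. astar A (p n)}),
      anorm = (\<lambda>P. lim (\<lambda>n. anorm A ((SOME p. p \<in> P) n)))\<rparr>"

definition to_completion :: "'b normed_star_algebra \<Rightarrow> 'b \<Rightarrow> (nat \<Rightarrow> 'b) set" where
  "to_completion A a = null_rel A `` {\<lambda>n. a}"

text \<open>Units are regarded as arrows, so \<open>src\<close> and \<open>rng\<close> take values in arrows.\<close>

record 'g topological_groupoid =
  arrows :: "'g set"
  arrow_top :: "'g topology"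
  src :: "'g \<Rightarrow> 'g"
  rng :: "'g \<Rightarrow> 'g"
  gmult :: "'g \<Rightarrow> 'g \<Rightarrow> 'g"
  ginv :: "'g \<Rightarrow> 'g"

definition units :: "('g, 'm) topological_groupoid_scheme \<Rightarrow> 'g set" where
  "units G = src G ` arrows G"

definition factorizations :: "('g, 'm) topological_groupoid_scheme \<Rightarrow> 'g \<Rightarrow> ('g \<times> 'g) set" where
  "factorizations G g = {(g1, g2). g1 \<in> arrows G \<and> g2 \<in> arrows G \<and>
     src G g1 = rng G g2 \<and> gmult G g1 g2 = g}"

text \<open>Functions on the arrows are represented by functions on the whole type that vanish off the
  arrows.\<close>

definition Bc :: "('g, 'm) topological_groupoid_scheme \<Rightarrow> ('g \<Rightarrow> complex) set" where
  "Bc G = {f. (\<forall>g. g \<notin> arrows G \<longrightarrow> f g = 0) \<and> bounded (range f) \<and>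
     compactin (arrow_top G) (arrow_top G closure_of {g \<in> arrows G. f g \<noteq> 0})}"

definition Cc :: "('g, 'm) topological_groupoid_scheme \<Rightarrow> ('g \<Rightarrow> complex) set" where
  "Cc G = {f \<in> Bc G. continuous_map (arrow_top G) euclidean f}"

text \<open>When the range map is locally injective, only finitely many terms of the following sums over
  factorizations are nonzero, for \<open>f\<close> with compact support.\<close>

definition convolution ::
    "('g, 'm) topological_groupoid_scheme \<Rightarrow> ('g \<Rightarrow> complex) \<Rightarrow> ('g \<Rightarrow> complex) \<Rightarrow> 'g \<Rightarrow> complex" where
  "convolution G f h g =
     (if g \<in> arrows G then \<Sum>\<^sub>\<infinity>(g1, g2)\<in>factorizations G g. f g1 * h g2 else 0)"

definition src_fibre :: "('g, 'm) topological_groupoid_scheme \<Rightarrow> 'g \<Rightarrow> 'g set" where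
  "src_fibre G x = {g \<in> arrows G. src G g = x}"

definition l2 :: "'g set \<Rightarrow> ('g \<Rightarrow> complex) set" where
  "l2 S = {\<psi>. (\<forall>g. g \<notin> S \<longrightarrow> \<psi> g = 0) \<and> (\<lambda>g. (cmod (\<psi> g))\<^sup>2) summable_on S}"

definition l2_norm :: "'g set \<Rightarrow> ('g \<Rightarrow> complex) \<Rightarrow> real" where
  "l2_norm S \<psi> = sqrt (\<Sum>\<^sub>\<infinity>g\<in>S. (cmod (\<psi> g))\<^sup>2)"

definition pi_rep ::
    "('g, 'm) topological_groupoid_scheme \<Rightarrow> 'g \<Rightarrow> ('g \<Rightarrow> complex) \<Rightarrow> ('g \<Rightarrow> complex) \<Rightarrow> 'g \<Rightarrow> complex" where
  "pi_rep G x f \<psi> g =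
     (if g \<in> src_fibre G x then \<Sum>\<^sub>\<infinity>(g1, g2)\<in>factorizations G g. f g1 * \<psi> g2 else 0)"

definition pi_norm :: "('g, 'm) topological_groupoid_scheme \<Rightarrow> 'g \<Rightarrow> ('g \<Rightarrow> complex) \<Rightarrow> real" where
  "pi_norm G x f = (SUP \<psi>\<in>{\<psi> \<in> l2 (src_fibre G x). l2_norm (src_fibre G x) \<psi> \<le> 1}.
     l2_norm (src_fibre G x) (pi_rep G x f \<psi>))"

definition Bc_algebra ::
    "('g, 'm) topological_groupoid_scheme \<Rightarrow> ('g \<Rightarrow> complex) normed_star_algebra" where
  "Bc_algebra G =
     \<lparr>elements = Bc G,
      azero = (\<lambda>g. 0),
      aadd = (\<lambda>f h g. f g + h g),
      ascale = (\<lambda>c f g. c * f g),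
      amult = convolution G,
      astar = (\<lambda>f g. if g \<in> arrows G then cnj (f (ginv G g)) else 0),
      anorm = (\<lambda>f. SUP x\<in>units G. pi_norm G x f)\<rparr>"

definition reduced_B_algebra ::
    "('g, 'm) topological_groupoid_scheme \<Rightarrow> (nat \<Rightarrow> 'g \<Rightarrow> complex) set normed_star_algebra" where
  "reduced_B_algebra G = completion (Bc_algebra G)"

definition reduced_Cstar_algebra ::
    "('g, 'm) topological_groupoid_scheme \<Rightarrow> (nat \<Rightarrow> 'g \<Rightarrow> complex) set normed_star_algebra" where
  "reduced_Cstar_algebra G =
     cstar_generated (reduced_B_algebra G) (to_completion (Bc_algebra G) ` Cc G)"

text \<open>The final topology on a union with respect to the inclusions.  It is the inductive limit
  topology for an increasing sequence and the disjoint union topology for a disjoint family.\<close>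

definition union_topology :: "'i set \<Rightarrow> ('i \<Rightarrow> 'a topology) \<Rightarrow> 'a topology" where
  "union_topology I T = topology (\<lambda>U. U \<subseteq> (\<Union>i\<in>I. topspace (T i)) \<and>
     (\<forall>i\<in>I. openin (T i) (U \<inter> topspace (T i))))"

lemma openin_union_topology:
  "openin (union_topology I T) U \<longleftrightarrow>
     U \<subseteq> (\<Union>i\<in>I. topspace (T i)) \<and> (\<forall>i\<in>I. openin (T i) (U \<inter> topspace (T i)))"
proof -
  have "istopology (\<lambda>U. U \<subseteq> (\<Union>i\<in>I. topspace (T i)) \<and>
     (\<forall>i\<in>I. openin (T i) (U \<inter> topspace (T i))))" (is "istopology ?P")
    unfolding istopology_def
  proof (intro conjI allI impI)
    fix S U assume P: "?P S" "?P U"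
    then show "S \<inter> U \<subseteq> (\<Union>i\<in>I. topspace (T i))"
      by blast
    show "\<forall>i\<in>I. openin (T i) (S \<inter> U \<inter> topspace (T i))"
    proof
      fix i assume "i \<in> I"
      then have "openin (T i) ((S \<inter> topspace (T i)) \<inter> (U \<inter> topspace (T i)))"
        using P by (blast intro: openin_Int[of "T i" "S \<inter> topspace (T i)"])
      also have "(S \<inter> topspace (T i)) \<inter> (U \<inter> topspace (T i)) = S \<inter> U \<inter> topspace (T i)"
        by blast
      finally show "openin (T i) (S \<inter> U \<inter> topspace (T i))" .
    qed
  next
    fix \<K> assume K: "\<forall>K\<in>\<K>. ?P K"
    then show "\<Union>\<K> \<subseteq> (\<Union>i\<in>I. topspace (T i))"
      by blast
    show "\<forall>i\<in>I. openin (T i) (\<Union>\<K> \<inter> topspace (T i))"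
    proof
      fix i assume "i \<in> I"
      then have "openin (T i) (\<Union>((\<lambda>K. K \<inter> topspace (T i)) ` \<K>))"
        using K by (intro openin_Union) blast
      also have "\<Union>((\<lambda>K. K \<inter> topspace (T i)) ` \<K>) = \<Union>\<K> \<inter> topspace (T i)"
        by blast
      finally show "openin (T i) (\<Union>\<K> \<inter> topspace (T i))" .
    qed
  qed
  then show ?thesis
    by (simp add: union_topology_def topology_inverse')
qed

lemma topspace_union_topology: "topspace (union_topology I T) = (\<Union>i\<in>I. topspace (T i))"
proof
  show "topspace (union_topology I T) \<subseteq> (\<Union>i\<in>I. topspace (T i))"
    using openin_topspace[of "union_topology I T"] unfolding openin_union_topology by (rule conjunct1)
  have "(\<Union>i\<in>I. topspace (T i)) \<inter> topspace (T j) = topspace (T j)" if "j \<in> I" for j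
    using that by blast
  then have "openin (union_topology I T) (\<Union>i\<in>I. topspace (T i))"
    unfolding openin_union_topology by simp
  then show "(\<Union>i\<in>I. topspace (T i)) \<subseteq> topspace (union_topology I T)"
    by (rule openin_subset)
qed

definition Gamma_set :: "'a topology \<Rightarrow> ('a \<Rightarrow> 'a) \<Rightarrow> ('a \<times> int \<times> 'a) set" where
  "Gamma_set X \<phi> = {(x, k, y). x \<in> topspace X \<and> y \<in> topspace X \<and>
     (\<exists>a b :: nat. k = int a - int b \<and> (\<phi> ^^ a) x = (\<phi> ^^ b) y)}"

text \<open>Only used for \<open>0 \<le> int n + k\<close>, so that \<open>nat\<close> does not truncate.\<close>

definition Gamma_kn :: "'a topology \<Rightarrow> ('a \<Rightarrow> 'a) \<Rightarrow> int \<Rightarrow> nat \<Rightarrow> ('a \<times> int \<times> 'a) set" where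
  "Gamma_kn X \<phi> k n = {(x, k, y) | x y. x \<in> topspace X \<and> y \<in> topspace X \<and>
     (\<forall>i\<ge>n. (\<phi> ^^ nat (k + int i)) x = (\<phi> ^^ i) y)}"

definition Gamma_kn_top :: "'a topology \<Rightarrow> ('a \<Rightarrow> 'a) \<Rightarrow> int \<Rightarrow> nat \<Rightarrow> ('a \<times> int \<times> 'a) topology" where
  "Gamma_kn_top X \<phi> k n =
     subtopology (prod_topology X (prod_topology (discrete_topology UNIV) X)) (Gamma_kn X \<phi> k n)"

definition Gamma_k_top :: "'a topology \<Rightarrow> ('a \<Rightarrow> 'a) \<Rightarrow> int \<Rightarrow> ('a \<times> int \<times> 'a) topology" where
  "Gamma_k_top X \<phi> k = union_topology {n. 0 \<le> int n + k} (Gamma_kn_top X \<phi> k)"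

definition Gamma_top :: "'a topology \<Rightarrow> ('a \<Rightarrow> 'a) \<Rightarrow> ('a \<times> int \<times> 'a) topology" where
  "Gamma_top X \<phi> = union_topology UNIV (Gamma_k_top X \<phi>)"

lemma topspace_Gamma_top: "topspace (Gamma_top X \<phi>) = Gamma_set X \<phi>"
proof -
  have 1: "topspace (Gamma_kn_top X \<phi> k n) = Gamma_kn X \<phi> k n" for k n
  proof -
    have "Gamma_kn X \<phi> k n \<subseteq> topspace X \<times> UNIV \<times> topspace X"
      unfolding Gamma_kn_def by blast
    then show ?thesis
      by (simp add: Gamma_kn_top_def Int_absorb1)
  qed
  have "(\<Union>k. \<Union>n\<in>{n. 0 \<le> int n + k}. Gamma_kn X \<phi> k n) = Gamma_set X \<phi>"
  proof (intro equalityI subsetI)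
    fix g assume "g \<in> (\<Union>k. \<Union>n\<in>{n. 0 \<le> int n + k}. Gamma_kn X \<phi> k n)"
    then obtain k n x y where g: "g = (x, k, y)" "x \<in> topspace X" "y \<in> topspace X"
      and n: "0 \<le> int n + k" "(\<phi> ^^ nat (k + int n)) x = (\<phi> ^^ n) y"
      unfolding Gamma_kn_def by blast
    have "k = int (nat (k + int n)) - int n"
      using n(1) by simp
    then have "\<exists>a b :: nat. k = int a - int b \<and> (\<phi> ^^ a) x = (\<phi> ^^ b) y"
      using n(2) by blast
    then show "g \<in> Gamma_set X \<phi>"
      using g
      unfolding Gamma_set_def by blast
  next
    fix g assume "g \<in> Gamma_set X \<phi>"
    then obtain x y a b where g: "g = (x, int a - int b, y)" "x \<in> topspace X" "y \<in> topspace X"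
      and ab: "(\<phi> ^^ a) x = (\<phi> ^^ b) y"
      by (auto simp: Gamma_set_def)
    have "(\<phi> ^^ nat (int a - int b + int i)) x = (\<phi> ^^ i) y" if "i \<ge> b" for i
    proof -
      have 1: "nat (int a - int b + int i) = (i - b) + a"
        using that by simp
      have "(\<phi> ^^ ((i - b) + a)) x = (\<phi> ^^ ((i - b) + b)) y"
        by (simp only: funpow_add comp_apply ab)
      then show ?thesis
        using that by (simp add: 1)
    qed
    then have "g \<in> Gamma_kn X \<phi> (int a - int b) b"
      using g unfolding Gamma_kn_def by blast
    moreover have "0 \<le> int b + (int a - int b)"
      by simp
    ultimately show "g \<in> (\<Union>k. \<Union>n\<in>{n. 0 \<le> int n + k}. Gamma_kn X \<phi> k n)"
      by blast
  qed
  then show ?thesis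
    by (simp add: Gamma_top_def Gamma_k_top_def topspace_union_topology 1)
qed

definition Gamma_groupoid ::
    "'a topology \<Rightarrow> ('a \<Rightarrow> 'a) \<Rightarrow> ('a \<times> int \<times> 'a) topological_groupoid" where
  "Gamma_groupoid X \<phi> =
     \<lparr>arrows = Gamma_set X \<phi>,
      arrow_top = Gamma_top X \<phi>,
      src = (\<lambda>(x, k, y). (y, 0, y)),
      rng = (\<lambda>(x, k, y). (x, 0, x)),
      gmult = (\<lambda>(x, k, y) (y', k', z). (x, k + k', z)),
      ginv = (\<lambda>(x, k, y). (y, - k, x))\<rparr>"

definition locally_injective :: "'a topology \<Rightarrow> ('a \<Rightarrow> 'b) \<Rightarrow> bool" where
  "locally_injective X \<phi> \<longleftrightarrow> (\<forall>x\<in>topspace X. \<exists>U. openin X U \<and> x \<in> U \<and> inj_on \<phi> U)"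

definition Xkl :: "'a topology \<Rightarrow> ('a \<Rightarrow> 'a) \<Rightarrow> nat \<Rightarrow> nat \<Rightarrow> 'a set" where
  "Xkl X \<phi> k l = {x \<in> topspace X.
     finite {y \<in> topspace X. (\<phi> ^^ k) y = (\<phi> ^^ k) x} \<and>
     card {y \<in> topspace X. (\<phi> ^^ k) y = (\<phi> ^^ k) x} = l}"

end

theory Submission
  imports Defs
begin

text \<open>
  Elements of the reduced algebra are treated as Cauchy sequences of functions on the groupoid.

  Simplicity implies 2): for \<open>V = U \<inter> X\<^bsub>k,l\<^esub>\<close>, the limits of compactly supported functions \<open>f\<close> for which
  some \<open>M\<close> bounds the number of forward and backward steps from \<open>V\<close> to the ranges of the arrows in
  the support of \<open>f\<close> form a closed ideal.  It is nonzero, because multiples of the indicator function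
  of \<open>X\<^bsub>k,l\<^esub>\<close> lie in the algebra, and if it contains the unit then finitely many steps lead from \<open>V\<close> to
  every point.

  Conversely, let \<open>I\<close> be a nonzero closed ideal.  Every element of the algebra is a limit of
  functions that are continuous for the topology on \<open>X\<close> refined by the functions
  \<open>x \<mapsto> #\<phi>\<^sup>-\<^sup>p(\<phi>\<^sup>q x)\<close>, and after pulling back along a power of \<open>\<phi>\<close> these become continuous on each
  \<open>X\<^bsub>k,l\<^esub>\<close>.  By 2), for \<open>a \<noteq> b\<close> the points with \<open>\<phi>\<^sup>a x \<noteq> \<phi>\<^sup>b x\<close> are dense in every \<open>X\<^bsub>k,l\<^esub>\<close>.
  Compressing a positive element of \<open>I\<close> to a small neighbourhood of such a point gives
  an element of \<open>I\<close> that is at distance less than 1 from a function supported on the unit space.  A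
  geometric series argument turns this into a function on the unit space that lies in \<open>I\<close> and equals 1
  on some \<open>U \<inter> X\<^bsub>k,l\<^esub>\<close>.  By 2) the sum of its images under finitely many transfer operators of
  powers of \<open>\<phi>\<close> is at least 1 everywhere, hence invertible.
\<close>

section \<open>Completions\<close>

text \<open>The obstacle is that \<open>\<phi>\<close> need not be open: a point of a fibre can
  disappear under a small perturbation, so fibre counts jump and the convolution of two continuous
  functions need not be continuous. This is why 2) speaks of the sets X_{k,l}, on each of which one
  fibre count is constant, and why the work takes place among bounded functions. All norm estimates
  are estimates of matrices. On the source fibre over w a function f acts by the matrix with entries
  f(p q^{-1}); rows and columns have boundedly many nonzero entries, and the norm is tested on
  finite sets of indices. To place a unit in an ideal it is enough to approximate it at distance
  less than 1. In the converse a positive element u u^* is taken because its value at a unit is a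
  sum of squares and so cannot cancel. Two errors remain, each at most 1/3 after division by that
  value, which leaves distance at most 2/3. Noninjectivity serves to exclude an identity \<phi>^a =
  \<phi>^b with a and b distinct: by surjectivity it would turn a positive power of \<phi> into the
  identity.\<close>

locale pre_star_algebra =
  fixes A :: "'b normed_star_algebra"
  assumes zero_closed: "azero A \<in> elements A"
    and add_closed: "\<lbrakk>a \<in> elements A; b \<in> elements A\<rbrakk> \<Longrightarrow> aadd A a b \<in> elements A"
    and scale_closed: "a \<in> elements A \<Longrightarrow> ascale A c a \<in> elements A"
    and mult_closed: "\<lbrakk>a \<in> elements A; b \<in> elements A\<rbrakk> \<Longrightarrow> amult A a b \<in> elements A"
    and star_closed: "a \<in> elements A \<Longrightarrow> astar A a \<in> elements A"
    and dist_refl: "a \<in> elements A \<Longrightarrow> adist A a a = 0"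
    and dist_sym: "\<lbrakk>a \<in> elements A; b \<in> elements A\<rbrakk> \<Longrightarrow> adist A a b = adist A b a"
    and dist_triangle: "\<lbrakk>a \<in> elements A; b \<in> elements A; d \<in> elements A\<rbrakk> \<Longrightarrow>
      adist A a d \<le> adist A a b + adist A b d"
    and dist_add: "\<lbrakk>a \<in> elements A; b \<in> elements A; a' \<in> elements A; b' \<in> elements A\<rbrakk> \<Longrightarrow>
      adist A (aadd A a b) (aadd A a' b') \<le> adist A a a' + adist A b b'"
    and dist_scale: "\<lbrakk>a \<in> elements A; a' \<in> elements A\<rbrakk> \<Longrightarrow>
      adist A (ascale A c a) (ascale A c a') \<le> cmod c * adist A a a'"
    and dist_mult: "\<lbrakk>a \<in> elements A; b \<in> elements A; a' \<in> elements A; b' \<in> elements A\<rbrakk> \<Longrightarrow>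
      adist A (amult A a b) (amult A a' b') \<le> anorm A a * adist A b b' + adist A a a' * anorm A b'"
    and dist_star: "\<lbrakk>a \<in> elements A; a' \<in> elements A\<rbrakk> \<Longrightarrow>
      adist A (astar A a) (astar A a') \<le> adist A a a'"
    and norm_dist: "\<lbrakk>a \<in> elements A; b \<in> elements A\<rbrakk> \<Longrightarrow> \<bar>anorm A a - anorm A b\<bar> \<le> adist A a b"
begin

abbreviation "E \<equiv> elements A"
abbreviation "cauchy \<equiv> cauchy_seqs A"

definition cls :: "(nat \<Rightarrow> 'b) \<Rightarrow> (nat \<Rightarrow> 'b) set" where
  "cls u = null_rel A `` {u}"

text \<open>This is the closure of the image of \<open>S\<close> in the completion when
  \<open>S\<close> consists of elements (see \<open>norm_closed_limit_classes\<close>). Properties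
  of functions on the groupoid are carried to elements of the completion in this form.\<close>

definition limit_classes :: "'b set \<Rightarrow> (nat \<Rightarrow> 'b) set set" where
  "limit_classes S = {cls u | u. u \<in> cauchy \<and> range u \<subseteq> S}"

lemma dist_nonneg: "\<lbrakk>a \<in> E; b \<in> E\<rbrakk> \<Longrightarrow> 0 \<le> adist A a b"
  using dist_triangle[of a b a] dist_refl[of a] dist_sym[of a b] by simp

lemma cauchy_in: "u \<in> cauchy \<Longrightarrow> u n \<in> E"
  by (simp add: cauchy_seqs_def)

lemma cauchyD: "u \<in> cauchy \<Longrightarrow> 0 < e \<Longrightarrow> \<exists>N. \<forall>m\<ge>N. \<forall>n\<ge>N. adist A (u m) (u n) < e"
  by (simp add: cauchy_seqs_def)

lemma cauchy_const: "a \<in> E \<Longrightarrow> (\<lambda>n. a) \<in> cauchy"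
  by (simp add: cauchy_seqs_def dist_refl)

lemma cauchy_bounded:
  assumes u: "u \<in> cauchy"
  obtains K where "K > 0" "\<And>n. \<bar>anorm A (u n)\<bar> \<le> K"
proof -
  obtain N where N: "\<forall>m\<ge>N. \<forall>n\<ge>N. adist A (u m) (u n) < 1"
    using cauchyD[OF u, of 1] by auto
  define K where "K = 1 + \<bar>anorm A (u N)\<bar> + (\<Sum>n<N. \<bar>anorm A (u n)\<bar>)"
  have "\<bar>anorm A (u n)\<bar> \<le> K" for n
  proof (cases "n < N")
    case True
    then have "\<bar>anorm A (u n)\<bar> \<le> (\<Sum>n<N. \<bar>anorm A (u n)\<bar>)"
      by (intro member_le_sum) auto
    then show ?thesis by (simp add: K_def)
  next
    case False
    then have "adist A (u n) (u N) < 1" using N by simp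
    moreover have "\<bar>anorm A (u n) - anorm A (u N)\<bar> \<le> adist A (u n) (u N)"
      using u by (intro norm_dist cauchy_in)
    moreover have "(\<Sum>n<N. \<bar>anorm A (u n)\<bar>) \<ge> 0" by (simp add: sum_nonneg)
    ultimately show ?thesis unfolding K_def by linarith
  qed
  moreover have "K > 0"
    by (simp add: K_def add_pos_nonneg sum_nonneg)
  ultimately show ?thesis by (rule that[rotated])
qed

text \<open>Two comparison sequences let one criterion serve unary and binary operations; the unary
  ones use the same sequence twice.\<close>

lemma cauchy_if_dist_le:
  assumes v: "\<And>n. v n \<in> E" and u: "u \<in> cauchy" and u': "u' \<in> cauchy" and "K \<ge> 0"
    and le: "\<And>m n. adist A (v m) (v n) \<le> K * (adist A (u m) (u n) + adist A (u' m) (u' n))"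
  shows "v \<in> cauchy"
  unfolding cauchy_seqs_def
proof (intro CollectI conjI allI impI v)
  fix e :: real assume e: "e > 0"
  \<comment> \<open>\<open>K\<close> may be 0, so the positive \<open>L\<close> replaces it in the
    denominator.\<close>
  define L where "L = K + 1"
  have L: "L > 0" using \<open>K \<ge> 0\<close> by (simp add: L_def)
  define e' where "e' = e / (2 * L)"
  have e': "e' > 0" using e L by (simp add: e'_def)
  obtain N where N: "\<forall>m\<ge>N. \<forall>n\<ge>N. adist A (u m) (u n) < e'" using cauchyD[OF u e'] by blast
  obtain N' where N': "\<forall>m\<ge>N'. \<forall>n\<ge>N'. adist A (u' m) (u' n) < e'" using cauchyD[OF u' e'] by blast
  have "adist A (v m) (v n) < e" if "m \<ge> max N N'" "n \<ge> max N N'" for m n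
  proof -
    have "adist A (u m) (u n) + adist A (u' m) (u' n) \<le> 2 * e'"
      using N N' that by (smt (verit) max.bounded_iff)
    then have "adist A (v m) (v n) \<le> K * (2 * e')"
      using le[of m n] \<open>K \<ge> 0\<close> by (smt (verit) mult_left_mono)
    also have "\<dots> < L * (2 * e')" using e' by (simp add: L_def)
    also have "\<dots> = e" using L by (simp add: e'_def)
    finally show ?thesis .
  qed
  then show "\<exists>N. \<forall>m\<ge>N. \<forall>n\<ge>N. adist A (v m) (v n) < e" by blast
qed

lemma cauchy_add: "\<lbrakk>u \<in> cauchy; v \<in> cauchy\<rbrakk> \<Longrightarrow> (\<lambda>n. aadd A (u n) (v n)) \<in> cauchy"
  by (rule cauchy_if_dist_le[of _ u v 1]) (auto intro: add_closed cauchy_in dist_add)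

lemma cauchy_scale: "u \<in> cauchy \<Longrightarrow> (\<lambda>n. ascale A c (u n)) \<in> cauchy"
proof (rule cauchy_if_dist_le[of _ u u "cmod c"])
  fix m n assume u: "u \<in> cauchy"
  show "adist A (ascale A c (u m)) (ascale A c (u n))
     \<le> cmod c * (adist A (u m) (u n) + adist A (u m) (u n))"
    by (rule order_trans[OF dist_scale])
      (simp_all add: u cauchy_in dist_nonneg mult_left_mono)
qed (auto intro: scale_closed cauchy_in)

lemma cauchy_star: "u \<in> cauchy \<Longrightarrow> (\<lambda>n. astar A (u n)) \<in> cauchy"
proof (rule cauchy_if_dist_le[of _ u u 1])
  fix m n assume u: "u \<in> cauchy"
  show "adist A (astar A (u m)) (astar A (u n))
     \<le> 1 * (adist A (u m) (u n) + adist A (u m) (u n))"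
    by (rule order_trans[OF dist_star]) (auto intro!: u cauchy_in dist_nonneg)
qed (auto intro: star_closed cauchy_in)

lemma dist_mult_le:
  assumes "a \<in> E" "b \<in> E" "a' \<in> E" "b' \<in> E" "anorm A a \<le> K" "anorm A b' \<le> L"
  shows "adist A (amult A a b) (amult A a' b') \<le> K * adist A b b' + L * adist A a a'"
proof -
  have "anorm A a * adist A b b' \<le> K * adist A b b'"
    by (intro mult_right_mono assms dist_nonneg)
  moreover have "adist A a a' * anorm A b' \<le> L * adist A a a'"
    using mult_right_mono[OF assms(6) dist_nonneg[OF assms(1,3)]] by (simp add: mult.commute)
  ultimately show ?thesis
    using dist_mult[OF assms(1-4)] by linarith
qed

lemma cauchy_mult:
  assumes u: "u \<in> cauchy" and v: "v \<in> cauchy"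
  shows "(\<lambda>n. amult A (u n) (v n)) \<in> cauchy"
proof -
  obtain K where K: "K > 0" "\<And>n. \<bar>anorm A (u n)\<bar> \<le> K" by (rule cauchy_bounded[OF u]) blast
  obtain L where L: "L > 0" "\<And>n. \<bar>anorm A (v n)\<bar> \<le> L" by (rule cauchy_bounded[OF v]) blast
  show ?thesis
  proof (rule cauchy_if_dist_le[OF _ u v, of _ "max K L"])
    fix m n
    have 1: "anorm A (u m) \<le> max K L" "anorm A (v n) \<le> max K L"
      using K(2)[of m] L(2)[of n] by auto
    show "adist A (amult A (u m) (v m)) (amult A (u n) (v n))
      \<le> max K L * (adist A (u m) (u n) + adist A (v m) (v n))"
      using dist_mult_le[OF cauchy_in[OF u, of m] cauchy_in[OF v, of m] cauchy_in[OF u, of n]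
        cauchy_in[OF v, of n] 1]
      by (simp add: algebra_simps)
  qed (use K in \<open>auto intro: mult_closed cauchy_in u v\<close>)
qed

lemma null_relI: "\<lbrakk>u \<in> cauchy; v \<in> cauchy; (\<lambda>n. adist A (u n) (v n)) \<longlonglongrightarrow> 0\<rbrakk> \<Longrightarrow> (u, v) \<in> null_rel A"
  by (simp add: null_rel_def)

lemma null_relD:
  "(u, v) \<in> null_rel A \<Longrightarrow> u \<in> cauchy \<and> v \<in> cauchy \<and> (\<lambda>n. adist A (u n) (v n)) \<longlonglongrightarrow> 0"
  by (simp add: null_rel_def)

lemma dist_null_mono:
  assumes "\<And>n. v n \<in> E" "\<And>n. v' n \<in> E" "f \<longlonglongrightarrow> 0" "\<And>n. adist A (v n) (v' n) \<le> f n"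
  shows "(\<lambda>n. adist A (v n) (v' n)) \<longlonglongrightarrow> 0"
  by (rule tendsto_sandwich[of "\<lambda>n. 0" _ _ f])
    (use assms in \<open>auto simp: dist_nonneg\<close>)

lemma equiv_null_rel: "equiv cauchy (null_rel A)"
proof (rule equivI)
  show "null_rel A \<subseteq> cauchy \<times> cauchy" by (auto simp: null_rel_def)
  show "refl_on cauchy (null_rel A)"
    by (auto simp: refl_on_def null_rel_def dist_refl cauchy_in)
  show "sym (null_rel A)"
    by (rule symI) (auto simp: null_rel_def dist_sym cauchy_in)
  show "trans (null_rel A)"
  proof (rule transI)
    fix u v w assume uv: "(u, v) \<in> null_rel A" and vw: "(v, w) \<in> null_rel A"
    note * = null_relD[OF uv] null_relD[OF vw]
    have "(\<lambda>n. adist A (u n) (v n) + adist A (v n) (w n)) \<longlonglongrightarrow> 0"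
      using tendsto_add[of _ 0 _ _ 0] * by fastforce
    then have "(\<lambda>n. adist A (u n) (w n)) \<longlonglongrightarrow> 0"
      by (rule dist_null_mono[rotated 2]) (use * in \<open>auto intro: dist_triangle cauchy_in\<close>)
    then show "(u, w) \<in> null_rel A" using * by (simp add: null_relI)
  qed
qed

lemma cls_in: "u \<in> cauchy \<Longrightarrow> cls u \<in> elements (completion A)"
  by (auto simp: completion_def cls_def quotientI)

lemma completion_cases:
  assumes "P \<in> elements (completion A)"
  obtains u where "u \<in> cauchy" "P = cls u"
  using assms by (auto simp: completion_def cls_def elim: quotientE)

lemma cls_eq_iff: "\<lbrakk>u \<in> cauchy; v \<in> cauchy\<rbrakk> \<Longrightarrow>
    cls u = cls v \<longleftrightarrow> (\<lambda>n. adist A (u n) (v n)) \<longlonglongrightarrow> 0"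
  unfolding cls_def using eq_equiv_class_iff[OF equiv_null_rel] by (auto simp: null_rel_def)

lemma to_completion_eq: "to_completion A a = cls (\<lambda>n. a)"
  by (simp add: to_completion_def cls_def)

lemma completion_zero: "azero (completion A) = cls (\<lambda>n. azero A)"
  by (simp add: completion_def cls_def)

lemma cls_eqI:
  assumes "v \<in> cauchy" "v' \<in> cauchy" "(\<lambda>n. adist A (v n) (v' n)) \<longlonglongrightarrow> 0"
  shows "null_rel A `` {v} = null_rel A `` {v'}"
  using cls_eq_iff[OF assms(1,2)] assms(3) by (simp add: cls_def)

text \<open>The union over representatives collapses to one class once the operation respects
  \<open>null_rel\<close>. The other operations follow the same pattern; for products the
  boundedness of Cauchy sequences is needed as well.\<close>

lemma completion_scale:
  assumes u: "u \<in> cauchy"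
  shows "ascale (completion A) c (cls u) = cls (\<lambda>n. ascale A c (u n))"
proof -
  have "(\<lambda>p. null_rel A `` {\<lambda>n. ascale A c (p n)}) respects null_rel A"
  proof (rule congruentI)
    fix u v assume uv: "(u, v) \<in> null_rel A"
    note * = null_relD[OF uv]
    have "(\<lambda>n. cmod c * adist A (u n) (v n)) \<longlonglongrightarrow> 0"
      using tendsto_mult_right_zero * by blast
    then have "(\<lambda>n. adist A (ascale A c (u n)) (ascale A c (v n))) \<longlonglongrightarrow> 0"
      by (rule dist_null_mono[rotated 2]) (use * in \<open>auto intro: scale_closed dist_scale cauchy_in\<close>)
    then show "null_rel A `` {\<lambda>n. ascale A c (u n)} = null_rel A `` {\<lambda>n. ascale A c (v n)}"
      using * by (intro cls_eqI cauchy_scale) auto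
  qed
  from UN_equiv_class[OF equiv_null_rel this u] show ?thesis
    by (simp add: completion_def cls_def)
qed

lemma completion_star:
  assumes u: "u \<in> cauchy"
  shows "astar (completion A) (cls u) = cls (\<lambda>n. astar A (u n))"
proof -
  have "(\<lambda>p. null_rel A `` {\<lambda>n. astar A (p n)}) respects null_rel A"
  proof (rule congruentI)
    fix u v assume uv: "(u, v) \<in> null_rel A"
    note * = null_relD[OF uv]
    have "(\<lambda>n. adist A (astar A (u n)) (astar A (v n))) \<longlonglongrightarrow> 0"
      by (rule dist_null_mono[of _ _ "\<lambda>n. adist A (u n) (v n)"])
        (use * in \<open>auto intro: star_closed dist_star cauchy_in\<close>)
    then show "null_rel A `` {\<lambda>n. astar A (u n)} = null_rel A `` {\<lambda>n. astar A (v n)}"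
      using * by (intro cls_eqI cauchy_star) auto
  qed
  from UN_equiv_class[OF equiv_null_rel this u] show ?thesis
    by (simp add: completion_def cls_def)
qed

lemma completion_add:
  assumes u: "u \<in> cauchy" and v: "v \<in> cauchy"
  shows "aadd (completion A) (cls u) (cls v) = cls (\<lambda>n. aadd A (u n) (v n))"
proof -
  have "congruent2 (null_rel A) (null_rel A) (\<lambda>p q. null_rel A `` {\<lambda>n. aadd A (p n) (q n)})"
  proof (rule congruent2I')
    fix u u' v v' assume "(u, u') \<in> null_rel A" "(v, v') \<in> null_rel A"
    note * = null_relD[OF this(1)] null_relD[OF this(2)]
    have "(\<lambda>n. adist A (u n) (u' n) + adist A (v n) (v' n)) \<longlonglongrightarrow> 0"
      using tendsto_add[of _ 0 _ _ 0] * by fastforce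
    then have "(\<lambda>n. adist A (aadd A (u n) (v n)) (aadd A (u' n) (v' n))) \<longlonglongrightarrow> 0"
      by (rule dist_null_mono[rotated 2]) (use * in \<open>auto intro: add_closed dist_add cauchy_in\<close>)
    then show "null_rel A `` {\<lambda>n. aadd A (u n) (v n)} = null_rel A `` {\<lambda>n. aadd A (u' n) (v' n)}"
      using * by (intro cls_eqI cauchy_add) auto
  qed
  from UN_equiv_class2[OF equiv_null_rel equiv_null_rel this u v] show ?thesis
    by (simp add: completion_def cls_def)
qed

lemma completion_mult:
  assumes u: "u \<in> cauchy" and v: "v \<in> cauchy"
  shows "amult (completion A) (cls u) (cls v) = cls (\<lambda>n. amult A (u n) (v n))"
proof -
  have "congruent2 (null_rel A) (null_rel A) (\<lambda>p q. null_rel A `` {\<lambda>n. amult A (p n) (q n)})"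
  proof (rule congruent2I')
    fix u u' v v' assume "(u, u') \<in> null_rel A" "(v, v') \<in> null_rel A"
    note * = null_relD[OF this(1)] null_relD[OF this(2)]
    obtain K where K: "\<And>n. \<bar>anorm A (u n)\<bar> \<le> K" by (rule cauchy_bounded[of u]) (use * in auto)
    obtain L where L: "\<And>n. \<bar>anorm A (v' n)\<bar> \<le> L" by (rule cauchy_bounded[of v']) (use * in auto)
    have KL: "anorm A (u n) \<le> K" "anorm A (v' n) \<le> L" for n
      using K[of n] L[of n] by auto
    have "(\<lambda>n. K * adist A (v n) (v' n) + L * adist A (u n) (u' n)) \<longlonglongrightarrow> K * 0 + L * 0"
      using * by (intro tendsto_intros) auto
    then have "(\<lambda>n. K * adist A (v n) (v' n) + L * adist A (u n) (u' n)) \<longlonglongrightarrow> 0" by simp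
    then have lim: "(\<lambda>n. adist A (amult A (u n) (v n)) (amult A (u' n) (v' n))) \<longlonglongrightarrow> 0"
      by (rule dist_null_mono[rotated 2]) (simp_all add: mult_closed dist_mult_le KL cauchy_in *)
    show "null_rel A `` {\<lambda>n. amult A (u n) (v n)} = null_rel A `` {\<lambda>n. amult A (u' n) (v' n)}"
      by (rule cls_eqI[OF cauchy_mult cauchy_mult lim]) (simp_all add: *)
  qed
  from UN_equiv_class2[OF equiv_null_rel equiv_null_rel this u v] show ?thesis
    by (simp add: completion_def cls_def)
qed

lemma convergent_norm: "u \<in> cauchy \<Longrightarrow> convergent (\<lambda>n. anorm A (u n))"
proof (rule Cauchy_convergent, rule metric_CauchyI)
  fix e :: real assume u: "u \<in> cauchy" and "e > 0"
  then obtain N where N: "\<forall>m\<ge>N. \<forall>n\<ge>N. adist A (u m) (u n) < e" using cauchyD by blast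
  have "dist (anorm A (u m)) (anorm A (u n)) < e" if "m \<ge> N" "n \<ge> N" for m n
    using norm_dist[OF cauchy_in cauchy_in, OF u u, of m n] N that by (force simp: dist_real_def)
  then show "\<exists>N. \<forall>m\<ge>N. \<forall>n\<ge>N. dist (anorm A (u m)) (anorm A (u n)) < e" by blast
qed

text \<open>The norm of a class is computed on one chosen representative. Any other representative
  differs from it by a null sequence, so the norms have the same limit.\<close>

lemma completion_norm:
  assumes u: "u \<in> cauchy"
  shows "(\<lambda>n. anorm A (u n)) \<longlonglongrightarrow> anorm (completion A) (cls u)"
proof -
  define v where "v = (SOME p. p \<in> cls u)"
  have "u \<in> cls u" using u equiv_class_self[OF equiv_null_rel] by (simp add: cls_def)
  then have "v \<in> cls u" unfolding v_def by (rule someI[of "\<lambda>p. p \<in> cls u"])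
  then have *: "(u, v) \<in> null_rel A" by (simp add: cls_def)
  note uv = null_relD[OF this]
  have "(\<lambda>n. anorm A (v n)) \<longlonglongrightarrow> lim (\<lambda>n. anorm A (v n))"
    using convergent_norm[of v] uv by (simp add: convergent_LIMSEQ_iff)
  moreover have "(\<lambda>n. anorm A (u n) - anorm A (v n)) \<longlonglongrightarrow> 0"
  proof (rule Lim_null_comparison)
    show "(\<lambda>n. adist A (u n) (v n)) \<longlonglongrightarrow> 0" using uv by simp
    show "\<forall>\<^sub>F n in sequentially. norm (anorm A (u n) - anorm A (v n)) \<le> adist A (u n) (v n)"
      using uv by (simp add: norm_dist cauchy_in)
  qed
  ultimately have "(\<lambda>n. anorm A (u n)) \<longlonglongrightarrow> lim (\<lambda>n. anorm A (v n))"
    by (rule Lim_transform)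
  then show ?thesis by (simp add: completion_def v_def)
qed

lemma completion_dist:
  assumes u: "u \<in> cauchy" and v: "v \<in> cauchy"
  shows "(\<lambda>n. adist A (u n) (v n)) \<longlonglongrightarrow> adist (completion A) (cls u) (cls v)"
  unfolding adist_def
  using completion_norm[OF cauchy_add[OF u cauchy_scale[OF v, of "-1"]]]
  by (simp add: completion_scale completion_add u v cauchy_scale)

lemma limit_classesI: "\<lbrakk>u \<in> cauchy; \<And>n. u n \<in> S\<rbrakk> \<Longrightarrow> cls u \<in> limit_classes S"
  by (auto simp: limit_classes_def)

text \<open>Diagonal argument: from the approximating classes pick elements \<open>b k\<close> of
  \<open>S\<close> that are close to a whole tail of a representative \<open>w\<close>; then
  \<open>b\<close> is Cauchy and represents the same class.\<close>

lemma norm_closed_limit_classes: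
  assumes S: "S \<subseteq> E"
  shows "norm_closed (completion A) (limit_classes S)"
  unfolding norm_closed_def
proof (intro ballI impI)
  fix P assume "P \<in> elements (completion A)"
    and ap: "\<forall>e>0. \<exists>b\<in>limit_classes S. adist (completion A) P b < e"
  then obtain w where w: "w \<in> cauchy" "P = cls w" by (blast elim: completion_cases)
  \<comment> \<open>One \<open>1 / real (Suc k)\<close> is spent on the approximating class and one
    on the oscillation of \<open>w\<close>. The bound holds along a tail of \<open>w\<close>, which
    is what allows later comparisons.\<close>
  have "\<exists>b N. b \<in> S \<and> (\<forall>m\<ge>N. adist A (w m) b < 2 / real (Suc k))" for k
  proof -
    obtain v where v: "v \<in> cauchy" "range v \<subseteq> S" "adist (completion A) P (cls v) < 1 / real (Suc k)"
      using ap by (auto simp: limit_classes_def) (metis of_nat_0_less_iff zero_less_Suc zero_less_divide_1_iff of_nat_Suc)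
    have "\<forall>\<^sub>F n in sequentially. adist A (w n) (v n) < 1 / real (Suc k)"
      using completion_dist[OF w(1) v(1)] v(3) w(2) by (intro order_tendstoD) auto
    then obtain N1 where N1: "\<And>n. n \<ge> N1 \<Longrightarrow> adist A (w n) (v n) < 1 / real (Suc k)"
      by (auto simp: eventually_sequentially)
    obtain N2 where N2: "\<forall>m\<ge>N2. \<forall>n\<ge>N2. adist A (w m) (w n) < 1 / real (Suc k)"
      using cauchyD[OF w(1), of "1 / real (Suc k)"] by auto
    define n where "n = max N1 N2"
    have "adist A (w m) (v n) < 2 / real (Suc k)" if "m \<ge> N2" for m
    proof -
      have "adist A (w m) (v n) \<le> adist A (w m) (w n) + adist A (w n) (v n)"
        using w v by (intro dist_triangle cauchy_in)
      also have "\<dots> < 1 / real (Suc k) + 1 / real (Suc k)"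
        using N1[of n] N2 that by (intro add_strict_mono) (auto simp: n_def)
      finally show ?thesis by simp
    qed
    then show ?thesis using v(2) by blast
  qed
  then obtain b N where b: "\<And>k. b k \<in> S" "\<And>k m. m \<ge> N k \<Longrightarrow> adist A (w m) (b k) < 2 / real (Suc k)"
    by metis
  have bE: "b k \<in> E" for k using b(1) S by blast
  have lim: "(\<lambda>k. adist A (w k) (b k)) \<longlonglongrightarrow> 0"
  proof (rule LIMSEQ_I)
    fix e :: real assume e: "e > 0"
    obtain N1 where N1: "\<forall>m\<ge>N1. \<forall>n\<ge>N1. adist A (w m) (w n) < e / 2"
      using cauchyD[OF w(1), of "e / 2"] e by auto
    obtain N2 where N2: "4 / e < real N2" using reals_Archimedean2 by blast
    have "norm (adist A (w k) (b k) - 0) < e" if k: "k \<ge> max N1 N2" for k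
    proof -
      \<comment> \<open>The index \<open>k\<close> may lie before \<open>N k\<close>, so
        \<open>w k\<close> and \<open>b k\<close> are compared through a later term of
        \<open>w\<close>.\<close>
      define m where "m = max N1 (N k)"
      have "adist A (w k) (b k) \<le> adist A (w k) (w m) + adist A (w m) (b k)"
        by (intro dist_triangle cauchy_in[OF w(1)] bE)
      moreover have "adist A (w k) (w m) < e / 2" using N1 k by (simp add: m_def)
      moreover have "adist A (w m) (b k) < 2 / real (Suc k)" by (rule b(2)) (simp add: m_def)
      moreover have "2 / real (Suc k) \<le> e / 2"
      proof -
        have "4 / e < real (Suc k)" using N2 k by linarith
        then show ?thesis using e by (simp add: field_simps)
      qed
      ultimately show ?thesis
        using dist_nonneg[OF cauchy_in[OF w(1), of k] bE[of k]] by simp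
    qed
    then show "\<exists>no. \<forall>n\<ge>no. norm (adist A (w n) (b n) - 0) < e" by blast
  qed
  have "b \<in> cauchy"
    unfolding cauchy_seqs_def
  proof (intro CollectI conjI allI impI bE)
    fix e :: real assume e: "e > 0"
    obtain N1 where N1: "\<forall>m\<ge>N1. \<forall>n\<ge>N1. adist A (w m) (w n) < e / 3"
      using cauchyD[OF w(1), of "e / 3"] e by auto
    obtain N2 where N2: "\<And>n. n \<ge> N2 \<Longrightarrow> adist A (w n) (b n) < e / 3"
      using order_tendstoD(2)[OF lim, of "e / 3"] e by (auto simp: eventually_sequentially)
    have "adist A (b m) (b n) < e" if "m \<ge> max N1 N2" "n \<ge> max N1 N2" for m n
    proof -
      have "adist A (b m) (b n) \<le> adist A (b m) (w m) + adist A (w m) (b n)"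
        by (intro dist_triangle cauchy_in[OF w(1)] bE)
      moreover have "adist A (w m) (b n) \<le> adist A (w m) (w n) + adist A (w n) (b n)"
        by (intro dist_triangle cauchy_in[OF w(1)] bE)
      moreover have "adist A (b m) (w m) = adist A (w m) (b m)"
        by (intro dist_sym cauchy_in[OF w(1)] bE)
      moreover have "adist A (w m) (w n) < e / 3" "adist A (w m) (b m) < e / 3" "adist A (w n) (b n) < e / 3"
        using N1 N2 that by auto
      ultimately show ?thesis by linarith
    qed
    then show "\<exists>N. \<forall>m\<ge>N. \<forall>n\<ge>N. adist A (b m) (b n) < e" by blast
  qed
  then have "P = cls b"
    using lim w by (simp add: cls_eq_iff)
  with \<open>b \<in> cauchy\<close> b(1) show "P \<in> limit_classes S"
    by (simp add: limit_classesI)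
qed

lemma limit_classes_cases:
  assumes "P \<in> limit_classes S"
  obtains u where "u \<in> cauchy" "\<And>n. u n \<in> S" "P = cls u"
  using assms by (auto simp: limit_classes_def)

lemma linear_subspace_limit_classes:
  assumes "azero A \<in> S" "\<And>a b. \<lbrakk>a \<in> S; b \<in> S\<rbrakk> \<Longrightarrow> aadd A a b \<in> S"
    "\<And>c a. a \<in> S \<Longrightarrow> ascale A c a \<in> S"
  shows "linear_subspace (completion A) (limit_classes S)"
  unfolding linear_subspace_def
  by (auto simp: completion_zero completion_add completion_scale elim!: limit_classes_cases
      intro!: limit_classesI assms cauchy_const cauchy_add cauchy_scale zero_closed cls_in)

lemma limit_classes_mult:
  assumes "\<And>a b. \<lbrakk>a \<in> S; b \<in> S'\<rbrakk> \<Longrightarrow> amult A a b \<in> S''"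
    and "P \<in> limit_classes S" "Q \<in> limit_classes S'"
  shows "amult (completion A) P Q \<in> limit_classes S''"
  using assms(2,3)
  by (auto simp: completion_mult elim!: limit_classes_cases intro!: limit_classesI assms(1) cauchy_mult)

lemma limit_classes_star:
  assumes "\<And>a. a \<in> S \<Longrightarrow> astar A a \<in> S'" and "P \<in> limit_classes S"
  shows "astar (completion A) P \<in> limit_classes S'"
  using assms(2)
  by (auto simp: completion_star elim!: limit_classes_cases intro!: limit_classesI assms(1) cauchy_star)

lemma elements_completion: "elements (completion A) = limit_classes E"
  by (auto intro: cls_in limit_classesI cauchy_in elim!: completion_cases limit_classes_cases)

text \<open>An upper bound for a generated algebra: it suffices to find a set of functions that
  contains the generators and is closed under the operations. It is applied to all elements and to
  the functions called \<open>tame\<close>.\<close>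

lemma cstar_generated_subset_limit_classes:
  assumes "S \<subseteq> E" "azero A \<in> S" "\<And>a b. \<lbrakk>a \<in> S; b \<in> S\<rbrakk> \<Longrightarrow> aadd A a b \<in> S"
    "\<And>c a. a \<in> S \<Longrightarrow> ascale A c a \<in> S" "\<And>a b. \<lbrakk>a \<in> S; b \<in> S\<rbrakk> \<Longrightarrow> amult A a b \<in> S"
    "\<And>a. a \<in> S \<Longrightarrow> astar A a \<in> S" "S0 \<subseteq> S"
  shows "elements (cstar_generated (completion A) (to_completion A ` S0)) \<subseteq> limit_classes S"
proof -
  have "cstar_subalgebra (completion A) (limit_classes S)"
    unfolding cstar_subalgebra_def
    by (intro conjI ballI linear_subspace_limit_classes limit_classes_mult[of S S]
      limit_classes_star[of S] norm_closed_limit_classes assms)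
  moreover have "to_completion A ` S0 \<subseteq> limit_classes S"
    using assms by (auto simp: to_completion_eq intro!: limit_classesI cauchy_const)
  ultimately show ?thesis
    by (auto simp: cstar_generated_def)
qed

lemma cstar_generated_superset: "S \<subseteq> elements (cstar_generated B S)"
  by (auto simp: cstar_generated_def)

lemma elements_cstar_generated:
  "elements (cstar_generated B S) = \<Inter>{B'. cstar_subalgebra B B' \<and> S \<subseteq> B'}"
  by (simp add: cstar_generated_def)

lemma cstar_subalgebra_Inter:
  assumes F: "\<And>B'. B' \<in> F \<Longrightarrow> cstar_subalgebra B B'" and sub: "\<Inter>F \<subseteq> elements B"
  shows "cstar_subalgebra B (\<Inter>F)"
proof -
  have "norm_closed B (\<Inter>F)"
    unfolding norm_closed_def
  proof (rule ballI, rule impI, rule InterI)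
    fix a B' assume a: "a \<in> elements B" "\<forall>e>0. \<exists>b\<in>\<Inter>F. adist B a b < e" and B': "B' \<in> F"
    from a(2) have "\<forall>e>0. \<exists>b\<in>B'. adist B a b < e" using B' by blast
    then show "a \<in> B'" using F[OF B'] a(1) by (simp add: cstar_subalgebra_def norm_closed_def)
  qed
  moreover have "azero B \<in> \<Inter>F"
    "\<forall>a\<in>\<Inter>F. \<forall>b\<in>\<Inter>F. aadd B a b \<in> \<Inter>F" "\<forall>c. \<forall>a\<in>\<Inter>F. ascale B c a \<in> \<Inter>F"
    "\<forall>a\<in>\<Inter>F. \<forall>b\<in>\<Inter>F. amult B a b \<in> \<Inter>F" "\<forall>a\<in>\<Inter>F. astar B a \<in> \<Inter>F"
    using F by (simp_all add: cstar_subalgebra_def linear_subspace_def)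
  ultimately show ?thesis
    using sub unfolding cstar_subalgebra_def linear_subspace_def by blast
qed

lemma cstar_subalgebra_cstar_generated:
  assumes "S0 \<subseteq> E"
  shows "cstar_subalgebra (completion A) (elements (cstar_generated (completion A) (to_completion A ` S0)))"
proof -
  \<comment> \<open>The generated algebra is an intersection over a family of subalgebras. It lies
    in the completion because the limits of all elements form one member of that family.\<close>
  have "elements (cstar_generated (completion A) (to_completion A ` S0)) \<subseteq> elements (completion A)"
    unfolding elements_completion
    by (rule cstar_generated_subset_limit_classes)
      (simp_all add: zero_closed add_closed scale_closed mult_closed star_closed assms)
  then show ?thesis
    unfolding elements_cstar_generated by (intro cstar_subalgebra_Inter) auto
qed

end

section \<open>The topology of the groupoid\<close>

locale locally_injective_surjection =
  fixes X :: "'a topology" and \<phi> :: "'a \<Rightarrow> 'a"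
  assumes compact: "compact_space X" and Hausdorff: "Hausdorff_space X"
    and cont: "continuous_map X X \<phi>" and linj: "locally_injective X \<phi>"
    and surj: "\<phi> ` topspace X = topspace X" and nonempty: "topspace X \<noteq> {}"
begin

abbreviation "T \<equiv> topspace X"
abbreviation "\<Gamma> \<equiv> Gamma_groupoid X \<phi>"
abbreviation "iter n \<equiv> \<phi> ^^ n"
abbreviation "\<X> \<equiv> Xkl X \<phi>"
abbreviation "\<G> \<equiv> Gamma_set X \<phi>"
abbreviation "\<T> \<equiv> Gamma_top X \<phi>"
abbreviation "\<B> \<equiv> Bc \<Gamma>"
abbreviation "\<A> \<equiv> Bc_algebra \<Gamma>"
abbreviation "\<C> \<equiv> completion \<A>"
abbreviation "L2 \<psi> F \<equiv> L2_set (\<lambda>p. cmod (\<psi> p)) F"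

section \<open>Iterates of the map and their finite fibres\<close>

lemma continuous_pow: "continuous_map X X (\<phi> ^^ n)"
proof (induction n)
  case (Suc n)
  from continuous_map_compose[OF this cont] show ?case by (simp add: o_def)
qed (simp add: id_def)

lemma pow_in: "x \<in> T \<Longrightarrow> iter n x \<in> T"
  using continuous_pow[of n] by (auto simp: continuous_map_def)

lemma pow_pow: "iter m (iter n x) = iter (m + n) x"
  by (simp add: funpow_add)

lemma surj_pow: "z \<in> T \<Longrightarrow> \<exists>x\<in>T. iter n x = z"
proof (induction n arbitrary: z)
  case (Suc n)
  obtain x where "x \<in> T" "z = \<phi> x" using Suc.prems surj by blast
  then show ?case using Suc.IH[of x] by auto
qed auto

lemma linj_pow:
  assumes "x \<in> T" obtains U where "openin X U" "x \<in> U" "inj_on (\<phi> ^^ n) U"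
proof -
  have "\<exists>U. openin X U \<and> x \<in> U \<and> inj_on (\<phi> ^^ n) U" using assms
  proof (induction n)
    case (Suc n)
    then obtain U where U: "openin X U" "x \<in> U" "inj_on (\<phi> ^^ n) U" by blast
    obtain V where V: "openin X V" "iter n x \<in> V" "inj_on \<phi> V"
      using linj pow_in[OF Suc.prems, of n] unfolding locally_injective_def by blast
    let ?W = "U \<inter> {y \<in> T. iter n y \<in> V}"
    have "openin X ?W"
      using U V openin_continuous_map_preimage[OF continuous_pow] by blast
    moreover have "inj_on (\<phi> ^^ Suc n) ?W"
    proof (rule inj_onI)
      fix y z assume yz: "y \<in> ?W" "z \<in> ?W" "iter (Suc n) y = iter (Suc n) z"
      then have "iter n y = iter n z" using V(3) by (auto dest: inj_onD)
      then show "y = z" using U(3) yz by (auto dest: inj_onD)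
    qed
    moreover have "x \<in> ?W" using U V Suc.prems by simp
    ultimately show ?case by blast
  qed (auto intro: exI[of _ T])
  then show thesis using that by blast
qed

lemma separate_points:
  assumes "x \<in> T" "y \<in> T" "x \<noteq> y"
  obtains U V where "openin X U" "openin X V" "x \<in> U" "y \<in> V" "U \<inter> V = {}"
  using Hausdorff assms unfolding Hausdorff_space_def disjnt_def by metis

definition fibre :: "nat \<Rightarrow> 'a \<Rightarrow> 'a set" where
  "fibre p w = {y \<in> T. iter p y = w}"

text \<open>By compactness finitely many open sets on which \<open>iter p\<close> is injective cover
  the space. Each of them contains at most one point of a given fibre, so their number is a bound
  independent of \<open>w\<close>.\<close>

lemma fibre_card_bound:
  obtains D where "\<And>w. finite (fibre p w)" "\<And>w. card (fibre p w) \<le> D"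
proof -
  let ?\<U> = "{U. openin X U \<and> inj_on (\<phi> ^^ p) U}"
  have "T \<subseteq> \<Union>?\<U>" using linj_pow[of _ p] by blast
  then obtain \<F> where F: "finite \<F>" "\<F> \<subseteq> ?\<U>" "T \<subseteq> \<Union>\<F>"
    using compact unfolding compact_space_def compactin_def by (metis (mono_tags, lifting) mem_Collect_eq)
  define c where "c y = (SOME U. U \<in> \<F> \<and> y \<in> U)" for y
  have c: "c y \<in> \<F>" "y \<in> c y" if "y \<in> T" for y
    using someI_ex[of "\<lambda>U. U \<in> \<F> \<and> y \<in> U"] that F(3) unfolding c_def by blast+
  have "inj_on c (fibre p w)" for w
  proof (rule inj_onI)
    fix y z assume "y \<in> fibre p w" "z \<in> fibre p w" "c y = c z"
    then show "y = z" using c[of y] c[of z] F(2) unfolding fibre_def by (auto dest: inj_onD)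
  qed
  moreover have "c ` fibre p w \<subseteq> \<F>" for w using c by (auto simp: fibre_def)
  ultimately show thesis
    using that[of "card \<F>"] F(1) by (meson card_inj_on_le inj_on_finite)
qed

lemma finite_fibre: "finite (fibre p w)"
  using fibre_card_bound by blast

text \<open>These are the sets \<open>Gamma_kn X \<phi> k n\<close> with
  \<open>k = int a - int b\<close> and \<open>n = b\<close>. Indexing them by two natural numbers
  removes the truncation in \<open>nat\<close> and makes the symmetry of the inverse
  visible.\<close>

definition Eab :: "nat \<Rightarrow> nat \<Rightarrow> ('a \<times> int \<times> 'a) set" where
  "Eab a b = {(x, k, y). x \<in> T \<and> y \<in> T \<and> k = int a - int b \<and> iter a x = iter b y}"

definition slab :: "nat \<Rightarrow> ('a \<times> int \<times> 'a) set" where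
  "slab n = (\<Union>a\<in>{..n}. \<Union>b\<in>{..n}. Eab a b)"

abbreviation "P \<equiv> prod_topology X (prod_topology (discrete_topology (UNIV :: int set)) X)"

lemma Eab_iff: "(x, k, y) \<in> Eab a b \<longleftrightarrow> x \<in> T \<and> y \<in> T \<and> k = int a - int b \<and> iter a x = iter b y"
  by (simp add: Eab_def)

lemma slab_iff: "(x, k, y) \<in> slab n \<longleftrightarrow> x \<in> T \<and> y \<in> T \<and>
    (\<exists>a\<le>n. \<exists>b\<le>n. k = int a - int b \<and> iter a x = iter b y)"
  by (auto simp: slab_def Eab_def)

lemma slab_mono: "m \<le> n \<Longrightarrow> slab m \<subseteq> slab n"
  unfolding slab_def by (fastforce intro: order_trans)

lemma Gamma_set_iff: "(x, k, y) \<in> \<G> \<longleftrightarrow> x \<in> T \<and> y \<in> T \<and>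
    (\<exists>a b. k = int a - int b \<and> iter a x = iter b y)"
  by (simp add: Gamma_set_def)

lemma Gamma_set_Eab: "\<G> = (\<Union>a b. Eab a b)"
proof (rule set_eqI)
  fix g show "g \<in> \<G> \<longleftrightarrow> g \<in> (\<Union>a b. Eab a b)"
    by (cases g) (simp add: Gamma_set_iff Eab_iff)
qed

lemma Gamma_slab: "g \<in> \<G> \<Longrightarrow> \<exists>n. g \<in> slab n"
proof -
  assume "g \<in> \<G>"
  then obtain a b where "g \<in> Eab a b" by (auto simp: Gamma_set_Eab)
  then have "g \<in> slab (a + b)" unfolding slab_def by fastforce
  then show ?thesis ..
qed

lemma slab_subset: "slab n \<subseteq> \<G>"
  by (auto simp: Gamma_set_Eab slab_def)

lemma Eab_subset: "Eab a b \<subseteq> \<G>"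
  by (auto simp: Gamma_set_Eab)

lemma Eab_in_slab: "a \<le> n \<Longrightarrow> b \<le> n \<Longrightarrow> Eab a b \<subseteq> slab n"
  by (auto simp: slab_def)

lemma Eab_add: "Eab a b \<subseteq> Eab (c + a) (c + b)"
  by (auto simp: Eab_def simp flip: pow_pow)

lemma Eab_Gamma_kn: "Eab a b = Gamma_kn X \<phi> (int a - int b) b"
proof -
  have "iter (nat (int a - int b + int i)) x = iter i y"
    if "iter a x = iter b y" "i \<ge> b" for i x y
  proof -
    have "nat (int a - int b + int i) = (i - b) + a" using that by simp
    then show ?thesis using that(1) by (simp flip: pow_pow) (simp add: pow_pow that)
  qed
  then show ?thesis by (fastforce simp: Eab_def Gamma_kn_def)
qed

lemma Gamma_kn_Eab: "0 \<le> int n + k \<Longrightarrow> Gamma_kn X \<phi> k n = Eab (nat (int n + k)) n"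
  by (simp add: Eab_Gamma_kn)

lemma Eab_subset_P: "Eab a b \<subseteq> topspace P"
  by (auto simp: Eab_def)

text \<open>The two nested final topologies merge into one: openness is tested on each piece
  \<open>Eab a b\<close> separately, with the topology inherited from the product.\<close>

lemma openin_Gamma_top: "openin (\<T>) W \<longleftrightarrow>
    W \<subseteq> \<G> \<and> (\<forall>a b. openin (subtopology P (Eab a b)) (W \<inter> Eab a b))" (is "?l \<longleftrightarrow> ?r")
proof -
  have ts: "topspace (Gamma_kn_top X \<phi> k n) = Gamma_kn X \<phi> k n" for k n
    by (auto simp: Gamma_kn_top_def Gamma_kn_def)
  have tsk: "topspace (Gamma_k_top X \<phi> k) = (\<Union>n\<in>{n. 0 \<le> int n + k}. Gamma_kn X \<phi> k n)" for k
    by (simp add: Gamma_k_top_def topspace_union_topology ts)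
  have all: "(\<Union>k. topspace (Gamma_k_top X \<phi> k)) = \<G>"
    using topspace_Gamma_top[of X \<phi>] by (simp add: Gamma_top_def topspace_union_topology)
  have "?l \<longleftrightarrow> W \<subseteq> \<G> \<and> (\<forall>k. openin (Gamma_k_top X \<phi> k) (W \<inter> topspace (Gamma_k_top X \<phi> k)))"
    by (simp add: Gamma_top_def openin_union_topology flip: all)
  also have "\<dots> \<longleftrightarrow> W \<subseteq> \<G> \<and>
      (\<forall>k. \<forall>n. 0 \<le> int n + k \<longrightarrow> openin (Gamma_kn_top X \<phi> k n) (W \<inter> Gamma_kn X \<phi> k n))"
  proof -
    have eq: "W \<inter> topspace (Gamma_k_top X \<phi> k) \<inter> Gamma_kn X \<phi> k n = W \<inter> Gamma_kn X \<phi> k n"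
      if "0 \<le> int n + k" for k n
      using that by (auto simp: tsk)
    have "openin (Gamma_k_top X \<phi> k) (W \<inter> topspace (Gamma_k_top X \<phi> k)) \<longleftrightarrow>
        (\<forall>n. 0 \<le> int n + k \<longrightarrow> openin (Gamma_kn_top X \<phi> k n) (W \<inter> Gamma_kn X \<phi> k n))" for k
    proof -
      have "openin (Gamma_k_top X \<phi> k) (W \<inter> topspace (Gamma_k_top X \<phi> k)) \<longleftrightarrow>
          (\<forall>n. 0 \<le> int n + k \<longrightarrow> openin (Gamma_kn_top X \<phi> k n)
            (W \<inter> topspace (Gamma_k_top X \<phi> k) \<inter> Gamma_kn X \<phi> k n))"
        by (subst Gamma_k_top_def, subst openin_union_topology) (auto simp: ts tsk)
      then show ?thesis by (simp add: eq)
    qed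
    then show ?thesis by simp
  qed
  also have "\<dots> \<longleftrightarrow> ?r"
  proof (intro conj_cong refl iffI allI impI)
    fix a b
    assume A: "\<forall>k n. 0 \<le> int n + k \<longrightarrow> openin (Gamma_kn_top X \<phi> k n) (W \<inter> Gamma_kn X \<phi> k n)"
    have "0 \<le> int b + (int a - int b)" by simp
    from A[rule_format, OF this] show "openin (subtopology P (Eab a b)) (W \<inter> Eab a b)"
      unfolding Gamma_kn_top_def Eab_Gamma_kn .
  next
    fix k n assume B: "\<forall>a b. openin (subtopology P (Eab a b)) (W \<inter> Eab a b)" and k: "0 \<le> int n + k"
    show "openin (Gamma_kn_top X \<phi> k n) (W \<inter> Gamma_kn X \<phi> k n)"
      unfolding Gamma_kn_top_def Gamma_kn_Eab[OF k] by (rule B[rule_format])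
  qed
  finally show ?thesis .
qed

lemma closedin_Eab: "closedin P (Eab a b)"
proof -
  have 1: "continuous_map P X (\<lambda>g. iter a (fst g))"
    using continuous_map_compose[OF continuous_map_fst continuous_pow] by (simp add: o_def)
  have 2: "continuous_map P X (\<lambda>g. iter b (snd (snd g)))"
    using continuous_map_compose[OF continuous_map_compose[OF continuous_map_snd continuous_map_snd] continuous_pow]
    by (simp add: o_def)
  have "closedin P {g \<in> topspace P. iter a (fst g) = iter b (snd (snd g))}"
    by (rule closedin_continuous_maps_eq[OF Hausdorff 1 2])
  moreover have "closedin P (T \<times> {int a - int b} \<times> T)"
    by (simp add: closedin_prod_Times_iff)
  moreover have "Eab a b = {g \<in> topspace P. iter a (fst g) = iter b (snd (snd g))} \<inter> (T \<times> {int a - int b} \<times> T)"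
    by (auto simp: Eab_def)
  ultimately show ?thesis by (simp only: closedin_Int)
qed

text \<open>Local injectivity makes the pieces open in one another. For equal degrees and
  \<open>c \<le> a\<close> the second piece lies in the first. Otherwise an arrow of
  \<open>Eab c d\<close> near a common point satisfies the shorter equation too, because
  \<open>iter e\<close> is injective near the common value of \<open>iter a x\<close> and
  \<open>iter b y\<close>.\<close>

lemma openin_Eab_Int: "openin (subtopology P (Eab c d)) (Eab a b \<inter> Eab c d)"
proof (cases "int a - int b = int c - int d")
  case False
  then have "Eab a b \<inter> Eab c d = {}" by (auto simp: Eab_def)
  then show ?thesis by simp
next
  case True
  show ?thesis
  proof (cases "c \<le> a")
    case c: True
    then have "Eab a b = Eab ((a - c) + c) ((a - c) + d)" using True by (simp add: algebra_simps) (metis True add_diff_cancel_left' diff_add_cancel diff_diff_eq2 of_nat_add of_nat_diff of_nat_eq_iff)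
    then have "Eab c d \<subseteq> Eab a b" using Eab_add by metis
    then have "Eab a b \<inter> Eab c d = Eab c d" by blast
    then show ?thesis using Eab_subset_P openin_topspace[of "subtopology P (Eab c d)"] by (simp add: Int_absorb1)
  next
    case False
    define e where "e = c - a"
    have e: "c = e + a" "d = e + b" using False True by (auto simp: e_def)
    show ?thesis
    proof (subst openin_subopen, rule ballI)
      fix g assume g: "g \<in> Eab a b \<inter> Eab c d"
      obtain x y where xy: "g = (x, int a - int b, y)" "x \<in> T" "y \<in> T" "iter a x = iter b y"
        using g by (auto simp: Eab_def)
      obtain U where U: "openin X U" "iter a x \<in> U" "inj_on (\<phi> ^^ e) U"
        using linj_pow[OF pow_in[OF xy(2), of a]] .
      let ?N = "{x \<in> T. iter a x \<in> U} \<times> UNIV \<times> {y \<in> T. iter b y \<in> U}"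
      have "openin P ?N"
        using U(1) openin_continuous_map_preimage[OF continuous_pow U(1)]
        by (simp add: openin_prod_Times_iff)
      then have "openin (subtopology P (Eab c d)) (?N \<inter> Eab c d)"
        by (auto simp: openin_subtopology)
      moreover have "g \<in> ?N \<inter> Eab c d" using g xy U by auto
      moreover have "?N \<inter> Eab c d \<subseteq> Eab a b \<inter> Eab c d"
        using U(3) by (auto simp: Eab_def e simp flip: pow_pow dest: inj_onD)
      ultimately show "\<exists>V. openin (subtopology P (Eab c d)) V \<and> g \<in> V \<and> V \<subseteq> Eab a b \<inter> Eab c d"
        by blast
    qed
  qed
qed

lemma openin_Gamma_Eab_Int:
  assumes "openin P O'"
  shows "openin (\<T>) (O' \<inter> Eab a b)"
  unfolding openin_Gamma_top
proof (intro conjI allI)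
  show "O' \<inter> Eab a b \<subseteq> \<G>" using Eab_subset by blast
  fix c d
  have "openin (subtopology P (Eab c d)) (O' \<inter> Eab c d)" using assms by (auto simp: openin_subtopology)
  from openin_Int[OF this openin_Eab_Int]
  show "openin (subtopology P (Eab c d)) (O' \<inter> Eab a b \<inter> Eab c d)"
    by (rule back_subst[of "openin _"]) blast
qed

lemma openin_Gamma_Eab: "openin (\<T>) (Eab a b)"
  using openin_Gamma_Eab_Int[OF openin_topspace, of a b] Eab_subset_P by (simp add: Int_absorb1)

lemma openin_Gamma_diff:
  assumes "\<And>c d. closedin P (C \<inter> Eab c d)"
  shows "openin (\<T>) (\<G> - C)"
  unfolding openin_Gamma_top
proof (intro conjI allI)
  fix c d
  have "openin P (topspace P - (C \<inter> Eab c d))" using assms by blast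
  then have "openin (subtopology P (Eab c d)) ((topspace P - (C \<inter> Eab c d)) \<inter> Eab c d)"
    by (auto simp: openin_subtopology)
  then show "openin (subtopology P (Eab c d)) ((\<G> - C) \<inter> Eab c d)"
    by (rule back_subst[of "openin _"]) (use Eab_subset Eab_subset_P in blast)
qed blast

lemma closedin_Gamma_slab: "closedin (\<T>) (slab n)"
proof -
  have "closedin P (slab n)" unfolding slab_def by (intro closedin_Union) (auto intro: closedin_Union closedin_Eab)
  then have "openin (\<T>) (\<G> - slab n)"
    by (intro openin_Gamma_diff closedin_Int closedin_Eab)
  then show ?thesis using slab_subset by (simp add: closedin_def topspace_Gamma_top)
qed

text \<open>On one piece the final topology can be replaced by that of the product. Compactness of
  the pieces and limits of continuous functions are transported along this inclusion.\<close>

lemma continuous_map_into_Gamma: "continuous_map (subtopology P (Eab a b)) (\<T>) (\<lambda>g. g)"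
proof -
  have "openin (subtopology P (Eab a b)) {g \<in> topspace (subtopology P (Eab a b)). g \<in> W}"
    if "openin (\<T>) W" for W
  proof -
    have "openin (subtopology P (Eab a b)) (W \<inter> Eab a b)" using that by (simp add: openin_Gamma_top)
    then show ?thesis by (rule back_subst[of "openin _"]) (use Eab_subset_P in auto)
  qed
  then show ?thesis
    using Eab_subset by (auto simp: continuous_map_def topspace_Gamma_top)
qed

lemma compactin_Gamma_Eab: "compactin (\<T>) (Eab a b)"
proof -
  have "compactin P (T \<times> {int a - int b} \<times> T)"
    using compact by (simp add: compactin_Times compact_space_def)
  then have "compactin P (Eab a b)"
    by (rule closed_compactin[OF _ _ closedin_Eab]) (auto simp: Eab_def)
  then have "compactin (subtopology P (Eab a b)) (Eab a b)"
    by (simp add: compactin_subtopology)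
  from image_compactin[OF this continuous_map_into_Gamma] show ?thesis by simp
qed

lemma compactin_Gamma_slab: "compactin (\<T>) (slab n)"
  unfolding slab_def by (intro compactin_Union) (auto intro: compactin_Union compactin_Gamma_Eab)

text \<open>The slabs are open and increase to the whole groupoid.\<close>

lemma compactin_Gamma_subset_slab:
  assumes "compactin (\<T>) K"
  obtains n where "K \<subseteq> slab n"
proof -
  have K: "K \<subseteq> \<G>" using compactin_subset_topspace[OF assms] by (simp add: topspace_Gamma_top)
  have "(\<forall>U \<in> range slab. openin (\<T>) U) \<and> K \<subseteq> \<Union>(range slab)"
    using K Gamma_slab unfolding slab_def by (fastforce intro!: openin_Union openin_Gamma_Eab)
  then obtain \<F> where F: "finite \<F>" "\<F> \<subseteq> range slab" "K \<subseteq> \<Union>\<F>"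
    using assms unfolding compactin_def by meson
  obtain I where I: "finite I" "\<F> = slab ` I" using finite_subset_image[OF F(1,2)] by blast
  have "slab i \<subseteq> slab (Max I)" if "i \<in> I" for i using that I(1) by (intro slab_mono) simp
  then show thesis using that[of "Max I"] F(3) I(2) by blast
qed

lemma \<Gamma>_simps [simp]: "arrows \<Gamma> = \<G>" "arrow_top \<Gamma> = \<T>"
  "src \<Gamma> (x, k, y) = (y, 0, y)" "rng \<Gamma> (x, k, y) = (x, 0, x)" "ginv \<Gamma> (x, k, y) = (y, - k, x)"
  "gmult \<Gamma> (x, k, y) (y', l, z) = (x, k + l, z)"
  by (simp_all add: Gamma_groupoid_def)

section \<open>Boundedness of the regular representations\<close>

text \<open>A slab is compact and closed, and every compact set lies in one. Hence compact support
  becomes support in some slab, and membership in \<open>\<B>\<close> turns into a condition on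
  supports and bounds without topology.\<close>

lemma Bc_iff: "f \<in> \<B> \<longleftrightarrow> (\<exists>n. \<forall>g. g \<notin> slab n \<longrightarrow> f g = 0) \<and> (\<exists>B. \<forall>g. cmod (f g) \<le> B)"
proof
  assume f: "f \<in> \<B>"
  let ?S = "{g \<in> \<G>. f g \<noteq> 0}"
  have 0: "\<forall>g. g \<notin> \<G> \<longrightarrow> f g = 0" and bd: "bounded (range f)"
    and "compactin (\<T>) (\<T> closure_of ?S)"
    using f unfolding Bc_def mem_Collect_eq \<Gamma>_simps by blast+
  from this(3) obtain n where n: "\<T> closure_of ?S \<subseteq> slab n" by (rule compactin_Gamma_subset_slab)
  have "?S \<subseteq> slab n" using n closure_of_subset[of ?S "\<T>"] by (auto simp: topspace_Gamma_top)
  then have "\<forall>g. g \<notin> slab n \<longrightarrow> f g = 0" using 0 by blast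
  moreover have "\<exists>B. \<forall>g. cmod (f g) \<le> B" using bd by (auto simp: bounded_iff)
  ultimately show "(\<exists>n. \<forall>g. g \<notin> slab n \<longrightarrow> f g = 0) \<and> (\<exists>B. \<forall>g. cmod (f g) \<le> B)" by blast
next
  assume "(\<exists>n. \<forall>g. g \<notin> slab n \<longrightarrow> f g = 0) \<and> (\<exists>B. \<forall>g. cmod (f g) \<le> B)"
  then obtain n B where n: "\<forall>g. g \<notin> slab n \<longrightarrow> f g = 0" and B: "\<forall>g. cmod (f g) \<le> B" by blast
  have "{g \<in> \<G>. f g \<noteq> 0} \<subseteq> slab n" using n by blast
  then have "\<T> closure_of {g \<in> \<G>. f g \<noteq> 0} \<subseteq> slab n"
    by (rule closure_of_minimal[OF _ closedin_Gamma_slab])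
  then have "compactin (\<T>) (\<T> closure_of {g \<in> \<G>. f g \<noteq> 0})"
    by (rule closed_compactin[OF compactin_Gamma_slab]) simp
  moreover have "bounded (range f)" using B unfolding bounded_iff by blast
  moreover have "\<forall>g. g \<notin> \<G> \<longrightarrow> f g = 0" using n slab_subset by blast
  ultimately show "f \<in> \<B>" unfolding Bc_def mem_Collect_eq \<Gamma>_simps by blast
qed

lemma Bc_cases:
  assumes "f \<in> \<B>"
  obtains n B where "\<And>g. g \<notin> slab n \<Longrightarrow> f g = 0" "B > 0" "\<And>g. cmod (f g) \<le> B"
proof -
  obtain n B where "\<forall>g. g \<notin> slab n \<longrightarrow> f g = 0" "\<forall>g. cmod (f g) \<le> B" using assms by (auto simp: Bc_iff)
  then show thesis using that[of n "max B 1"] by (auto simp: max.coboundedI1)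
qed

lemma BcI: "(\<And>g. g \<notin> slab n \<Longrightarrow> f g = 0) \<Longrightarrow> (\<And>g. cmod (f g) \<le> B) \<Longrightarrow> f \<in> \<B>"
  by (auto simp: Bc_iff)

lemma Bc_zero_off: "f \<in> \<B> \<Longrightarrow> g \<notin> \<G> \<Longrightarrow> f g = 0"
  unfolding Bc_def mem_Collect_eq \<Gamma>_simps by blast

text \<open>A function of the source point, placed on one piece. The case \<open>a = b = 0\<close>
  gives functions on the unit space, \<open>a = 0\<close> the partial shifts along
  \<open>\<phi>\<close>, and \<open>a = b = k\<close> with constant value 1 the relation of having
  the same image under \<open>iter k\<close>.\<close>

definition bis :: "nat \<Rightarrow> nat \<Rightarrow> ('a \<Rightarrow> complex) \<Rightarrow> ('a \<times> int \<times> 'a) \<Rightarrow> complex" where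
  "bis a b g = (\<lambda>(x, k, y). if (x, k, y) \<in> Eab a b then g y else 0)"

text \<open>A piece is both open and closed, so extension by zero keeps continuity.\<close>

lemma bis_in_Cc:
  assumes g: "continuous_map X euclidean g"
  shows "bis a b g \<in> Cc \<Gamma>"
proof -
  have "compactin euclidean (g ` T)" by (rule image_compactin[OF _ g]) (use compact in \<open>simp add: compact_space_def\<close>)
  then have "bounded (g ` T)" by (simp add: compact_imp_bounded)
  then obtain B where "\<forall>x\<in>T. cmod (g x) \<le> B" by (auto simp: bounded_iff)
  then have "cmod (bis a b g h) \<le> max B 0" for h
    by (cases h) (auto simp: bis_def Eab_iff max.coboundedI1)
  moreover have "bis a b g h = 0" if "h \<notin> slab (max a b)" for h
    using that Eab_in_slab[of a "max a b" b] by (cases h) (auto simp: bis_def)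
  ultimately have Bc: "bis a b g \<in> \<B>" by (rule BcI[rotated])
  have gP: "continuous_map P euclidean (\<lambda>h. g (snd (snd h)))"
    using continuous_map_compose[OF continuous_map_compose[OF continuous_map_snd continuous_map_snd] g]
    by (simp add: o_def)
  have "openin (\<T>) {h \<in> \<G>. bis a b g h \<in> V}" if V: "open V" for V
  proof -
    have 1: "openin (\<T>) ({h \<in> topspace P. g (snd (snd h)) \<in> V} \<inter> Eab a b)"
      using V by (intro openin_Gamma_Eab_Int openin_continuous_map_preimage[OF gP]) simp
    have 2: "openin (\<T>) (\<G> - Eab a b)"
      by (intro openin_Gamma_diff closedin_Int closedin_Eab)
    have "{h \<in> \<G>. bis a b g h \<in> V} =
        ({h \<in> topspace P. g (snd (snd h)) \<in> V} \<inter> Eab a b) \<union> (if 0 \<in> V then \<G> - Eab a b else {})"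
      using Eab_subset[of a b] Eab_subset_P[of a b] by (auto simp: bis_def split: if_splits)
    then show ?thesis using 1 2 by auto
  qed
  then show ?thesis using Bc by (simp add: Cc_def continuous_map_def topspace_Gamma_top)
qed

text \<open>Continuity on the groupoid is rephrased as convergence of range and source while both
  the varying arrows and the limit satisfy the same equation. This form survives the passage to
  weaker notions of continuity.\<close>

lemma Cc_tendsto:
  assumes f: "f \<in> Cc \<Gamma>" and x: "limitin X x x0 F" and y: "limitin X y y0 F"
    and ev: "\<forall>\<^sub>F i in F. iter a (x i) = iter b (y i)" and eq: "iter a x0 = iter b y0"
  shows "((\<lambda>i. f (x i, int a - int b, y i)) \<longlongrightarrow> f (x0, int a - int b, y0)) F"
proof -
  have T: "x0 \<in> T" "y0 \<in> T" using x y by (auto dest: limitin_topspace)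
  have cf: "continuous_map (subtopology P (Eab a b)) euclidean f"
    using continuous_map_compose[OF continuous_map_into_Gamma, of euclidean f] f
    by (simp add: Cc_def o_def)
  have "\<forall>\<^sub>F i in F. x i \<in> T" "\<forall>\<^sub>F i in F. y i \<in> T" using limitinD[OF x] limitinD[OF y] T by auto
  with ev have "\<forall>\<^sub>F i in F. (x i, int a - int b, y i) \<in> Eab a b"
    by eventually_elim (simp add: Eab_iff)
  moreover have "limitin P (\<lambda>i. (x i, int a - int b, y i)) (x0, int a - int b, y0) F"
    using x y by (simp add: limitin_pairwise o_def)
  ultimately have "limitin (subtopology P (Eab a b)) (\<lambda>i. (x i, int a - int b, y i)) (x0, int a - int b, y0) F"
    using T eq by (simp add: limitin_subtopology Eab_iff)
  from continuous_map_limit[OF cf this] show ?thesis by (simp add: o_def)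
qed

text \<open>An index \<open>p = (x, k)\<close> stands for the arrow \<open>(x, k, w)\<close> with a
  fixed source \<open>w\<close>. The entry at \<open>p\<close>, \<open>q\<close> is the value of
  \<open>f\<close> at the product of \<open>p\<close> with the inverse of \<open>q\<close>, so the
  same matrix describes the regular representations at all \<open>w\<close>; they differ in the
  index set \<open>fib w\<close>.\<close>

definition ker :: "('a \<times> int \<times> 'a \<Rightarrow> complex) \<Rightarrow> 'a \<times> int \<Rightarrow> 'a \<times> int \<Rightarrow> complex" where
  "ker f p q = f (fst p, snd p - snd q, fst q)"

definition adj :: "nat \<Rightarrow> 'a \<times> int \<Rightarrow> ('a \<times> int) set" where
  "adj n p = {q. (fst p, snd p - snd q, fst q) \<in> slab n}"

definition fib :: "'a \<Rightarrow> ('a \<times> int) set" where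
  "fib w = {p. (fst p, snd p, w) \<in> \<G>}"

lemma slab_sym: "(x, k, y) \<in> slab n \<longleftrightarrow> (y, - k, x) \<in> slab n"
proof -
  have "(y, - k, x) \<in> slab n" if "(x, k, y) \<in> slab n" for x y k
    using that unfolding slab_iff by (metis minus_diff_eq)
  from this this[of y "- k" x] show ?thesis by auto
qed

lemma adj_sym: "q \<in> adj n p \<longleftrightarrow> p \<in> adj n q"
  using slab_sym[of "fst p" "snd p - snd q" "fst q" n] by (simp add: adj_def)

text \<open>An index in \<open>adj n p\<close> is determined by \<open>a\<close>, \<open>b\<close>
  up to \<open>n\<close> and a point in a fibre of \<open>iter b\<close>, and fibres are uniformly
  finite. So functions supported in a slab have matrices with boundedly many nonzero entries in each
  row, and by \<open>adj_sym\<close> in each column.\<close>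

lemma adj_card_bound:
  obtains D where "\<And>p. finite (adj n p)" "\<And>p. card (adj n p) \<le> D"
proof -
  have "\<forall>b. \<exists>D. \<forall>w. card (fibre b w) \<le> D" using fibre_card_bound by metis
  then obtain d where d: "\<And>b w. card (fibre b w) \<le> d b" by metis
  let ?S = "\<lambda>p. \<Union>a\<in>{..n}. \<Union>b\<in>{..n}. (\<lambda>z. (z, snd p - (int a - int b))) ` fibre b (iter a (fst p))"
  have sub: "adj n p \<subseteq> ?S p" for p
  proof
    fix q assume "q \<in> adj n p"
    then obtain a b where ab: "a \<le> n" "b \<le> n" "fst q \<in> T" "snd p - snd q = int a - int b"
      "iter a (fst p) = iter b (fst q)"
      by (auto simp: adj_def slab_iff)
    then have "q = (fst q, snd p - (int a - int b))" by (cases q) auto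
    moreover have "fst q \<in> fibre b (iter a (fst p))" using ab by (simp add: fibre_def)
    ultimately show "q \<in> ?S p" using ab(1,2) by blast
  qed
  have fin: "finite (?S p)" for p by (simp add: finite_fibre)
  have "card (?S p) \<le> (\<Sum>a\<in>{..n}. \<Sum>b\<in>{..n}. d b)" for p
  proof (rule order_trans[OF card_UN_le sum_mono])
    fix a
    show "card (\<Union>b\<in>{..n}. (\<lambda>z. (z, snd p - (int a - int b))) ` fibre b (iter a (fst p))) \<le> (\<Sum>b\<in>{..n}. d b)"
      by (rule order_trans[OF card_UN_le sum_mono]) (auto intro: order_trans[OF card_image_le d] finite_fibre)
  qed simp
  then have "card (adj n p) \<le> (\<Sum>a\<in>{..n}. \<Sum>b\<in>{..n}. d b)" for p
    using card_mono[OF fin sub] order_trans by blast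
  moreover have "finite (adj n p)" for p using finite_subset[OF sub fin] .
  ultimately show thesis by (rule that[rotated])
qed

lemma finite_adj: "finite (adj n p)"
  using adj_card_bound by blast

lemma Gamma_inv: "(x, k, y) \<in> \<G> \<Longrightarrow> (y, - k, x) \<in> \<G>"
  using Gamma_slab slab_sym slab_subset by blast

lemma slab_mult: "(x, k, y) \<in> slab m \<Longrightarrow> (y, l, z) \<in> slab n \<Longrightarrow> (x, k + l, z) \<in> slab (m + n)"
proof -
  assume "(x, k, y) \<in> slab m" "(y, l, z) \<in> slab n"
  then obtain a b a' b' where T: "x \<in> T" "z \<in> T" "a \<le> m" "b \<le> m" "a' \<le> n" "b' \<le> n"
    and kl: "k = int a - int b" "l = int a' - int b'"
    and eq: "iter a x = iter b y" "iter a' y = iter b' z"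
    by (auto simp: slab_iff)
  have "iter (a' + a) x = iter b (iter a' y)" by (simp flip: pow_pow add: eq(1)) (simp add: pow_pow add.commute)
  also have "\<dots> = iter (b + b') z" by (simp add: eq(2) pow_pow)
  finally have "iter (a' + a) x = iter (b + b') z" .
  moreover have "k + l = int (a' + a) - int (b + b')" using kl by simp
  moreover have "a' + a \<le> m + n" "b + b' \<le> m + n" using T by auto
  ultimately show ?thesis unfolding slab_iff using T(1,2) by blast
qed

lemma Gamma_mult: "(x, k, y) \<in> \<G> \<Longrightarrow> (y, l, z) \<in> \<G> \<Longrightarrow> (x, k + l, z) \<in> \<G>"
  using Gamma_slab slab_mult slab_subset by blast

lemma fib_adj: "p \<in> fib w \<Longrightarrow> q \<in> adj n p \<Longrightarrow> q \<in> fib w"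
  using Gamma_mult[OF Gamma_inv, of "fst p" "snd p - snd q" "fst q" "snd p" w] slab_subset
  by (auto simp: fib_def adj_def)

text \<open>Factorizations of the arrow from \<open>r\<close> to \<open>p\<close> correspond to
  intermediate indices \<open>q\<close>. Convolution is therefore the matrix product, and any finite
  \<open>R\<close> that contains the nonzero terms computes it.\<close>

lemma infsum_factorizations:
  assumes G: "(fst p, snd p - snd r, fst r) \<in> \<G>"
    and f: "\<And>g. g \<notin> \<G> \<Longrightarrow> f g = 0" and h: "\<And>g. g \<notin> \<G> \<Longrightarrow> h g = 0"
    and R: "finite R" "\<And>q. ker f p q \<noteq> 0 \<Longrightarrow> ker h q r \<noteq> 0 \<Longrightarrow> q \<in> R"
  shows "(\<Sum>\<^sub>\<infinity>(g1, g2)\<in>factorizations \<Gamma> (fst p, snd p - snd r, fst r). f g1 * h g2) = (\<Sum>q\<in>R. ker f p q * ker h q r)"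
proof -
  define S where "S = {q. (fst p, snd p - snd q, fst q) \<in> \<G> \<and> (fst q, snd q - snd r, fst r) \<in> \<G>}"
  define j where "j q = ((fst p, snd p - snd q, fst q), (fst q, snd q - snd r, fst r))" for q :: "'a \<times> int"
  have inj: "inj_on j S" by (auto simp: inj_on_def j_def prod_eq_iff)
  have fac: "factorizations \<Gamma> (fst p, snd p - snd r, fst r) = j ` S"
  proof (intro equalityI subsetI)
    fix g assume "g \<in> factorizations \<Gamma> (fst p, snd p - snd r, fst r)"
    then obtain x m z l y where g: "g = ((x, m, z), (z, l, y))" "(x, m, z) \<in> \<G>"
      "(z, l, y) \<in> \<G>" "(x, m + l, y) = (fst p, snd p - snd r, fst r)"
      by (auto simp: factorizations_def)
    have "x = fst p" "y = fst r" "l = snd p - m - snd r" using g(4) by auto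
    then have "g = j (z, snd p - m)" "(z, snd p - m) \<in> S" using g(1-3) by (simp_all add: j_def S_def)
    then show "g \<in> j ` S" by blast
  qed (auto simp: factorizations_def j_def S_def)
  have "(\<Sum>\<^sub>\<infinity>(g1, g2)\<in>j ` S. f g1 * h g2) = (\<Sum>\<^sub>\<infinity>q\<in>S. ker f p q * ker h q r)"
    by (subst infsum_reindex[OF inj]) (simp add: o_def j_def ker_def)
  also have "\<dots> = (\<Sum>\<^sub>\<infinity>q\<in>R. ker f p q * ker h q r)"
    by (rule infsum_cong_neutral) (use R f h in \<open>auto simp: S_def ker_def\<close>)
  also have "\<dots> = (\<Sum>q\<in>R. ker f p q * ker h q r)" using R by simp
  finally show ?thesis by (simp add: fac)
qed

lemma ker_convolution:
  assumes f: "\<And>g. g \<notin> \<G> \<Longrightarrow> f g = 0" and h: "\<And>g. g \<notin> \<G> \<Longrightarrow> h g = 0"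
    and R: "finite R" "\<And>q. ker f p q \<noteq> 0 \<Longrightarrow> ker h q r \<noteq> 0 \<Longrightarrow> q \<in> R"
  shows "ker (convolution \<Gamma> f h) p r = (\<Sum>q\<in>R. ker f p q * ker h q r)"
proof (cases "(fst p, snd p - snd r, fst r) \<in> \<G>")
  case True
  then show ?thesis
    using infsum_factorizations[OF True f h R] by (simp add: ker_def convolution_def)
next
  case False
  have "ker f p q * ker h q r = 0" for q
  proof (rule ccontr)
    assume "ker f p q * ker h q r \<noteq> 0"
    then have "(fst p, snd p - snd q, fst q) \<in> \<G>" "(fst q, snd q - snd r, fst r) \<in> \<G>"
      using f[of "(fst p, snd p - snd q, fst q)"] h[of "(fst q, snd q - snd r, fst r)"]
      unfolding ker_def by auto
    from Gamma_mult[OF this] show False using False by simp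
  qed
  then have "(\<Sum>q\<in>R. ker f p q * ker h q r) = 0" by (intro sum.neutral) blast
  then show ?thesis using False by (simp add: ker_def convolution_def)
qed

text \<open>The operator norm in every regular representation is bounded through sesquilinear forms
  on finite sets of indices. By \<open>bnorm_le\<close> and \<open>opbound_bnorm\<close> the reduced
  norm is the least nonnegative such bound, so later estimates involve finite sums alone.\<close>

definition opbound :: "('a \<times> int \<times> 'a \<Rightarrow> complex) \<Rightarrow> real \<Rightarrow> bool" where
  "opbound f C \<longleftrightarrow> (\<forall>w F \<psi> \<theta>. finite F \<and> F \<subseteq> fib w \<longrightarrow>
     cmod (\<Sum>p\<in>F. \<Sum>q\<in>F. cnj (\<theta> p) * ker f p q * \<psi> q)
       \<le> C * L2 \<theta> F * L2 \<psi> F)"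

lemma opboundD:
  assumes "opbound f C" "finite F" "F \<subseteq> fib w"
  shows "cmod (\<Sum>p\<in>F. \<Sum>q\<in>F. cnj (\<theta> p) * ker f p q * \<psi> q)
       \<le> C * L2 \<theta> F * L2 \<psi> F"
  using assms by (simp add: opbound_def)

lemma L2_set_extend_zero:
  assumes "finite H" "F \<subseteq> H"
  shows "L2_set (\<lambda>p. cmod (if p \<in> F then \<psi> p else 0)) H = L2 \<psi> F"
  unfolding L2_set_def
  by (rule arg_cong[of _ _ sqrt]) (use assms in \<open>auto intro!: sum.mono_neutral_cong_right split: if_splits\<close>)

text \<open>Duality: the form is tested against the image vector itself, whose norm is then
  cancelled. Separate row and column sets are reduced to their union by extending with zero.\<close>

lemma opbound_apply:
  assumes ob: "opbound f C" and "C \<ge> 0" and F: "finite F" "F \<subseteq> fib w" and F': "finite F'" "F' \<subseteq> fib w"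
  shows "L2_set (\<lambda>p. cmod (\<Sum>q\<in>F. ker f p q * \<psi> q)) F' \<le> C * L2 \<psi> F"
proof -
  define \<eta> where "\<eta> p = (\<Sum>q\<in>F. ker f p q * \<psi> q)" for p
  let ?H = "F \<union> F'"
  let ?\<theta> = "\<lambda>p. if p \<in> F' then \<eta> p else 0" and ?\<psi> = "\<lambda>p. if p \<in> F then \<psi> p else 0"
  let ?N = "L2 \<eta> F'"
  have "(\<Sum>p\<in>?H. \<Sum>q\<in>?H. cnj (?\<theta> p) * ker f p q * ?\<psi> q) = (\<Sum>p\<in>?H. cnj (?\<theta> p) * \<eta> p)"
  proof (rule sum.cong[OF refl])
    fix p
    have "(\<Sum>q\<in>?H. ker f p q * ?\<psi> q) = \<eta> p"
      unfolding \<eta>_def using F F' by (intro sum.mono_neutral_cong_right) auto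
    then show "(\<Sum>q\<in>?H. cnj (?\<theta> p) * ker f p q * ?\<psi> q) = cnj (?\<theta> p) * \<eta> p"
      by (simp add: sum_distrib_left mult.assoc flip: \<open>(\<Sum>q\<in>?H. ker f p q * ?\<psi> q) = \<eta> p\<close>)
  qed
  also have "\<dots> = (\<Sum>p\<in>F'. cnj (\<eta> p) * \<eta> p)"
    using F F' by (intro sum.mono_neutral_cong_right) auto
  also have "\<dots> = complex_of_real (\<Sum>p\<in>F'. (cmod (\<eta> p))\<^sup>2)"
    unfolding of_real_sum by (intro sum.cong refl) (simp only: complex_norm_square mult.commute)
  also have "(\<Sum>p\<in>F'. (cmod (\<eta> p))\<^sup>2) = ?N\<^sup>2"
    by (simp add: L2_set_def sum_nonneg)
  finally have "?N\<^sup>2 = cmod (\<Sum>p\<in>?H. \<Sum>q\<in>?H. cnj (?\<theta> p) * ker f p q * ?\<psi> q)"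
    by (simp only: norm_of_real) (simp add: L2_set_nonneg)
  also have "\<dots> \<le> C * L2 ?\<theta> ?H * L2 ?\<psi> ?H"
    using F F' by (intro opboundD[OF ob, of _ w]) auto
  also have "\<dots> = C * ?N * L2 \<psi> F"
    using F F' by (simp only: L2_set_extend_zero finite_Un Un_upper1 Un_upper2)
  finally have "?N * ?N \<le> (C * L2 \<psi> F) * ?N"
    by (simp add: power2_eq_square mult.commute mult.left_commute)
  moreover have "0 \<le> ?N" "0 \<le> C * L2 \<psi> F" using \<open>C \<ge> 0\<close> by (simp_all add: L2_set_nonneg)
  ultimately have "?N \<le> C * L2 \<psi> F"
    by (cases "?N = 0") auto
  then show ?thesis by (simp add: \<eta>_def)
qed

lemma src_fibre_iff: "g \<in> src_fibre \<Gamma> (w, 0, w) \<longleftrightarrow> (\<exists>p\<in>fib w. g = (fst p, snd p, w))"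
  by (cases g) (force simp: src_fibre_def fib_def)

lemma pi_rep_sum:
  assumes f: "f \<in> \<B>" and \<psi>: "\<psi> \<in> l2 (src_fibre \<Gamma> (w, 0, w))" and p: "p \<in> fib w"
    and R: "finite R" "\<And>q. q \<in> fib w \<Longrightarrow> ker f p q \<noteq> 0 \<Longrightarrow> \<psi> (fst q, snd q, w) \<noteq> 0 \<Longrightarrow> q \<in> R"
  shows "pi_rep \<Gamma> (w, 0, w) f \<psi> (fst p, snd p, w) = (\<Sum>q\<in>R. ker f p q * \<psi> (fst q, snd q, w))"
proof -
  have \<psi>0: "\<psi> g = 0" if "g \<notin> src_fibre \<Gamma> (w, 0, w)" for g using \<psi> that unfolding l2_def by blast
  have sub: "src_fibre \<Gamma> (w, 0, w) \<subseteq> \<G>" by (auto simp: src_fibre_def)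
  have g: "(fst p, snd p, w) \<in> src_fibre \<Gamma> (w, 0, w)" using p src_fibre_iff by blast
  have "(\<Sum>\<^sub>\<infinity>(g1, g2)\<in>factorizations \<Gamma> (fst p, snd p - snd (w, 0 :: int), fst (w, 0 :: int)). f g1 * \<psi> g2) =
      (\<Sum>q\<in>R. ker f p q * ker \<psi> q (w, 0))"
  proof (rule infsum_factorizations)
    show "(fst p, snd p - snd (w, 0 :: int), fst (w, 0 :: int)) \<in> \<G>" using p by (simp add: fib_def)
    fix q assume "ker f p q \<noteq> 0" "ker \<psi> q (w, 0) \<noteq> 0"
    moreover from this have "q \<in> fib w" using \<psi>0 sub by (fastforce simp: ker_def fib_def)
    ultimately show "q \<in> R" using R(2) by (simp add: ker_def)
  qed (use f \<psi>0 sub R in \<open>auto intro: Bc_zero_off\<close>)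
  then show ?thesis using g by (simp add: pi_rep_def ker_def)
qed

text \<open>Finitely many rows meet finitely many columns, by finiteness of \<open>adj n p\<close>.
  Every finite partial sum is thus controlled by a finite form, which yields summability and the
  norm bound together.\<close>

lemma l2_norm_pi_rep_le:
  assumes f: "f \<in> \<B>" and ob: "opbound f C" and C: "C \<ge> 0"
    and \<psi>: "\<psi> \<in> l2 (src_fibre \<Gamma> (w, 0, w))" and le: "l2_norm (src_fibre \<Gamma> (w, 0, w)) \<psi> \<le> 1"
  shows "(\<lambda>g. (cmod (pi_rep \<Gamma> (w, 0, w) f \<psi> g))\<^sup>2) summable_on src_fibre \<Gamma> (w, 0, w)"
    and "l2_norm (src_fibre \<Gamma> (w, 0, w)) (pi_rep \<Gamma> (w, 0, w) f \<psi>) \<le> C"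
proof -
  let ?S = "src_fibre \<Gamma> (w, 0, w)"
  let ?\<pi> = "pi_rep \<Gamma> (w, 0, w) f \<psi>"
  define e where "e p = (fst p, snd p, w)" for p :: "'a \<times> int"
  have inj: "inj_on e A" for A by (auto simp: inj_on_def e_def prod_eq_iff)
  have S: "?S = e ` fib w" by (rule set_eqI) (simp only: src_fibre_iff e_def image_iff)
  obtain n where n: "\<And>g. g \<notin> slab n \<Longrightarrow> f g = 0" by (rule Bc_cases[OF f]) blast
  have \<psi>1: "(\<Sum>\<^sub>\<infinity>g\<in>?S. (cmod (\<psi> g))\<^sup>2) \<le> 1" using le by (simp add: l2_norm_def)
  have bd: "sum (\<lambda>g. (cmod (?\<pi> g))\<^sup>2) F0 \<le> C\<^sup>2" if F0: "finite F0" "F0 \<subseteq> ?S" for F0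
  proof -
    obtain F' where F': "F0 = e ` F'" "finite F'" "F' \<subseteq> fib w"
      using finite_subset_image[OF F0(1), of e "fib w"] F0(2) S by metis
    define F where "F = (\<Union>p\<in>F'. adj n p)"
    have F: "finite F" "F \<subseteq> fib w"
      using F' fib_adj by (auto simp: F_def finite_adj)
    have "?\<pi> (e p) = (\<Sum>q\<in>F. ker f p q * \<psi> (e q))" if "p \<in> F'" for p
      unfolding e_def
    proof (rule pi_rep_sum[OF f \<psi>])
      fix q assume "ker f p q \<noteq> 0"
      then have "q \<in> adj n p" using n by (auto simp: ker_def adj_def)
      then show "q \<in> F" using that by (auto simp: F_def)
    qed (use F F' that in auto)
    then have "sum (\<lambda>g. (cmod (?\<pi> g))\<^sup>2) F0 = (L2_set (\<lambda>p. cmod (\<Sum>q\<in>F. ker f p q * \<psi> (e q))) F')\<^sup>2"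
      by (simp add: F'(1) sum.reindex[OF inj] L2_set_def sum_nonneg)
    also have "\<dots> \<le> (C * L2_set (\<lambda>q. cmod (\<psi> (e q))) F)\<^sup>2"
      using opbound_apply[OF ob C F F'(2,3)] by (intro power_mono) (auto simp: L2_set_nonneg)
    also have "\<dots> = C\<^sup>2 * (\<Sum>g\<in>e ` F. (cmod (\<psi> g))\<^sup>2)"
      by (simp add: power_mult_distrib L2_set_def sum_nonneg sum.reindex[OF inj])
    also have "\<dots> \<le> C\<^sup>2 * (\<Sum>\<^sub>\<infinity>g\<in>?S. (cmod (\<psi> g))\<^sup>2)"
      using \<psi> F S by (intro mult_left_mono finite_sum_le_infsum) (auto simp: l2_def)
    also have "\<dots> \<le> C\<^sup>2 * 1" using \<psi>1 by (intro mult_left_mono) auto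
    finally show ?thesis by simp
  qed
  show sm: "(\<lambda>g. (cmod (?\<pi> g))\<^sup>2) summable_on ?S"
    by (rule nonneg_bdd_above_summable_on) (auto intro!: bdd_aboveI[of _ "C\<^sup>2"] bd)
  have "(\<Sum>\<^sub>\<infinity>g\<in>?S. (cmod (?\<pi> g))\<^sup>2) \<le> C\<^sup>2"
    by (rule infsum_le_finite_sums[OF sm bd])
  then show "l2_norm ?S ?\<pi> \<le> C"
    using C by (simp add: l2_norm_def real_sqrt_le_iff real_le_lsqrt)
qed

text \<open>Schur test: each absolute value is split into two equal square roots, one for
  \<open>\<theta>\<close> and one for \<open>\<psi>\<close>, and the Cauchy-Schwarz inequality is
  applied on \<open>F \<times> F\<close>.\<close>

lemma opbound_schur:
  assumes "C \<ge> 0"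
    and row: "\<And>w p F. finite F \<Longrightarrow> F \<subseteq> fib w \<Longrightarrow> p \<in> F \<Longrightarrow> (\<Sum>q\<in>F. cmod (ker f p q)) \<le> C"
    and col: "\<And>w q F. finite F \<Longrightarrow> F \<subseteq> fib w \<Longrightarrow> q \<in> F \<Longrightarrow> (\<Sum>p\<in>F. cmod (ker f p q)) \<le> C"
  shows "opbound f C"
  unfolding opbound_def
proof (intro allI impI, elim conjE)
  fix w F \<psi> \<theta> assume F: "finite F" "F \<subseteq> fib w"
  let ?a = "\<lambda>(p, q). cmod (\<theta> p) * sqrt (cmod (ker f p q))"
  let ?b = "\<lambda>(p, q). cmod (\<psi> q) * sqrt (cmod (ker f p q))"
  have "cmod (\<Sum>p\<in>F. \<Sum>q\<in>F. cnj (\<theta> p) * ker f p q * \<psi> q) \<le> (\<Sum>p\<in>F. \<Sum>q\<in>F. cmod (\<theta> p) * cmod (ker f p q) * cmod (\<psi> q))"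
    by (rule order_trans[OF norm_sum sum_mono], rule order_trans[OF norm_sum sum_mono])
      (simp add: norm_mult)
  also have "\<dots> = (\<Sum>pq\<in>F \<times> F. \<bar>?a pq\<bar> * \<bar>?b pq\<bar>)"
    unfolding sum.cartesian_product
    by (rule sum.cong) (auto simp: abs_mult mult.assoc mult.left_commute simp flip: real_sqrt_mult)
  also have "\<dots> \<le> L2_set ?a (F \<times> F) * L2_set ?b (F \<times> F)" by (rule L2_set_mult_ineq)
  also have "\<dots> \<le> (sqrt C * L2 \<theta> F) * (sqrt C * L2 \<psi> F)"
  proof (rule mult_mono)
    have "(\<Sum>pq\<in>F \<times> F. (?a pq)\<^sup>2) = (\<Sum>p\<in>F. (cmod (\<theta> p))\<^sup>2 * (\<Sum>q\<in>F. cmod (ker f p q)))"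
      by (simp add: sum_distrib_left sum.cartesian_product power_mult_distrib case_prod_unfold)
    also have "\<dots> \<le> (\<Sum>p\<in>F. (cmod (\<theta> p))\<^sup>2 * C)"
      by (intro sum_mono mult_left_mono row[OF F]) auto
    finally show "L2_set ?a (F \<times> F) \<le> sqrt C * L2 \<theta> F"
      unfolding L2_set_def real_sqrt_mult[symmetric]
      by (intro real_sqrt_le_mono) (simp add: sum_distrib_left mult.commute)
    have "(\<Sum>pq\<in>F \<times> F. (?b pq)\<^sup>2) = (\<Sum>q\<in>F. (cmod (\<psi> q))\<^sup>2 * (\<Sum>p\<in>F. cmod (ker f p q)))"
      unfolding sum_distrib_left
      by (subst sum.swap) (simp add: sum.cartesian_product power_mult_distrib case_prod_unfold)
    also have "\<dots> \<le> (\<Sum>p\<in>F. (cmod (\<psi> p))\<^sup>2 * C)"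
      by (intro sum_mono mult_left_mono col[OF F]) auto
    finally show "L2_set ?b (F \<times> F) \<le> sqrt C * L2 \<psi> F"
      unfolding L2_set_def real_sqrt_mult[symmetric]
      by (intro real_sqrt_le_mono) (simp add: sum_distrib_left mult.commute)
  qed (use \<open>C \<ge> 0\<close> in \<open>auto simp: L2_set_nonneg\<close>)
  also have "\<dots> = C * L2 \<theta> F * L2 \<psi> F"
    using \<open>C \<ge> 0\<close> by (simp add: mult.assoc mult.left_commute)
  finally show "cmod (\<Sum>p\<in>F. \<Sum>q\<in>F. cnj (\<theta> p) * ker f p q * \<psi> q)
       \<le> C * L2 \<theta> F * L2 \<psi> F" .
qed

text \<open>At most \<open>D\<close> entries of size at most \<open>B\<close> in each row and column
  give the bound \<open>D * B\<close>. It keeps the suprema in the definition of the norm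
  finite.\<close>

lemma Bc_opbound:
  assumes f: "f \<in> \<B>"
  obtains C where "C \<ge> 0" "opbound f C"
proof -
  obtain n B where n: "\<And>g. g \<notin> slab n \<Longrightarrow> f g = 0" and B: "B > 0" "\<And>g. cmod (f g) \<le> B"
    by (rule Bc_cases[OF f]) blast
  obtain D where D: "\<And>p. finite (adj n p)" "\<And>p. card (adj n p) \<le> D" by (rule adj_card_bound[of n]) blast
  have le: "(\<Sum>q\<in>F. cmod (k q)) \<le> D * B"
    if F: "finite F" and k: "\<And>q. q \<notin> adj n p \<Longrightarrow> k q = 0" "\<And>q. cmod (k q) \<le> B" for F p and k :: "'a \<times> int \<Rightarrow> complex"
  proof -
    have "(\<Sum>q\<in>F. cmod (k q)) = (\<Sum>q\<in>F \<inter> adj n p. cmod (k q))"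
      using F k(1) by (intro sum.mono_neutral_right) auto
    also have "\<dots> \<le> card (F \<inter> adj n p) * B" using k(2) by (intro sum_bounded_above) auto
    also have "\<dots> \<le> D * B"
      using B(1) order_trans[OF card_mono[OF D(1) Int_lower2] D(2)] by (intro mult_right_mono) (auto simp: of_nat_le_iff)
    finally show ?thesis .
  qed
  have "opbound f (D * B)"
  proof (rule opbound_schur)
    fix F p
    assume F: "finite (F :: ('a \<times> int) set)"
    show "(\<Sum>q\<in>F. cmod (ker f p q)) \<le> D * B"
      by (rule le[OF F, of p]) (use n B in \<open>auto simp: ker_def adj_def\<close>)
    show "(\<Sum>q\<in>F. cmod (ker f q p)) \<le> D * B"
      by (rule le[OF F, of p], subst (asm) adj_sym) (use n B in \<open>auto simp: ker_def adj_def\<close>)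
  qed (use B in auto)
  then show thesis using that[of "D * B"] B by auto
qed

section \<open>The reduced norm as the least bound on finite forms\<close>

abbreviation "bnorm \<equiv> anorm \<A>"

lemma bnorm_def: "bnorm f = (SUP w\<in>T. pi_norm \<Gamma> (w, 0, w) f)"
proof -
  have "units \<Gamma> = (\<lambda>w. (w, 0, w)) ` T"
  proof (intro equalityI subsetI)
    fix u :: "'a \<times> int \<times> 'a" assume "u \<in> (\<lambda>w. (w, 0, w)) ` T"
    then obtain w where w: "w \<in> T" "u = (w, 0, w)" by blast
    then have "(w, 0, w) \<in> \<G>" by (auto simp: Gamma_set_iff intro!: exI[of _ 0])
    then show "u \<in> units \<Gamma>" using w by (force simp: units_def)
  qed (auto simp: units_def Gamma_set_iff)
  then show ?thesis by (simp add: Bc_algebra_def image_image)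
qed

lemma zero_in_l2: "(\<lambda>g. 0) \<in> l2 S" "l2_norm S (\<lambda>g. 0) \<le> 1"
  by (simp_all add: l2_def l2_norm_def)

lemma pi_norm_le:
  assumes "f \<in> \<B>" "opbound f C" "C \<ge> 0"
  shows "pi_norm \<Gamma> (w, 0, w) f \<le> C"
    and "\<lbrakk>\<psi> \<in> l2 (src_fibre \<Gamma> (w, 0, w)); l2_norm (src_fibre \<Gamma> (w, 0, w)) \<psi> \<le> 1\<rbrakk> \<Longrightarrow>
      l2_norm (src_fibre \<Gamma> (w, 0, w)) (pi_rep \<Gamma> (w, 0, w) f \<psi>) \<le> pi_norm \<Gamma> (w, 0, w) f"
proof -
  show "pi_norm \<Gamma> (w, 0, w) f \<le> C"
    unfolding pi_norm_def
    by (rule cSUP_least) (use zero_in_l2 l2_norm_pi_rep_le(2)[OF assms] in auto)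
  assume "\<psi> \<in> l2 (src_fibre \<Gamma> (w, 0, w))" "l2_norm (src_fibre \<Gamma> (w, 0, w)) \<psi> \<le> 1"
  then show "l2_norm (src_fibre \<Gamma> (w, 0, w)) (pi_rep \<Gamma> (w, 0, w) f \<psi>) \<le> pi_norm \<Gamma> (w, 0, w) f"
    unfolding pi_norm_def
    by (intro cSUP_upper) (use l2_norm_pi_rep_le(2)[OF assms] in \<open>auto intro!: bdd_aboveI[of _ C]\<close>)
qed

lemma bnorm_le:
  assumes "f \<in> \<B>" "opbound f C" "C \<ge> 0"
  shows "bnorm f \<le> C"
  unfolding bnorm_def by (rule cSUP_least) (use assms pi_norm_le nonempty in auto)

lemma pi_norm_le_bnorm:
  assumes f: "f \<in> \<B>" and "w \<in> T"
  shows "pi_norm \<Gamma> (w, 0, w) f \<le> bnorm f"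
proof -
  obtain C where "C \<ge> 0" "opbound f C" by (rule Bc_opbound[OF f])
  then show ?thesis
    unfolding bnorm_def by (intro cSUP_upper assms bdd_aboveI[of _ C]) (use pi_norm_le[OF f] in auto)
qed

text \<open>The converse of \<open>bnorm_le\<close>: a finitely supported vector is normalized,
  moved to the source fibre and extended by zero, and the definition of the norm is applied to
  it.\<close>

lemma opbound_bnorm:
  assumes f: "f \<in> \<B>"
  shows "opbound f (bnorm f)"
  unfolding opbound_def
proof (intro allI impI, elim conjE)
  fix w F and \<psi> \<theta> :: "'a \<times> int \<Rightarrow> complex" assume F: "finite F" "F \<subseteq> fib w"
  obtain C where C: "C \<ge> 0" "opbound f C" by (rule Bc_opbound[OF f])
  let ?S = "src_fibre \<Gamma> (w, 0, w)"
  define e where "e p = (fst p, snd p, w)" for p :: "'a \<times> int"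
  have inj: "inj_on e A" for A by (auto simp: inj_on_def e_def prod_eq_iff)
  have S: "?S = e ` fib w" by (rule set_eqI) (simp only: src_fibre_iff e_def image_iff)
  define L where "L = L2 \<psi> F"
  define \<eta> where "\<eta> p = (\<Sum>q\<in>F. ker f p q * \<psi> q)" for p
  have form: "(\<Sum>p\<in>F. \<Sum>q\<in>F. cnj (\<theta> p) * ker f p q * \<psi> q) = (\<Sum>p\<in>F. cnj (\<theta> p) * \<eta> p)"
    by (simp add: \<eta>_def sum_distrib_left mult.assoc)
  have main: "L2 \<eta> F \<le> bnorm f * L"
  proof (cases "L = 0")
    case True
    then have "\<psi> q = 0" if "q \<in> F" for q
      using that F by (auto simp: L_def L2_set_eq_0_iff)
    then have "\<eta> p = 0" for p by (simp add: \<eta>_def)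
    then show ?thesis using True by (simp add: L2_set_def)
  next
    case False
    then have L: "L > 0" using L2_set_nonneg[of "\<lambda>p. cmod (\<psi> p)" F] unfolding L_def by linarith
    have "F \<noteq> {}" using False by (auto simp: L_def)
    then have w: "w \<in> T" using F by (auto simp: fib_def Gamma_set_iff)
    define \<psi>' where "\<psi>' g = (if g \<in> e ` F then \<psi> (fst g, fst (snd g)) / L else 0)" for g
    have \<psi>'e: "\<psi>' (e q) = (if q \<in> F then \<psi> q / L else 0)" for q
      using inj_image_mem_iff[OF inj, of q F] by (auto simp: \<psi>'_def) (auto simp: e_def)
    have sums: "((\<lambda>g. (cmod (\<psi>' g))\<^sup>2) has_sum 1) ?S"
    proof -
      have "(\<Sum>g\<in>e ` F. (cmod (\<psi>' g))\<^sup>2) = (\<Sum>q\<in>F. (cmod (\<psi> q))\<^sup>2 / L\<^sup>2)"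
        using L by (subst sum.reindex[OF inj]) (auto simp: \<psi>'e norm_divide power_divide intro!: sum.cong)
      also have "\<dots> = L\<^sup>2 / L\<^sup>2" by (simp add: L_def L2_set_def sum_nonneg flip: sum_divide_distrib)
      finally have "(\<Sum>g\<in>e ` F. (cmod (\<psi>' g))\<^sup>2) = 1" using L by simp
      then have "((\<lambda>g. (cmod (\<psi>' g))\<^sup>2) has_sum 1) (e ` F)"
        using has_sum_finite[of "e ` F" "\<lambda>g. (cmod (\<psi>' g))\<^sup>2"] F by simp
      then show ?thesis
        by (rule iffD1[OF has_sum_cong_neutral, rotated -1]) (use F S in \<open>auto simp: \<psi>'_def\<close>)
    qed
    have \<psi>': "\<psi>' \<in> l2 ?S" "l2_norm ?S \<psi>' \<le> 1"
      using sums F S by (auto simp: l2_def l2_norm_def infsumI \<psi>'_def intro: has_sum_imp_summable)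
    have pi: "pi_rep \<Gamma> (w, 0, w) f \<psi>' (e p) = \<eta> p / L" if "p \<in> F" for p
    proof -
      have "pi_rep \<Gamma> (w, 0, w) f \<psi>' (e p) = (\<Sum>q\<in>F. ker f p q * \<psi>' (e q))"
        unfolding e_def
      proof (rule pi_rep_sum[OF f \<psi>'(1)])
        fix q assume "\<psi>' (fst q, snd q, w) \<noteq> 0"
        then show "q \<in> F" using \<psi>'e[of q] by (auto simp: e_def split: if_splits)
      qed (use F that in auto)
      then show ?thesis by (simp add: \<psi>'e \<eta>_def sum_divide_distrib)
    qed
    note sm = l2_norm_pi_rep_le(1)[OF f C(2,1) \<psi>']
    have "L2 \<eta> F / L = sqrt (\<Sum>g\<in>e ` F. (cmod (pi_rep \<Gamma> (w, 0, w) f \<psi>' g))\<^sup>2)"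
      using L by (simp add: sum.reindex[OF inj] pi L2_set_def norm_divide power_divide real_sqrt_divide flip: sum_divide_distrib)
    also have "\<dots> \<le> l2_norm ?S (pi_rep \<Gamma> (w, 0, w) f \<psi>')"
      unfolding l2_norm_def using F S by (intro real_sqrt_le_mono finite_sum_le_infsum sm) auto
    also have "\<dots> \<le> pi_norm \<Gamma> (w, 0, w) f" by (rule pi_norm_le(2)[OF f C(2,1) \<psi>'])
    also have "\<dots> \<le> bnorm f" by (rule pi_norm_le_bnorm[OF f w])
    finally show ?thesis using L by (simp add: field_simps)
  qed
  have "cmod (\<Sum>p\<in>F. cnj (\<theta> p) * \<eta> p) \<le> (\<Sum>p\<in>F. \<bar>cmod (\<theta> p)\<bar> * \<bar>cmod (\<eta> p)\<bar>)"
    by (rule order_trans[OF norm_sum]) (simp add: norm_mult)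
  also have "\<dots> \<le> L2 \<theta> F * L2 \<eta> F" by (rule L2_set_mult_ineq)
  also have "\<dots> \<le> L2 \<theta> F * (bnorm f * L)" by (intro mult_left_mono main L2_set_nonneg)
  finally show "cmod (\<Sum>p\<in>F. \<Sum>q\<in>F. cnj (\<theta> p) * ker f p q * \<psi> q)
       \<le> bnorm f * L2 \<theta> F * L2 \<psi> F"
    unfolding form L_def by (simp add: mult.commute mult.left_commute)
qed

section \<open>The algebra of bounded compactly supported functions\<close>

lemma Bc_algebra_simps [simp]:
  "elements \<A> = \<B>" "azero \<A> = (\<lambda>g. 0)"
  "aadd \<A> f h = (\<lambda>g. f g + h g)" "ascale \<A> c f = (\<lambda>g. c * f g)"
  "amult \<A> = convolution \<Gamma>"
  by (simp_all add: Bc_algebra_def)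

abbreviation conv :: "('a \<times> int \<times> 'a \<Rightarrow> complex) \<Rightarrow> ('a \<times> int \<times> 'a \<Rightarrow> complex) \<Rightarrow> 'a \<times> int \<times> 'a \<Rightarrow> complex" (infixl "\<star>" 70)
  where "f \<star> h \<equiv> convolution \<Gamma> f h"

abbreviation "adj_fun \<equiv> astar \<A>"

lemma fun_ker: "f (x, k, y) = ker f (x, k) (y, 0)"
  by (simp add: ker_def)

lemma fun_eq_kerI: "(\<And>p q. ker f p q = ker h p q) \<Longrightarrow> f = h"
  by (rule ext) (metis fun_ker prod_cases3)

lemma ker_star: "f \<in> \<B> \<Longrightarrow> ker (adj_fun f) p q = cnj (ker f q p)"
  using Bc_zero_off[of f "(fst q, snd q - snd p, fst p)"] Gamma_inv[of "fst q" "snd q - snd p" "fst p"]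
  by (auto simp: Bc_algebra_def ker_def)

lemma ker_add: "ker (\<lambda>g. f g + h g) p q = ker f p q + ker h p q"
  by (simp add: ker_def)

lemma ker_diff: "ker (\<lambda>g. f g - h g) p q = ker f p q - ker h p q"
  by (simp add: ker_def)

lemma ker_scale: "ker (\<lambda>g. c * f g) p q = c * ker f p q"
  by (simp add: ker_def)

lemma ker_adj:
  assumes "\<And>g. g \<notin> slab n \<Longrightarrow> f g = 0" "ker f p q \<noteq> 0"
  shows "q \<in> adj n p" "p \<in> adj n q"
  using assms(1)[of "(fst p, snd p - snd q, fst q)"] assms(2) adj_sym by (auto simp: ker_def adj_def)

lemma ker_conv:
  assumes "f \<in> \<B>" "h \<in> \<B>" "finite R" "\<And>q. ker f p q \<noteq> 0 \<Longrightarrow> ker h q r \<noteq> 0 \<Longrightarrow> q \<in> R"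
  shows "ker (f \<star> h) p r = (\<Sum>q\<in>R. ker f p q * ker h q r)"
  using assms by (intro ker_convolution) (auto intro: Bc_zero_off)

lemma Bc_zero: "(\<lambda>g. 0) \<in> \<B>"
  by (rule BcI[of 0 _ 0]) auto

lemma Bc_add:
  assumes f: "f \<in> \<B>" and h: "h \<in> \<B>"
  shows "(\<lambda>g. f g + h g) \<in> \<B>"
proof -
  obtain m A where m: "\<And>g. g \<notin> slab m \<Longrightarrow> f g = 0" "\<And>g. cmod (f g) \<le> A" by (rule Bc_cases[OF f]) blast
  obtain n B where n: "\<And>g. g \<notin> slab n \<Longrightarrow> h g = 0" "\<And>g. cmod (h g) \<le> B" by (rule Bc_cases[OF h]) blast
  show ?thesis
  proof (rule BcI[of "max m n" _ "A + B"])
    fix g assume "g \<notin> slab (max m n)"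
    then have "g \<notin> slab m" "g \<notin> slab n" using slab_mono[of m "max m n"] slab_mono[of n "max m n"] by auto
    then show "f g + h g = 0" using m(1)[of g] n(1)[of g] by simp
  qed (auto intro: order_trans[OF norm_triangle_ineq add_mono] m n)
qed

lemma Bc_scale: "f \<in> \<B> \<Longrightarrow> (\<lambda>g. c * f g) \<in> \<B>"
proof (erule Bc_cases)
  fix n B assume "\<And>g. g \<notin> slab n \<Longrightarrow> f g = 0" "\<And>g. cmod (f g) \<le> B"
  then show ?thesis by (intro BcI[of n _ "cmod c * B"]) (auto simp: norm_mult intro: mult_left_mono)
qed

lemma Bc_diff: "f \<in> \<B> \<Longrightarrow> h \<in> \<B> \<Longrightarrow> (\<lambda>g. f g - h g) \<in> \<B>"
  using Bc_add[OF _ Bc_scale, of f h "-1"] by simp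

lemma Bc_star:
  assumes f: "f \<in> \<B>"
  shows "adj_fun f \<in> \<B>"
proof -
  obtain m A where m: "\<And>g. g \<notin> slab m \<Longrightarrow> f g = 0" "A > 0" "\<And>g. cmod (f g) \<le> A" by (rule Bc_cases[OF f]) blast
  show ?thesis
  proof (rule BcI[of m _ A])
    fix g show "cmod (adj_fun f g) \<le> A" using m by (simp add: Bc_algebra_def)
    assume "g \<notin> slab m"
    then show "adj_fun f g = 0" using m slab_sym by (cases g) (auto simp: Bc_algebra_def)
  qed
qed

lemma Bc_conv:
  assumes f: "f \<in> \<B>" and h: "h \<in> \<B>"
  shows "f \<star> h \<in> \<B>"
proof -
  obtain m A where m: "\<And>g. g \<notin> slab m \<Longrightarrow> f g = 0" "A > 0" "\<And>g. cmod (f g) \<le> A" by (rule Bc_cases[OF f]) blast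
  obtain n B where n: "\<And>g. g \<notin> slab n \<Longrightarrow> h g = 0" "B > 0" "\<And>g. cmod (h g) \<le> B" by (rule Bc_cases[OF h]) blast
  obtain D where D: "\<And>p. card (adj m p) \<le> D" by (rule adj_card_bound[of m]) blast
  have eq: "(f \<star> h) (x, k, y) = (\<Sum>q\<in>adj m (x, k). ker f (x, k) q * ker h q (y, 0))" for x k y
    unfolding fun_ker[of "f \<star> h"] by (intro ker_conv f h finite_adj ker_adj(1)[of m f] m(1))
  show ?thesis
  proof (rule BcI[of "m + n" _ "D * (A * B)"])
    fix g :: "'a \<times> int \<times> 'a"
    obtain x k y where g: "g = (x, k, y)" by (cases g)
    show "(f \<star> h) g = 0" if "g \<notin> slab (m + n)"
    proof -
      have "ker f (x, k) q * ker h q (y, 0) = 0" for q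
        using m(1)[of "(x, k - snd q, fst q)"] n(1)[of "(fst q, snd q, y)"] that
          slab_mult[of x "k - snd q" "fst q" m "snd q" y n]
        by (auto simp: ker_def g)
      then show ?thesis unfolding g eq by (intro sum.neutral) blast
    qed
    have "cmod ((f \<star> h) g) \<le> card (adj m (x, k)) * (A * B)"
      unfolding g eq
      by (rule order_trans[OF norm_sum sum_bounded_above])
        (use m n in \<open>auto simp: norm_mult ker_def intro!: mult_mono intro: less_imp_le\<close>)
    also have "\<dots> \<le> D * (A * B)" using D m n by (intro mult_right_mono) auto
    finally show "cmod ((f \<star> h) g) \<le> D * (A * B)" .
  qed
qed

lemma opbound_add:
  assumes f: "opbound f A" and h: "opbound h B"
  shows "opbound (\<lambda>g. f g + h g) (A + B)"
  unfolding opbound_def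
proof (intro allI impI)
  fix w F \<psi> \<theta> assume F: "finite F \<and> F \<subseteq> fib w"
  have eq: "(\<Sum>p\<in>F. \<Sum>q\<in>F. cnj (\<theta> p) * ker (\<lambda>g. f g + h g) p q * \<psi> q) =
    (\<Sum>p\<in>F. \<Sum>q\<in>F. cnj (\<theta> p) * ker f p q * \<psi> q) + (\<Sum>p\<in>F. \<Sum>q\<in>F. cnj (\<theta> p) * ker h p q * \<psi> q)"
    by (simp add: ker_add algebra_simps sum.distrib)
  show "cmod (\<Sum>p\<in>F. \<Sum>q\<in>F. cnj (\<theta> p) * ker (\<lambda>g. f g + h g) p q * \<psi> q) \<le> (A + B) * L2 \<theta> F * L2 \<psi> F"
    unfolding eq distrib_right
    by (rule order_trans[OF norm_triangle_ineq add_mono]) (use opboundD f h F in blast)+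
qed

lemma opbound_scale:
  assumes f: "opbound f A"
  shows "opbound (\<lambda>g. c * f g) (cmod c * A)"
  unfolding opbound_def
proof (intro allI impI)
  fix w F \<psi> \<theta> assume F: "finite F \<and> F \<subseteq> fib w"
  have "(\<Sum>p\<in>F. \<Sum>q\<in>F. cnj (\<theta> p) * ker (\<lambda>g. c * f g) p q * \<psi> q) =
    c * (\<Sum>p\<in>F. \<Sum>q\<in>F. cnj (\<theta> p) * ker f p q * \<psi> q)"
    by (simp add: ker_scale sum_distrib_left mult.assoc mult.left_commute)
  then show "cmod (\<Sum>p\<in>F. \<Sum>q\<in>F. cnj (\<theta> p) * ker (\<lambda>g. c * f g) p q * \<psi> q) \<le> cmod c * A * L2 \<theta> F * L2 \<psi> F"
    using opboundD[OF f, of F w \<theta> \<psi>] F by (simp add: norm_mult mult.assoc mult_left_mono)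
qed

lemma opbound_star:
  assumes "f \<in> \<B>" "opbound f A"
  shows "opbound (adj_fun f) A"
  unfolding opbound_def
proof (intro allI impI)
  fix w F \<psi> \<theta> assume F: "finite F \<and> F \<subseteq> fib w"
  have "(\<Sum>p\<in>F. \<Sum>q\<in>F. cnj (\<theta> p) * ker (adj_fun f) p q * \<psi> q) =
    cnj (\<Sum>q\<in>F. \<Sum>p\<in>F. cnj (\<psi> q) * ker f q p * \<theta> p)"
    by (subst sum.swap) (simp add: ker_star[OF assms(1)] mult.commute mult.left_commute)
  then show "cmod (\<Sum>p\<in>F. \<Sum>q\<in>F. cnj (\<theta> p) * ker (adj_fun f) p q * \<psi> q)
       \<le> A * L2 \<theta> F * L2 \<psi> F"
    using opboundD[OF assms(2), of F w \<psi> \<theta>] F by (simp only: complex_mod_cnj) (simp add: mult_ac)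
qed

lemma opbound_conv:
  assumes f: "f \<in> \<B>" "opbound f A" "A \<ge> 0" and h: "h \<in> \<B>" "opbound h B" "B \<ge> 0"
  shows "opbound (f \<star> h) (A * B)"
  unfolding opbound_def
proof (intro allI impI)
  fix w F and \<psi> \<theta> :: "'a \<times> int \<Rightarrow> complex" assume F: "finite F \<and> F \<subseteq> fib w"
  obtain n where n: "\<And>g. g \<notin> slab n \<Longrightarrow> h g = 0" by (rule Bc_cases[OF h(1)]) blast
  define F' where "F' = (\<Union>q\<in>F. adj n q)"
  have F': "finite F'" "F' \<subseteq> fib w" using F fib_adj by (auto simp: F'_def finite_adj)
  define \<eta> where "\<eta> r = (\<Sum>q\<in>F. ker h r q * \<psi> q)" for r
  have conv: "ker (f \<star> h) p q = (\<Sum>r\<in>F'. ker f p r * ker h r q)" if "q \<in> F" for p q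
  proof (rule ker_conv[OF f(1) h(1) F'(1)])
    fix r assume "ker h r q \<noteq> 0"
    with n have "r \<in> adj n q" by (rule ker_adj(2)[of n h])
    then show "r \<in> F'" using that by (auto simp: F'_def)
  qed
  have "(\<Sum>q\<in>F. cnj (\<theta> p) * ker (f \<star> h) p q * \<psi> q) = cnj (\<theta> p) * (\<Sum>r\<in>F'. ker f p r * \<eta> r)" for p
  proof -
    have "(\<Sum>q\<in>F. cnj (\<theta> p) * ker (f \<star> h) p q * \<psi> q) = cnj (\<theta> p) * (\<Sum>q\<in>F. \<Sum>r\<in>F'. ker f p r * (ker h r q * \<psi> q))"
      by (simp add: conv sum_distrib_left sum_distrib_right mult.assoc)
    also have "(\<Sum>q\<in>F. \<Sum>r\<in>F'. ker f p r * (ker h r q * \<psi> q)) = (\<Sum>r\<in>F'. ker f p r * \<eta> r)"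
      by (subst sum.swap) (simp add: \<eta>_def sum_distrib_left)
    finally show ?thesis .
  qed
  then have "cmod (\<Sum>p\<in>F. \<Sum>q\<in>F. cnj (\<theta> p) * ker (f \<star> h) p q * \<psi> q) \<le>
      (\<Sum>p\<in>F. \<bar>cmod (\<theta> p)\<bar> * \<bar>cmod (\<Sum>r\<in>F'. ker f p r * \<eta> r)\<bar>)"
    by (simp add: norm_mult order_trans[OF norm_sum])
  also have "\<dots> \<le> L2 \<theta> F * L2_set (\<lambda>p. cmod (\<Sum>r\<in>F'. ker f p r * \<eta> r)) F"
    by (rule L2_set_mult_ineq)
  also have "\<dots> \<le> L2 \<theta> F * (A * L2 \<eta> F')"
    using F by (intro mult_left_mono opbound_apply[OF f(2,3) F'] L2_set_nonneg) auto
  also have "\<dots> \<le> L2 \<theta> F * (A * (B * L2 \<psi> F))"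
    unfolding \<eta>_def using F f(3)
    by (intro mult_left_mono opbound_apply[OF h(2,3) _ _ F'] L2_set_nonneg) auto
  finally show "cmod (\<Sum>p\<in>F. \<Sum>q\<in>F. cnj (\<theta> p) * ker (f \<star> h) p q * \<psi> q)
       \<le> A * B * L2 \<theta> F * L2 \<psi> F"
    by (simp add: mult_ac)
qed

lemma opbound_pointwise:
  assumes "opbound f C" and g: "(x, k, y) \<in> \<G>"
  shows "cmod (f (x, k, y)) \<le> C"
proof -
  let ?F = "{(x, k), (y, 0)}" and ?\<theta> = "\<lambda>p. if p = (x, k) then 1 else 0 :: complex"
    and ?\<psi> = "\<lambda>p. if p = (y, 0) then 1 else 0 :: complex"
  have delta: "L2_set (\<lambda>p. cmod (if p = a then 1 else 0)) F = 1" if "finite F" "a \<in> F" for a and F :: "('a \<times> int) set"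
  proof -
    have "(\<Sum>p\<in>F. (cmod (if p = a then 1 else 0))\<^sup>2) = (\<Sum>p\<in>{a}. (cmod (if p = a then 1 else 0))\<^sup>2)"
      using that by (intro sum.mono_neutral_right) auto
    then show ?thesis by (simp add: L2_set_def)
  qed
  have "(y, 0, y) \<in> \<G>" using g by (auto simp: Gamma_set_iff intro!: exI[of _ 0])
  then have F: "finite ?F" "?F \<subseteq> fib y" using g by (auto simp: fib_def)
  have "(\<Sum>p\<in>?F. \<Sum>q\<in>?F. cnj (?\<theta> p) * ker f p q * ?\<psi> q) = (\<Sum>p\<in>?F. cnj (?\<theta> p) * ker f p (y, 0))"
    by (intro sum.cong refl) (auto simp: if_distrib cong: if_cong)
  also have "\<dots> = (\<Sum>p\<in>{(x, k)}. cnj (?\<theta> p) * ker f p (y, 0))"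
    by (rule sum.mono_neutral_right) auto
  also have "\<dots> = f (x, k, y)" by (simp add: ker_def)
  finally have "cmod (f (x, k, y)) \<le> C * L2 ?\<theta> ?F * L2 ?\<psi> ?F"
    using opboundD[OF assms(1) F, of ?\<theta> ?\<psi>] by simp
  also have "L2 ?\<theta> ?F = 1" by (rule delta) simp_all
  also have "L2 ?\<psi> ?F = 1" by (rule delta) simp_all
  finally show ?thesis by simp
qed

text \<open>The forms are finite sums, so they pass to pointwise limits; this is lower
  semicontinuity of the norm.\<close>

lemma opbound_limit:
  assumes lim: "\<And>g. (\<lambda>m. u m g) \<longlonglongrightarrow> f g" and ob: "\<forall>\<^sub>F m in sequentially. opbound (u m) C"
  shows "opbound f C"
  unfolding opbound_def
proof (intro allI impI)
  fix w F \<psi> \<theta> assume F: "finite F \<and> F \<subseteq> fib w"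
  show "cmod (\<Sum>p\<in>F. \<Sum>q\<in>F. cnj (\<theta> p) * ker f p q * \<psi> q)
       \<le> C * L2 \<theta> F * L2 \<psi> F"
  proof (rule tendsto_upperbound)
    show "(\<lambda>m. cmod (\<Sum>p\<in>F. \<Sum>q\<in>F. cnj (\<theta> p) * ker (u m) p q * \<psi> q)) \<longlonglongrightarrow>
        cmod (\<Sum>p\<in>F. \<Sum>q\<in>F. cnj (\<theta> p) * ker f p q * \<psi> q)"
      unfolding ker_def by (intro tendsto_intros lim)
    show "\<forall>\<^sub>F m in sequentially. cmod (\<Sum>p\<in>F. \<Sum>q\<in>F. cnj (\<theta> p) * ker (u m) p q * \<psi> q)
        \<le> C * L2 \<theta> F * L2 \<psi> F"
      using ob by eventually_elim (use opboundD F in blast)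
  qed simp
qed

lemma bnorm_nonneg: "f \<in> \<B> \<Longrightarrow> 0 \<le> bnorm f"
proof -
  assume f: "f \<in> \<B>"
  obtain w where "w \<in> T" using nonempty by blast
  then have "(w, 0, w) \<in> \<G>" by (auto simp: Gamma_set_iff intro!: exI[of _ 0])
  from opbound_pointwise[OF opbound_bnorm[OF f] this] show ?thesis
    by (rule order_trans[OF norm_ge_zero])
qed

lemma bnorm_pointwise: "f \<in> \<B> \<Longrightarrow> cmod (f g) \<le> bnorm f"
  using opbound_pointwise[OF opbound_bnorm] Bc_zero_off[of f g] bnorm_nonneg[of f]
  by (cases "g \<in> \<G>") (cases g; auto)+

lemma bnorm_add: "f \<in> \<B> \<Longrightarrow> h \<in> \<B> \<Longrightarrow> bnorm (\<lambda>g. f g + h g) \<le> bnorm f + bnorm h"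
  by (intro bnorm_le opbound_add opbound_bnorm Bc_add add_nonneg_nonneg bnorm_nonneg)

lemma bnorm_scale_le: "f \<in> \<B> \<Longrightarrow> bnorm (\<lambda>g. c * f g) \<le> cmod c * bnorm f"
  by (intro bnorm_le opbound_scale opbound_bnorm Bc_scale mult_nonneg_nonneg bnorm_nonneg norm_ge_zero)

lemma bnorm_conv: "f \<in> \<B> \<Longrightarrow> h \<in> \<B> \<Longrightarrow> bnorm (f \<star> h) \<le> bnorm f * bnorm h"
  by (intro bnorm_le opbound_conv opbound_bnorm Bc_conv mult_nonneg_nonneg bnorm_nonneg)

lemma bnorm_star: "f \<in> \<B> \<Longrightarrow> bnorm (adj_fun f) \<le> bnorm f"
  by (intro bnorm_le opbound_star opbound_bnorm Bc_star bnorm_nonneg)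

lemma bnorm_zero: "bnorm (\<lambda>g. 0) = 0"
  using bnorm_scale_le[OF Bc_zero, of 0] bnorm_nonneg[OF Bc_zero] by simp

lemma adist_bnorm: "adist \<A> f h = bnorm (\<lambda>g. f g - h g)"
  by (simp add: adist_def)

lemma conv_sum_adj:
  assumes f: "f \<in> \<B>" and h: "h \<in> \<B>" and n: "\<And>g. g \<notin> slab n \<Longrightarrow> f g = 0"
  shows "ker (f \<star> h) p q = (\<Sum>r\<in>adj n p. ker f p r * ker h r q)"
  by (intro ker_conv f h finite_adj ker_adj(1)[of n f] n)

lemma conv_diff_left:
  assumes f: "f \<in> \<B>" and f': "f' \<in> \<B>" and h: "h \<in> \<B>"
  shows "(\<lambda>g. f g - f' g) \<star> h = (\<lambda>g. (f \<star> h) g - (f' \<star> h) g)"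
proof (rule fun_eq_kerI)
  fix p q
  obtain n where n: "\<And>g. g \<notin> slab n \<Longrightarrow> h g = 0" by (rule Bc_cases[OF h]) blast
  have R: "finite (adj n q)" "\<And>r. ker h r q \<noteq> 0 \<Longrightarrow> r \<in> adj n q"
    by (rule finite_adj) (rule ker_adj(2)[of n h, OF n])
  have *: "ker (u \<star> h) p q = (\<Sum>r\<in>adj n q. ker u p r * ker h r q)" if "u \<in> \<B>" for u
    using R by (intro ker_conv that h) auto
  show "ker ((\<lambda>g. f g - f' g) \<star> h) p q = ker (\<lambda>g. (f \<star> h) g - (f' \<star> h) g) p q"
    by (simp add: * Bc_diff f f' ker_diff algebra_simps sum_subtractf)
qed

lemma conv_diff_right:
  assumes f: "f \<in> \<B>" and f': "f' \<in> \<B>" and h: "h \<in> \<B>"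
  shows "h \<star> (\<lambda>g. f g - f' g) = (\<lambda>g. (h \<star> f) g - (h \<star> f') g)"
proof (rule fun_eq_kerI)
  fix p q
  obtain n where n: "\<And>g. g \<notin> slab n \<Longrightarrow> h g = 0" by (rule Bc_cases[OF h]) blast
  show "ker (h \<star> (\<lambda>g. f g - f' g)) p q = ker (\<lambda>g. (h \<star> f) g - (h \<star> f') g) p q"
    by (simp add: conv_sum_adj[OF h _ n] Bc_diff f f' ker_diff algebra_simps sum_subtractf)
qed

lemma star_diff:
  assumes "f \<in> \<B>" "f' \<in> \<B>"
  shows "adj_fun (\<lambda>g. f g - f' g) = (\<lambda>g. adj_fun f g - adj_fun f' g)"
  by (rule fun_eq_kerI) (simp add: ker_star ker_diff assms Bc_diff)

sublocale B: pre_star_algebra \<A>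
proof
  fix f h f' h' :: "'a \<times> int \<times> 'a \<Rightarrow> complex" and c
  show "azero \<A> \<in> elements \<A>" by (simp add: Bc_zero)
  assume "f \<in> elements \<A>"
  then have f: "f \<in> \<B>" by simp
  show "ascale \<A> c f \<in> elements \<A>" by (simp add: Bc_scale f)
  show "adj_fun f \<in> elements \<A>" by (simp add: Bc_star f)
  show "adist \<A> f f = 0" by (simp add: adist_bnorm bnorm_zero)
  assume "h \<in> elements \<A>"
  then have h: "h \<in> \<B>" by simp
  show "aadd \<A> f h \<in> elements \<A>" by (simp add: Bc_add f h)
  show "amult \<A> f h \<in> elements \<A>" by (simp add: Bc_conv f h)
  have sym: "bnorm (\<lambda>g. u g - v g) \<le> bnorm (\<lambda>g. v g - u g)" if "u \<in> \<B>" "v \<in> \<B>" for u v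
    using bnorm_scale_le[OF Bc_diff[OF that(2,1)], of "-1"] by simp
  show "adist \<A> f h = adist \<A> h f"
    unfolding adist_bnorm using sym f h by (intro antisym) auto
  show "adist \<A> (ascale \<A> c f) (ascale \<A> c h) \<le> cmod c * adist \<A> f h"
    using bnorm_scale_le[OF Bc_diff[OF f h], of c] by (simp add: adist_bnorm right_diff_distrib)
  show "adist \<A> (adj_fun f) (adj_fun h) \<le> adist \<A> f h"
    using bnorm_star[OF Bc_diff[OF f h]] by (simp add: adist_bnorm star_diff f h)
  show "\<bar>bnorm f - bnorm h\<bar> \<le> adist \<A> f h"
    using bnorm_add[OF Bc_diff[OF f h] h] bnorm_add[OF Bc_diff[OF h f] f] sym[OF h f]
    by (simp add: adist_bnorm)
  assume "f' \<in> elements \<A>"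
  then have f': "f' \<in> \<B>" by simp
  show "adist \<A> f f' \<le> adist \<A> f h + adist \<A> h f'"
    using bnorm_add[OF Bc_diff[OF f h] Bc_diff[OF h f']] by (simp add: adist_bnorm)
  assume "h' \<in> elements \<A>"
  then have h': "h' \<in> \<B>" by simp
  have "(\<lambda>g. f g + h g - (f' g + h' g)) = (\<lambda>g. (f g - f' g) + (h g - h' g))" by auto
  then show "adist \<A> (aadd \<A> f h) (aadd \<A> f' h')
      \<le> adist \<A> f f' + adist \<A> h h'"
    using bnorm_add[OF Bc_diff[OF f f'] Bc_diff[OF h h']] by (simp add: adist_bnorm)
  have "(\<lambda>g. (f \<star> h) g - (f' \<star> h') g) = (\<lambda>g. (f \<star> (\<lambda>g. h g - h' g)) g + ((\<lambda>g. f g - f' g) \<star> h') g)"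
    by (simp add: conv_diff_left conv_diff_right f f' h h')
  then have "bnorm (\<lambda>g. (f \<star> h) g - (f' \<star> h') g) \<le> bnorm (f \<star> (\<lambda>g. h g - h' g)) + bnorm ((\<lambda>g. f g - f' g) \<star> h')"
    using bnorm_add[OF Bc_conv[OF f Bc_diff[OF h h']] Bc_conv[OF Bc_diff[OF f f'] h']] by simp
  also have "\<dots> \<le> bnorm f * bnorm (\<lambda>g. h g - h' g) + bnorm (\<lambda>g. f g - f' g) * bnorm h'"
    by (intro add_mono bnorm_conv f h' Bc_diff h f')
  finally show "adist \<A> (amult \<A> f h) (amult \<A> f' h')
      \<le> bnorm f * adist \<A> h h' + adist \<A> f f' * bnorm h'"
    by (simp add: adist_bnorm)
qed

section \<open>Continuity along the fibre counting functions\<close>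

lemma limitin_pow: "limitin X x x0 F \<Longrightarrow> limitin X (\<lambda>i. iter p (x i)) (iter p x0) F"
  using continuous_map_limit[OF continuous_pow, of x x0 F p] by (simp add: o_def)

lemma limitin_in: "limitin X x x0 F \<Longrightarrow> \<forall>\<^sub>F i in F. x i \<in> T"
  by (rule limitinD[OF _ openin_topspace]) (auto dest: limitin_topspace)

text \<open>Uniqueness of lifts: near the common limit \<open>iter p\<close> is injective.\<close>

lemma eventually_eq_if_pow_eq:
  assumes x: "limitin X x w F" and y: "limitin X y w F" and ev: "\<forall>\<^sub>F i in F. iter p (x i) = iter p (y i)"
  shows "\<forall>\<^sub>F i in F. x i = y i"
proof -
  obtain U where U: "openin X U" "w \<in> U" "inj_on (\<phi> ^^ p) U"
    using linj_pow[OF limitin_topspace[OF x]] by blast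
  from limitinD[OF x U(1,2)] limitinD[OF y U(1,2)] ev show ?thesis
    by eventually_elim (rule inj_onD[OF U(3)])
qed

text \<open>Upper semicontinuity of fibres. A continuous map from a compact space to a Hausdorff
  space is closed, so the image of the uncovered part is a closed set that misses
  \<open>w0\<close>.\<close>

lemma fibre_cover:
  assumes w0: "w0 \<in> T" and U: "\<And>y. y \<in> fibre p w0 \<Longrightarrow> openin X (U y) \<and> y \<in> U y"
  obtains W where "openin X W" "w0 \<in> W" "\<And>w. w \<in> W \<Longrightarrow> fibre p w \<subseteq> (\<Union>y\<in>fibre p w0. U y)"
proof -
  let ?K = "T - (\<Union>y\<in>fibre p w0. U y)"
  have "closedin X ?K" using U by (intro closedin_diff openin_Union) auto
  then have "closedin X (iter p ` ?K)"
    using T1_Spaces.continuous_imp_closed_map[OF continuous_pow compact Hausdorff] by (auto simp: closed_map_def)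
  then have "openin X (T - iter p ` ?K)" by blast
  moreover have "w0 \<in> T - iter p ` ?K" using w0 U by (auto simp: fibre_def)
  moreover have "fibre p w \<subseteq> (\<Union>y\<in>fibre p w0. U y)" if "w \<in> T - iter p ` ?K" for w
    using that by (auto simp: fibre_def)
  ultimately show thesis by (rule that)
qed

text \<open>Convergence in the topology generated by \<open>X\<close> and the fibre counting functions
  \<open>x \<mapsto> card (fibre p (iter q x))\<close> with \<open>p, q \<le> N\<close>, in which \<open>\<phi>\<close> becomes a local
  homeomorphism as \<open>N\<close> grows.  Every convolution of continuous functions is continuous for it.\<close>

definition good :: "nat \<Rightarrow> 'a filter \<Rightarrow> ('a \<Rightarrow> 'a) \<Rightarrow> 'a \<Rightarrow> bool" where
  "good N F x x0 \<longleftrightarrow> limitin X x x0 F \<and> (\<forall>p\<le>N. \<forall>q\<le>N. \<forall>y0\<in>T. iter p y0 = iter q x0 \<longrightarrow>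
     (\<exists>y. limitin X y y0 F \<and> (\<forall>\<^sub>F i in F. iter p (y i) = iter q (x i))))"

lemma good_mono: "good N F x x0 \<Longrightarrow> M \<le> N \<Longrightarrow> good M F x x0"
  unfolding good_def by (meson order_trans)

text \<open>A lifting problem at \<open>y\<close> becomes one at \<open>x\<close> after applying
  \<open>iter p\<close>, at the price of \<open>p\<close> and \<open>q\<close> more steps. The
  surplus \<open>iter p\<close> is then cancelled by uniqueness of lifts.\<close>

lemma good_lift:
  assumes g: "good N F x x0" and MN: "M + p \<le> N" "M + q \<le> N" and y: "limitin X y y0 F"
    and eq: "iter p y0 = iter q x0" and ev: "\<forall>\<^sub>F i in F. iter p (y i) = iter q (x i)"
  shows "good M F y y0"
  unfolding good_def
proof (intro conjI y allI impI ballI)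
  fix p' q' v0 assume pq: "p' \<le> M" "q' \<le> M" and v0: "v0 \<in> T" "iter p' v0 = iter q' y0"
  have comm: "iter m (iter n z) = iter n (iter m z)" for m n z
    by (simp add: pow_pow add.commute)
  have "iter (p + p') v0 = iter q' (iter p y0)"
    by (simp flip: pow_pow add: v0) (rule comm)
  also have "\<dots> = iter (q' + q) x0" by (simp add: eq pow_pow)
  finally have "iter (p + p') v0 = iter (q' + q) x0" .
  moreover have "p + p' \<le> N" "q' + q \<le> N" using pq MN by auto
  ultimately obtain v where v: "limitin X v v0 F" "\<forall>\<^sub>F i in F. iter (p + p') (v i) = iter (q' + q) (x i)"
    using g v0(1) unfolding good_def by blast
  have "\<forall>\<^sub>F i in F. iter p (iter p' (v i)) = iter p (iter q' (y i))"
    using v(2) ev by eventually_elim (simp flip: pow_pow add: comm[of p q'])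
  moreover have "limitin X (\<lambda>i. iter q' (y i)) (iter p' v0) F"
    using limitin_pow[OF y, of q'] v0(2) by simp
  ultimately have "\<forall>\<^sub>F i in F. iter p' (v i) = iter q' (y i)"
    by (intro eventually_eq_if_pow_eq[OF limitin_pow[OF v(1)]])
  then show "\<exists>v. limitin X v v0 F \<and> (\<forall>\<^sub>F i in F. iter p' (v i) = iter q' (y i))"
    using v(1) by blast
qed

text \<open>Lifts of different points are separated by the Hausdorff property, and
  \<open>fibre_cover\<close> together with local injectivity leaves no further points. So fibres
  vary without gain or loss, and sums over them can be compared term by term.\<close>

lemma good_fibre:
  assumes g: "good N F x x0" and pq: "p \<le> N" "q \<le> N"
  obtains s where "\<And>y0. y0 \<in> fibre p (iter q x0) \<Longrightarrow> limitin X (s y0) y0 F"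
    "\<And>y0. y0 \<in> fibre p (iter q x0) \<Longrightarrow> \<forall>\<^sub>F i in F. iter p (s y0 i) = iter q (x i)"
    "\<forall>\<^sub>F i in F. bij_betw (\<lambda>y0. s y0 i) (fibre p (iter q x0)) (fibre p (iter q (x i)))"
proof -
  let ?Y = "fibre p (iter q x0)"
  have x: "limitin X x x0 F" using g by (simp add: good_def)
  have "\<forall>y0\<in>?Y. \<exists>y. limitin X y y0 F \<and> (\<forall>\<^sub>F i in F. iter p (y i) = iter q (x i))"
    using g pq unfolding good_def fibre_def by blast
  then obtain s where s: "\<And>y0. y0 \<in> ?Y \<Longrightarrow> limitin X (s y0) y0 F"
    "\<And>y0. y0 \<in> ?Y \<Longrightarrow> \<forall>\<^sub>F i in F. iter p (s y0 i) = iter q (x i)"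
    by metis
  have "\<forall>y\<in>?Y. \<exists>U. openin X U \<and> y \<in> U \<and> inj_on (\<phi> ^^ p) U"
    using linj_pow[of _ p] by (metis (mono_tags, lifting) fibre_def mem_Collect_eq)
  then obtain U where U: "\<And>y. y \<in> ?Y \<Longrightarrow> openin X (U y) \<and> y \<in> U y" "\<And>y. y \<in> ?Y \<Longrightarrow> inj_on (\<phi> ^^ p) (U y)"
    by metis
  obtain W where W: "openin X W" "iter q x0 \<in> W" "\<And>w. w \<in> W \<Longrightarrow> fibre p w \<subseteq> (\<Union>y\<in>?Y. U y)"
    using fibre_cover[OF pow_in[OF limitin_topspace[OF x]] U(1)] by blast
  have "\<forall>\<^sub>F i in F. \<forall>y\<in>?Y. s y i \<in> U y \<and> s y i \<in> T \<and> iter p (s y i) = iter q (x i)"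
    using s U(1) by (intro eventually_ball_finite finite_fibre ballI eventually_conj limitin_in limitinD) auto
  moreover have "\<forall>\<^sub>F i in F. \<forall>y\<in>?Y. \<forall>y'\<in>?Y. y \<noteq> y' \<longrightarrow> s y i \<noteq> s y' i"
  proof (intro eventually_ball_finite finite_fibre ballI)
    fix y y' assume yy: "y \<in> ?Y" "y' \<in> ?Y"
    show "\<forall>\<^sub>F i in F. y \<noteq> y' \<longrightarrow> s y i \<noteq> s y' i"
    proof (cases "y = y'")
      case False
      then obtain V V' where V: "openin X V" "openin X V'" "y \<in> V" "y' \<in> V'" "V \<inter> V' = {}"
        using separate_points[of y y'] yy by (auto simp: fibre_def)
      from limitinD[OF s(1)[OF yy(1)] V(1,3)] limitinD[OF s(1)[OF yy(2)] V(2,4)]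
      show ?thesis by eventually_elim (use V(5) in auto)
    qed simp
  qed
  moreover have "\<forall>\<^sub>F i in F. iter q (x i) \<in> W" by (rule limitinD[OF limitin_pow[OF x] W(1,2)])
  ultimately have "\<forall>\<^sub>F i in F. bij_betw (\<lambda>y0. s y0 i) ?Y (fibre p (iter q (x i)))"
  proof eventually_elim
    case (elim i)
    have "y' \<in> (\<lambda>y0. s y0 i) ` ?Y" if y': "y' \<in> fibre p (iter q (x i))" for y'
    proof -
      obtain y where y: "y \<in> ?Y" "y' \<in> U y" using W(3)[OF elim(3)] y' by blast
      have "iter p (s y i) = iter p y'" using elim(1) y(1) y' by (auto simp: fibre_def)
      then have "s y i = y'" using inj_onD[OF U(2)[OF y(1)]] elim(1) y by blast
      then show ?thesis using y(1) by blast
    qed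
    then show ?case using elim unfolding bij_betw_def inj_on_def by (auto simp: fibre_def)
  qed
  with s show thesis by (rule that)
qed

text \<open>Continuity is tested along families that are good of level \<open>N\<close> at range and
  source. Families are indexed by points of the space because the filter to which this is finally
  applied is that of neighbourhoods inside some X_{k,l}.\<close>

definition tame_at :: "nat \<Rightarrow> ('a \<times> int \<times> 'a \<Rightarrow> complex) \<Rightarrow> bool" where
  "tame_at N f \<longleftrightarrow> (\<forall>F x x0 y y0 a b. good N F x x0 \<longrightarrow> good N F y y0 \<longrightarrow> iter a x0 = iter b y0 \<longrightarrow>
     (\<forall>\<^sub>F i in F. iter a (x i) = iter b (y i)) \<longrightarrow>
     ((\<lambda>i. f (x i, int a - int b, y i)) \<longlongrightarrow> f (x0, int a - int b, y0)) F)"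

text \<open>The level depends on the function, since each convolution raises it.\<close>

definition tame :: "('a \<times> int \<times> 'a \<Rightarrow> complex) set" where
  "tame = {f \<in> \<B>. \<exists>N. tame_at N f}"

lemma tame_atD:
  "\<lbrakk>tame_at N f; good N F x x0; good N F y y0; iter a x0 = iter b y0;
    \<forall>\<^sub>F i in F. iter a (x i) = iter b (y i)\<rbrakk> \<Longrightarrow>
     ((\<lambda>i. f (x i, int a - int b, y i)) \<longlongrightarrow> f (x0, int a - int b, y0)) F"
  by (simp add: tame_at_def)

lemma tame_at_mono: "tame_at M f \<Longrightarrow> M \<le> N \<Longrightarrow> tame_at N f"
  unfolding tame_at_def by (meson good_mono)

lemma tame_cases:
  assumes "f \<in> tame" obtains N where "f \<in> \<B>" "tame_at N f"
  using assms by (auto simp: tame_def)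

lemma tame_Cc: "Cc \<Gamma> \<subseteq> tame"
proof
  fix f assume f: "f \<in> Cc \<Gamma>"
  have "tame_at 0 f"
    unfolding tame_at_def by (intro allI impI Cc_tendsto[OF f]) (auto simp: good_def)
  then show "f \<in> tame" using f by (auto simp: tame_def Cc_def)
qed

lemma tame_zero: "(\<lambda>g. 0) \<in> tame"
  using Bc_zero by (auto simp: tame_def tame_at_def)

lemma tame_add: "f \<in> tame \<Longrightarrow> h \<in> tame \<Longrightarrow> (\<lambda>g. f g + h g) \<in> tame"
proof (elim tame_cases)
  fix M N assume f: "f \<in> \<B>" "h \<in> \<B>" and t: "tame_at M f" "tame_at N h"
  have "tame_at (max M N) f" "tame_at (max M N) h" using t by (auto elim: tame_at_mono)
  then have "tame_at (max M N) (\<lambda>g. f g + h g)"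
    unfolding tame_at_def[of _ "\<lambda>g. f g + h g"] by (intro allI impI tendsto_add tame_atD)
  then show ?thesis using f Bc_add by (auto simp: tame_def)
qed

lemma tame_scale: "f \<in> tame \<Longrightarrow> (\<lambda>g. c * f g) \<in> tame"
proof (elim tame_cases)
  fix M assume f: "f \<in> \<B>" and t: "tame_at M f"
  then have "tame_at M (\<lambda>g. c * f g)"
    unfolding tame_at_def[of _ "\<lambda>g. c * f g"] by (intro allI impI tendsto_mult_left tame_atD)
  then show ?thesis using f Bc_scale by (auto simp: tame_def)
qed

lemma star_apply: "f \<in> \<B> \<Longrightarrow> adj_fun f (x, k, y) = cnj (f (y, - k, x))"
  using ker_star[of f "(x, k)" "(y, 0)"] by (simp add: ker_def)

lemma tame_star: "f \<in> tame \<Longrightarrow> adj_fun f \<in> tame"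
proof (elim tame_cases)
  fix M assume f: "f \<in> \<B>" and t: "tame_at M f"
  have "tame_at M (adj_fun f)"
    unfolding tame_at_def
  proof (intro allI impI)
    fix F x x0 y y0 a b
    assume g: "good M F x x0" "good M F y y0" "iter a x0 = iter b y0"
      and ev: "\<forall>\<^sub>F i in F. iter a (x i) = iter b (y i)"
    have "\<forall>\<^sub>F i in F. iter b (y i) = iter a (x i)" using ev by eventually_elim simp
    from tendsto_cnj[OF tame_atD[OF t g(2,1) g(3)[symmetric] this]]
    show "((\<lambda>i. adj_fun f (x i, int a - int b, y i)) \<longlongrightarrow> adj_fun f (x0, int a - int b, y0)) F"
      by (simp add: star_apply f)
  qed
  then show ?thesis using f Bc_star by (auto simp: tame_def)
qed

text \<open>An arrow of degree \<open>m\<close> in \<open>slab n\<close> satisfies, after padding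
  both sides, the equation with \<open>n + m\<close> and \<open>n\<close> iterations. So the
  intermediate points over \<open>x\<close> lie in one fibre of \<open>iter n\<close> for each
  degree; extra points of that fibre contribute 0. As \<open>m\<close> is at least
  \<open>- int n\<close>, \<open>nat\<close> does not truncate.\<close>

lemma conv_fibre_sum:
  assumes f: "f \<in> \<B>" and h: "h \<in> \<B>" and n: "\<And>g. g \<notin> slab n \<Longrightarrow> f g = 0"
  shows "(f \<star> h) (x, k, z) = (\<Sum>m\<in>{- int n..int n}. \<Sum>y\<in>fibre n (iter (nat (int n + m)) x). f (x, m, y) * h (y, k - m, z))"
proof -
  let ?S = "SIGMA m:{- int n..int n}. fibre n (iter (nat (int n + m)) x)"
  let ?j = "\<lambda>(m, y). (y, k - m)"
  have inj: "inj_on ?j ?S" by (auto simp: inj_on_def)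
  have fin: "finite ?S" by (intro finite_SigmaI finite_fibre) simp
  have "(f \<star> h) (x, k, z) = (\<Sum>q\<in>?j ` ?S. ker f (x, k) q * ker h q (z, 0))"
    unfolding fun_ker[of "f \<star> h"]
  proof (rule ker_conv[OF f h finite_imageI[OF fin]])
    fix q assume "ker f (x, k) q \<noteq> 0"
    with n have "q \<in> adj n (x, k)" by (rule ker_adj(1)[of n f])
    then obtain a b where q: "fst q \<in> T" "a \<le> n" "b \<le> n" "k - snd q = int a - int b" "iter a x = iter b (fst q)"
      by (auto simp: adj_def slab_iff)
    have e: "nat (int n + (k - snd q)) = (n - b) + a" using q by auto
    have "iter (nat (int n + (k - snd q))) x = iter ((n - b) + b) (fst q)"
      unfolding e by (simp flip: pow_pow del: le_add_diff_inverse2 add: q(5))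
    then have "fst q \<in> fibre n (iter (nat (int n + (k - snd q))) x)" using q by (simp add: fibre_def)
    then have "(k - snd q, fst q) \<in> ?S" using q by auto
    moreover have "q = ?j (k - snd q, fst q)" by simp
    ultimately show "q \<in> ?j ` ?S" by (rule rev_image_eqI)
  qed
  also have "\<dots> = (\<Sum>(m, y)\<in>?S. f (x, m, y) * h (y, k - m, z))"
    by (subst sum.reindex[OF inj]) (simp add: ker_def case_prod_unfold)
  also have "\<dots> = (\<Sum>m\<in>{- int n..int n}. \<Sum>y\<in>fibre n (iter (nat (int n + m)) x). f (x, m, y) * h (y, k - m, z))"
    by (simp add: sum.Sigma finite_fibre)
  finally show ?thesis .
qed

lemma tame_conv:
  assumes "f \<in> tame" "h \<in> tame"
  shows "f \<star> h \<in> tame"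
proof -
  obtain N1 where f: "f \<in> \<B>" "tame_at N1 f" using tame_cases[OF assms(1)] .
  obtain N2 where h: "h \<in> \<B>" "tame_at N2 h" using tame_cases[OF assms(2)] .
  obtain n where n: "\<And>g. g \<notin> slab n \<Longrightarrow> f g = 0" by (rule Bc_cases[OF f(1)]) blast
  define M where "M = max N1 N2"
  have t: "tame_at M f" "tame_at M h" using f h by (auto simp: M_def elim: tame_at_mono)
  have conv_eq: "(f \<star> h) (x, k, z) =
      (\<Sum>m\<in>{- int n..int n}. \<Sum>y\<in>fibre n (iter (nat (int n + m)) x). f (x, m, y) * h (y, k - m, z))" for x k z
    by (rule conv_fibre_sum[OF f(1) h(1)]) (rule n)
  \<comment> \<open>The exponents \<open>q = n + m\<close> in the fibre sums go up to
    \<open>2 * n\<close>, and lifting through them costs as many levels.\<close>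
  have "tame_at (M + 2 * n) (f \<star> h)"
    unfolding tame_at_def
  proof (intro allI impI)
    fix F x x0 z z0 a b
    assume g: "good (M + 2 * n) F x x0" "good (M + 2 * n) F z z0" and eq: "iter a x0 = iter b z0"
      and ev: "\<forall>\<^sub>F i in F. iter a (x i) = iter b (z i)"
    have gM: "good M F x x0" "good M F z z0" using g by (auto elim: good_mono)
    show "((\<lambda>i. (f \<star> h) (x i, int a - int b, z i)) \<longlongrightarrow> (f \<star> h) (x0, int a - int b, z0)) F"
      unfolding conv_eq
    proof (rule tendsto_sum)
      fix m assume m: "m \<in> {- int n..int n}"
      define q where "q = nat (int n + m)"
      have q: "m = int q - int n" "q \<le> 2 * n" using m by (auto simp: q_def)
      obtain s where s: "\<And>y0. y0 \<in> fibre n (iter q x0) \<Longrightarrow> limitin X (s y0) y0 F"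
        "\<And>y0. y0 \<in> fibre n (iter q x0) \<Longrightarrow> \<forall>\<^sub>F i in F. iter n (s y0 i) = iter q (x i)"
        "\<forall>\<^sub>F i in F. bij_betw (\<lambda>y0. s y0 i) (fibre n (iter q x0)) (fibre n (iter q (x i)))"
        using good_fibre[OF g(1), of n q] q by auto
      let ?G = "\<lambda>i y. f (x i, m, y) * h (y, int a - int b - m, z i)"
      have "\<forall>\<^sub>F i in F. (\<Sum>y0\<in>fibre n (iter q x0). ?G i (s y0 i)) = (\<Sum>y\<in>fibre n (iter q (x i)). ?G i y)"
        using s(3) by eventually_elim (rule sum.reindex_bij_betw)
      moreover have "((\<lambda>i. \<Sum>y0\<in>fibre n (iter q x0). ?G i (s y0 i)) \<longlongrightarrow>
          (\<Sum>y0\<in>fibre n (iter q x0). f (x0, m, y0) * h (y0, int a - int b - m, z0))) F"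
      proof (intro tendsto_sum tendsto_mult)
        fix y0 assume y0: "y0 \<in> fibre n (iter q x0)"
        have y0q: "iter n y0 = iter q x0" using y0 by (simp add: fibre_def)
        have sg: "good M F (s y0) y0"
          using q by (intro good_lift[OF g(1) _ _ s(1)[OF y0] y0q s(2)[OF y0]]) auto
        have ev': "\<forall>\<^sub>F i in F. iter q (x i) = iter n (s y0 i)"
          using s(2)[OF y0] by eventually_elim simp
        show "((\<lambda>i. f (x i, m, s y0 i)) \<longlongrightarrow> f (x0, m, y0)) F"
          unfolding q(1) by (rule tame_atD[OF t(1) gM(1) sg y0q[symmetric] ev'])
        \<comment> \<open>The degree of the second factor is rewritten to match the equation
          obtained by composing the arrow from \<open>x\<close> to \<open>z\<close> with the inverse
          of the one from \<open>x\<close> to \<open>y\<close>.\<close>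
        have e: "int a - int b - m = int (a + n) - int (b + q)" using q by simp
        have comm: "iter (a + n) y = iter (b + q) z"
          if "iter q x = iter n y" "iter a x = iter b z" for x y z
        proof -
          have "iter (a + n) y = iter a (iter q x)" by (simp only: pow_pow[symmetric] that(1))
          also have "\<dots> = iter (q + a) x" by (simp add: pow_pow add.commute)
          also have "\<dots> = iter (q + b) z" using that(2) by (simp flip: pow_pow)
          finally show ?thesis by (simp add: add.commute)
        qed
        have "\<forall>\<^sub>F i in F. iter (a + n) (s y0 i) = iter (b + q) (z i)"
          using ev' ev by eventually_elim (rule comm)
        then show "((\<lambda>i. h (s y0 i, int a - int b - m, z i)) \<longlongrightarrow> h (y0, int a - int b - m, z0)) F"
          unfolding e by (rule tame_atD[OF t(2) sg gM(2) comm[OF y0q[symmetric] eq]])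
      qed
      ultimately show "((\<lambda>i. \<Sum>y\<in>fibre n (iter (nat (int n + m)) (x i)). ?G i y) \<longlongrightarrow>
          (\<Sum>y\<in>fibre n (iter (nat (int n + m)) x0). f (x0, m, y) * h (y, int a - int b - m, z0))) F"
        unfolding q_def[symmetric] by (rule Lim_transform_eventually[rotated])
    qed
  qed
  then show ?thesis using Bc_conv[OF f(1) h(1)] by (auto simp: tame_def)
qed

section \<open>Continuity on the sets X_{k,l} after pulling back along iterates\<close>

lemma Xkl_fibre: "\<X> k l = {x \<in> T. card (fibre k (iter k x)) = l}"
  using finite_fibre by (auto simp: Xkl_def fibre_def)

lemma Xkl_subset: "\<X> k l \<subseteq> T"
  by (auto simp: Xkl_def)

text \<open>Since \<open>x\<close> stays in \<open>Xkl\<close>, the fibre of \<open>iter M x\<close> near that of \<open>iter M y0\<close> can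
  lose no point.\<close>

lemma Xkl_fibre_lift:
  fixes M l :: nat
  defines "F y0 \<equiv> inf (nhdsin X y0) (principal (\<X> M l))"
  assumes y0: "y0 \<in> \<X> M l" and z0: "z0 \<in> fibre M (iter M y0)"
  obtains z where "limitin X z z0 (F y0)" "\<forall>\<^sub>F i in F y0. iter M (z i) = iter M i"
proof -
  let ?Y = "fibre M (iter M y0)"
  have y0T: "y0 \<in> T" using y0 Xkl_subset by blast
  have evF: "eventually R (F y0) \<longleftrightarrow> (\<exists>S. openin X S \<and> y0 \<in> S \<and> (\<forall>i\<in>S. i \<in> \<X> M l \<longrightarrow> R i))" for R
    by (simp add: F_def eventually_inf_principal eventually_nhdsin y0T)
  have "\<forall>y\<in>?Y. \<exists>U. openin X U \<and> y \<in> U \<and> inj_on (\<phi> ^^ M) U"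
    using linj_pow[of _ M] by (metis (mono_tags, lifting) fibre_def mem_Collect_eq)
  then obtain U where U: "\<And>y. y \<in> ?Y \<Longrightarrow> openin X (U y) \<and> y \<in> U y" "\<And>y. y \<in> ?Y \<Longrightarrow> inj_on (\<phi> ^^ M) (U y)"
    by metis
  have ne: "\<forall>\<^sub>F i in F y0. fibre M (iter M i) \<inter> (V \<inter> U z0) \<noteq> {}" if V: "openin X V" "z0 \<in> V" for V
  proof -
    \<comment> \<open>The cover of the fibre is shrunk at \<open>z0\<close> alone, so a point
      assigned to \<open>z0\<close> is forced into \<open>V\<close>.\<close>
    define U' where "U' y = (if y = z0 then V \<inter> U z0 else U y)" for y
    have U': "openin X (U' y) \<and> y \<in> U' y" if "y \<in> ?Y" for y
      using U(1)[OF that] V U(1)[OF z0] by (auto simp: U'_def)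
    have injU': "inj_on (\<phi> ^^ M) (U' y)" if "y \<in> ?Y" for y
      using U(2)[OF that] U(2)[OF z0] by (auto simp: U'_def intro: inj_on_subset)
    obtain W where W: "openin X W" "iter M y0 \<in> W" "\<And>w. w \<in> W \<Longrightarrow> fibre M w \<subseteq> (\<Union>y\<in>?Y. U' y)"
      using fibre_cover[OF pow_in[OF y0T] U'] by blast
    let ?S = "{i \<in> T. iter M i \<in> W}"
    have "fibre M (iter M i) \<inter> (V \<inter> U z0) \<noteq> {}" if i: "i \<in> ?S" "i \<in> \<X> M l" for i
    proof -
      let ?Yi = "fibre M (iter M i)"
      have "\<forall>y\<in>?Yi. \<exists>c\<in>?Y. y \<in> U' c" using W(3)[of "iter M i"] i(1) by blast
      then obtain c where c: "\<And>y. y \<in> ?Yi \<Longrightarrow> c y \<in> ?Y \<and> y \<in> U' (c y)" by metis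
      have "inj_on c ?Yi"
      proof (rule inj_onI)
        fix y y' assume yy: "y \<in> ?Yi" "y' \<in> ?Yi" "c y = c y'"
        then have "y \<in> U' (c y)" "y' \<in> U' (c y)" "iter M y = iter M y'" using c[of y] c[of y'] by (auto simp: fibre_def)
        then show "y = y'" using injU'[of "c y"] c[OF yy(1)] by (auto dest: inj_onD)
      qed
      moreover have "c ` ?Yi \<subseteq> ?Y" using c by blast
      moreover have "card ?Yi = card ?Y" using i(2) y0 by (simp add: Xkl_fibre)
      \<comment> \<open>An injection between finite sets of equal size is onto, hence some point of
        the fibre over \<open>iter M i\<close> is assigned to \<open>z0\<close>.\<close>
      ultimately have "c ` ?Yi = ?Y"
        by (metis card_image card_subset_eq finite_fibre)
      with z0 have "z0 \<in> c ` ?Yi" by simp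
      then obtain y where "y \<in> ?Yi" "c y = z0" by (elim imageE) simp
      then show ?thesis using c[of y] by (auto simp: U'_def)
    qed
    moreover have "openin X ?S" using W(1) openin_continuous_map_preimage[OF continuous_pow] by blast
    ultimately show ?thesis unfolding evF using W(2) y0T by blast
  qed
  \<comment> \<open>The choice is made in \<open>U z0\<close> and so is independent of
    \<open>V\<close>. Injectivity of \<open>iter M\<close> on \<open>U z0\<close> then places the
    chosen point in every smaller neighbourhood \<open>V\<close> that meets the fibre there.\<close>
  define z where "z i = (SOME y. y \<in> fibre M (iter M i) \<inter> U z0)" for i
  have z: "z i \<in> fibre M (iter M i) \<inter> U z0" if "fibre M (iter M i) \<inter> U z0 \<noteq> {}" for i
    unfolding z_def by (rule someI_ex) (use that in blast)
  have zV: "z i \<in> V" if i: "fibre M (iter M i) \<inter> (V \<inter> U z0) \<noteq> {}" for i V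
  proof -
    obtain y where y: "y \<in> fibre M (iter M i)" "y \<in> V" "y \<in> U z0" using i by blast
    have "z i \<in> fibre M (iter M i) \<inter> U z0" using i by (intro z) blast
    then have "iter M (z i) = iter M y" "z i \<in> U z0" using y(1) by (simp_all add: fibre_def)
    then have "z i = y" using y(3) by (rule inj_onD[OF U(2)[OF z0]])
    then show ?thesis using y by simp
  qed
  have "limitin X z z0 (F y0)"
    unfolding limitin_def
  proof (intro conjI allI impI)
    show "z0 \<in> T" using z0 by (simp add: fibre_def)
    fix V assume "openin X V \<and> z0 \<in> V"
    then have "\<forall>\<^sub>F i in F y0. fibre M (iter M i) \<inter> (V \<inter> U z0) \<noteq> {}" by (simp add: ne)
    then show "\<forall>\<^sub>F i in F y0. z i \<in> V" by eventually_elim (rule zV)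
  qed
  moreover have "\<forall>\<^sub>F i in F y0. iter M (z i) = iter M i"
    using ne[OF U(1)[OF z0, THEN conjunct1] U(1)[OF z0, THEN conjunct2]]
  proof eventually_elim
    case (elim i)
    then show ?case using z[of i] by (simp add: fibre_def)
  qed
  ultimately show thesis by (rule that)
qed

text \<open>The shift by \<open>iter N\<close> makes room to go backwards: a solution of
  \<open>iter p v0 = iter (q + N) y0\<close> with \<open>p \<le> N\<close> is an image of a point
  \<open>z0\<close> in the fibre of \<open>iter (2 * N)\<close> through \<open>y0\<close>. On the
  set where that fibre has constant size, \<open>z0\<close> can be followed.\<close>

lemma good_Xkl:
  fixes N l :: nat
  defines "F y0 \<equiv> inf (nhdsin X y0) (principal (\<X> (2 * N) l))"
  assumes y0: "y0 \<in> \<X> (2 * N) l"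
  shows "good N (F y0) (\<phi> ^^ N) (iter N y0)"
proof -
  have y0T: "y0 \<in> T" using y0 Xkl_subset by blast
  have id: "limitin X (\<lambda>i. i) y0 (F y0)"
    using y0T by (auto simp: F_def limitin_def eventually_inf_principal eventually_nhdsin)
  show ?thesis
    unfolding good_def
  proof (intro conjI allI impI ballI)
    show "limitin X (\<phi> ^^ N) (iter N y0) (F y0)" using limitin_pow[OF id] .
    fix p q v0 assume pq: "p \<le> N" "q \<le> N" and v0: "v0 \<in> T" "iter p v0 = iter q (iter N y0)"
    \<comment> \<open>\<open>p \<le> N\<close> makes this natural subtraction exact.\<close>
    define r where "r = q + N - p"
    have r: "p + r = q + N" using pq by (simp add: r_def)
    obtain z0 where z0: "z0 \<in> T" "iter r z0 = v0" using surj_pow[OF v0(1)] by blast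
    have z0q: "iter (q + N) z0 = iter (q + N) y0"
      unfolding r[symmetric] using v0 z0 by (simp flip: pow_pow) (simp add: pow_pow r)
    have "iter ((N - q) + (q + N)) z0 = iter ((N - q) + (q + N)) y0"
      by (simp only: pow_pow[symmetric, of "N - q"] z0q)
    then have "z0 \<in> fibre (2 * N) (iter (2 * N) y0)" using z0 pq by (simp add: fibre_def mult_2)
    then obtain z where z: "limitin X z z0 (F y0)" "\<forall>\<^sub>F i in F y0. iter (2 * N) (z i) = iter (2 * N) i"
      using Xkl_fibre_lift[OF y0] unfolding F_def by blast
    have N2: "2 * N = (N - q) + (q + N)" using pq by simp
    \<comment> \<open>The lift satisfies an equation after \<open>2 * N\<close> iterations;
      uniqueness of lifts removes the last \<open>N - q\<close> of them.\<close>
    have "limitin X (\<lambda>i. iter (q + N) i) (iter (q + N) z0) (F y0)"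
      using limitin_pow[OF id, of "q + N"] z0q by simp
    then have ev: "\<forall>\<^sub>F i in F y0. iter (q + N) (z i) = iter (q + N) i"
      using z(2) unfolding N2 pow_pow[symmetric, of "N - q"]
      by (intro eventually_eq_if_pow_eq[OF limitin_pow[OF z(1)]])
    have "limitin X (\<lambda>i. iter r (z i)) v0 (F y0)" using limitin_pow[OF z(1), of r] z0 by simp
    moreover have "\<forall>\<^sub>F i in F y0. iter p (iter r (z i)) = iter q (iter N i)"
      using ev by eventually_elim (simp add: pow_pow r)
    ultimately show "\<exists>y. limitin X y v0 (F y0) \<and> (\<forall>\<^sub>F i in F y0. iter p (y i) = iter q (iter N i))"
      by blast
  qed
qed

lemma tame_near:
  assumes t: "tame_at N f" and y0: "y0 \<in> \<X> (2 * N) l" and "e > 0"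
  obtains U where "openin X U" "y0 \<in> U"
    "\<And>y. y \<in> U \<inter> \<X> (2 * N) l \<Longrightarrow>
      cmod (f (iter N y, 0, iter N y) - f (iter N y0, 0, iter N y0)) < e"
proof -
  let ?F = "inf (nhdsin X y0) (principal (\<X> (2 * N) l))"
  have y0T: "y0 \<in> T" using y0 Xkl_subset by blast
  have "((\<lambda>i. f (iter N i, int 0 - int 0, iter N i)) \<longlongrightarrow> f (iter N y0, int 0 - int 0, iter N y0)) ?F"
    by (rule tame_atD[OF t good_Xkl[OF y0] good_Xkl[OF y0]]) auto
  then have "\<forall>\<^sub>F i in ?F. dist (f (iter N i, 0, iter N i)) (f (iter N y0, 0, iter N y0)) < e"
    using \<open>e > 0\<close> by (auto simp: tendsto_iff)
  then show thesis
    using that by (auto simp: eventually_inf_principal eventually_nhdsin y0T dist_norm)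
qed

section \<open>Elements of the reduced algebra\<close>

abbreviation diag :: "('a \<Rightarrow> complex) \<Rightarrow> 'a \<times> int \<times> 'a \<Rightarrow> complex" where
  "diag \<equiv> bis 0 0"

text \<open>The index of the product of the arrow \<open>(iter j x, - int j, x)\<close>, on which
  \<open>bis 0 j g\<close> lives, with the arrow of index \<open>q\<close>.\<close>

abbreviation shift :: "nat \<Rightarrow> 'a \<times> int \<Rightarrow> 'a \<times> int" where
  "shift j q \<equiv> (iter j (fst q), snd q - int j)"

lemma ker_bis0: "ker (bis 0 j g) p q = (if fst q \<in> T \<and> p = shift j q then g (fst q) else 0)"
  using pow_in[of "fst q" j] by (cases p) (auto simp: ker_def bis_def Eab_iff)

lemma ker_diag: "ker (diag d) p q = (if p = q \<and> fst p \<in> T then d (fst p) else 0)"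
  by (cases p; cases q) (auto simp: ker_bis0)

lemma ker_off: "f \<in> \<B> \<Longrightarrow> fst p \<notin> T \<or> fst q \<notin> T \<Longrightarrow> ker f p q = 0"
  by (auto simp: ker_def Gamma_set_iff intro: Bc_zero_off)

lemma bis_Bc: "(\<And>x. x \<in> T \<Longrightarrow> cmod (g x) \<le> C) \<Longrightarrow> bis a b g \<in> \<B>"
proof (rule BcI[of "max a b" _ "max C 0"])
  assume C: "\<And>x. x \<in> T \<Longrightarrow> cmod (g x) \<le> C"
  fix h
  show "cmod (bis a b g h) \<le> max C 0"
    using C by (cases h) (auto simp: bis_def Eab_iff max.coboundedI1)
  show "bis a b g h = 0" if "h \<notin> slab (max a b)"
    using that Eab_in_slab[of a "max a b" b] by (cases h) (auto simp: bis_def)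
qed

lemma bis_bounded:
  assumes "bis a b g \<in> \<B>" "b \<le> a"
  obtains C where "\<And>x. x \<in> T \<Longrightarrow> cmod (g x) \<le> C"
proof -
  obtain n C where C: "\<And>h. cmod (bis a b g h) \<le> C" by (rule Bc_cases[OF assms(1)]) blast
  have "cmod (g y) \<le> C" if y: "y \<in> T" for y
  proof -
    obtain x where "x \<in> T" "iter a x = iter b y" using surj_pow[OF pow_in[OF y]] by blast
    then have "bis a b g (x, int a - int b, y) = g y" using y by (simp add: bis_def Eab_iff)
    then show ?thesis using C[of "(x, int a - int b, y)"] by simp
  qed
  then show thesis by (rule that)
qed

lemma opbound_diag: "0 \<le> C \<Longrightarrow> (\<And>x. x \<in> T \<Longrightarrow> cmod (d x) \<le> C) \<Longrightarrow> opbound (diag d) C"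
proof (rule opbound_schur)
  assume C: "0 \<le> C" "\<And>x. x \<in> T \<Longrightarrow> cmod (d x) \<le> C"
  fix p and F :: "('a \<times> int) set" assume F: "finite F" "p \<in> F"
  have "(\<Sum>q\<in>F. cmod (ker (diag d) p q)) = (\<Sum>q\<in>{p}. cmod (ker (diag d) p q))"
    using F by (intro sum.mono_neutral_right) (auto simp: ker_diag)
  then show "(\<Sum>q\<in>F. cmod (ker (diag d) p q)) \<le> C" using C by (simp add: ker_diag)
  have "(\<Sum>q\<in>F. cmod (ker (diag d) q p)) = (\<Sum>q\<in>{p}. cmod (ker (diag d) q p))"
    using F by (intro sum.mono_neutral_right) (auto simp: ker_diag)
  then show "(\<Sum>q\<in>F. cmod (ker (diag d) q p)) \<le> C" using C by (simp add: ker_diag)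
qed

lemma bnorm_diag: "0 \<le> C \<Longrightarrow> (\<And>x. x \<in> T \<Longrightarrow> cmod (d x) \<le> C) \<Longrightarrow> bnorm (diag d) \<le> C"
  by (intro bnorm_le opbound_diag bis_Bc[where C = C])

text \<open>Injectivity of \<open>iter j\<close> on \<open>U\<close> leaves at most one nonzero
  entry in each row; columns have at most one in any case. The Schur test then gives the supremum
  bound.\<close>

lemma bnorm_shift:
  assumes C: "0 \<le> C" "\<And>x. x \<in> T \<Longrightarrow> cmod (g x) \<le> C"
    and U: "inj_on (\<phi> ^^ j) U" "\<And>x. x \<in> T \<Longrightarrow> x \<notin> U \<Longrightarrow> g x = 0"
  shows "bnorm (bis 0 j g) \<le> C"
proof (intro bnorm_le opbound_schur bis_Bc[where C = C] C)
  fix p and F :: "('a \<times> int) set" assume F: "finite F" "p \<in> F"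
  have "(\<Sum>q\<in>F. cmod (ker (bis 0 j g) q p)) = (\<Sum>q\<in>F \<inter> {shift j p}. cmod (ker (bis 0 j g) q p))"
    using F by (intro sum.mono_neutral_right) (auto simp: ker_bis0)
  also have "\<dots> \<le> (\<Sum>q\<in>{shift j p}. cmod (ker (bis 0 j g) q p))" by (intro sum_mono2) auto
  also have "\<dots> \<le> C" using C by (simp add: ker_bis0)
  finally show "(\<Sum>q\<in>F. cmod (ker (bis 0 j g) q p)) \<le> C" .
  show "(\<Sum>q\<in>F. cmod (ker (bis 0 j g) p q)) \<le> C"
  proof (cases "\<exists>q\<in>F. ker (bis 0 j g) p q \<noteq> 0")
    case True
    then obtain q where q: "q \<in> F" "ker (bis 0 j g) p q \<noteq> 0" by blast
    have "ker (bis 0 j g) p r = 0" if "r \<noteq> q" for r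
    proof (rule ccontr)
      assume "ker (bis 0 j g) p r \<noteq> 0"
      then have "fst q \<in> U" "fst r \<in> U" "iter j (fst q) = iter j (fst r)" "snd q = snd r"
        using q U(2) by (auto simp: ker_bis0 split: if_splits)
      then have "q = r" using U(1) by (auto simp: prod_eq_iff dest: inj_onD)
      then show False using that by simp
    qed
    then have "(\<Sum>r\<in>F. cmod (ker (bis 0 j g) p r)) = (\<Sum>r\<in>{q}. cmod (ker (bis 0 j g) p r))"
      using F q by (intro sum.mono_neutral_right) auto
    then show ?thesis using C by (simp add: ker_bis0)
  next
    case False
    then have "(\<Sum>q\<in>F. cmod (ker (bis 0 j g) p q)) = 0" by (intro sum.neutral) auto
    then show ?thesis using C by simp
  qed
qed

lemma ker_conv_diag:
  assumes f: "f \<in> \<B>" and d: "diag d \<in> \<B>"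
  shows "ker (f \<star> diag d) p q = ker f p q * d (fst q)"
proof -
  have "ker (f \<star> diag d) p q = (\<Sum>r\<in>{q}. ker f p r * ker (diag d) r q)"
    by (intro ker_conv f d) (auto simp: ker_diag split: if_splits)
  then show ?thesis using ker_off[OF f, of p q] by (auto simp: ker_diag)
qed

lemma ker_diag_conv:
  assumes f: "f \<in> \<B>" and d: "diag d \<in> \<B>"
  shows "ker (diag d \<star> f) p q = d (fst p) * ker f p q"
proof -
  have "ker (diag d \<star> f) p q = (\<Sum>r\<in>{p}. ker (diag d) p r * ker f r q)"
    by (intro ker_conv f d) (auto simp: ker_diag split: if_splits)
  then show ?thesis using ker_off[OF f, of p q] by (auto simp: ker_diag)
qed

lemma diag_conv_diag:
  assumes "diag d \<in> \<B>" "diag d' \<in> \<B>"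
  shows "diag d \<star> diag d' = diag (\<lambda>x. d x * d' x)"
  by (rule fun_eq_kerI) (auto simp: ker_conv_diag assms ker_diag)

lemma ker_conv_shift:
  assumes f: "f \<in> \<B>" and g: "bis 0 j g \<in> \<B>"
  shows "ker (f \<star> bis 0 j g) p q = (if fst q \<in> T then ker f p (shift j q) * g (fst q) else 0)"
proof -
  have "ker (f \<star> bis 0 j g) p q = (\<Sum>r\<in>{shift j q}. ker f p r * ker (bis 0 j g) r q)"
    by (intro ker_conv f g) (auto simp: ker_bis0 split: if_splits)
  then show ?thesis by (auto simp: ker_bis0)
qed

lemma ker_adj_shift_conv:
  assumes f: "f \<in> \<B>" and g: "bis 0 j g \<in> \<B>"
  shows "ker (adj_fun (bis 0 j g) \<star> f) p q = (if fst p \<in> T then cnj (g (fst p)) * ker f (shift j p) q else 0)"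
proof -
  have "ker (adj_fun (bis 0 j g) \<star> f) p q = (\<Sum>r\<in>{shift j p}. ker (adj_fun (bis 0 j g)) p r * ker f r q)"
    by (intro ker_conv f Bc_star g) (auto simp: ker_star g ker_bis0 split: if_splits)
  then show ?thesis by (auto simp: ker_star g ker_bis0)
qed

text \<open>Conjugation by the shift is the transfer operator of \<open>iter j\<close>: two indices
  are linked exactly when both are the shift of the same index, so the result is again a function on
  the unit space.\<close>

lemma push_forward_diag:
  assumes d: "diag d \<in> \<B>" and V: "bis 0 j (\<lambda>x. 1) \<in> \<B>"
  shows "bis 0 j (\<lambda>x. 1) \<star> diag d \<star> adj_fun (bis 0 j (\<lambda>x. 1)) = diag (\<lambda>x. \<Sum>y\<in>fibre j x. d y)"
proof (rule fun_eq_kerI)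
  fix p q :: "'a \<times> int"
  let ?V = "bis 0 j (\<lambda>x. 1)"
  let ?e = "\<lambda>y. (y, snd p + int j)"
  have inj: "inj_on ?e A" for A by (auto simp: inj_on_def)
  have "ker (?V \<star> diag d \<star> adj_fun ?V) p q = (\<Sum>r\<in>?e ` fibre j (fst p). ker (?V \<star> diag d) p r * ker (adj_fun ?V) r q)"
  proof (intro ker_conv Bc_conv Bc_star V d finite_imageI finite_fibre)
    fix r assume "ker (?V \<star> diag d) p r \<noteq> 0"
    then have "fst r \<in> T" "p = shift j r" by (auto simp: ker_conv_diag V d ker_bis0 split: if_splits)
    then show "r \<in> ?e ` fibre j (fst p)" by (intro image_eqI[of _ _ "fst r"]) (auto simp: fibre_def)
  qed
  also have "\<dots> = (\<Sum>y\<in>fibre j (fst p). if p = q then d y else 0)"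
    unfolding sum.reindex[OF inj]
    by (rule sum.cong) (auto simp: ker_conv_diag ker_star V d ker_bis0 fibre_def prod_eq_iff)
  also have "\<dots> = ker (diag (\<lambda>x. \<Sum>y\<in>fibre j x. d y)) p q"
  proof -
    have "fibre j (fst p) = {}" if "fst p \<notin> T"
      using that by (auto simp: fibre_def dest: pow_in[of _ j])
    then show ?thesis by (cases "p = q") (auto simp: ker_diag)
  qed
  finally show "ker (?V \<star> diag d \<star> adj_fun ?V) p q = ker (diag (\<lambda>x. \<Sum>y\<in>fibre j x. d y)) p q" .
qed

abbreviation fcard :: "nat \<Rightarrow> 'a \<Rightarrow> nat" where
  "fcard k x \<equiv> card (fibre k (iter k x))"

text \<open>This is how discontinuous fibre counts enter an algebra generated by continuous
  functions: they are the diagonal entries of the square of the relation matrix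
  \<open>bis k k (\<lambda>x. 1)\<close>. Cutting down to a set on which \<open>iter k\<close> is
  injective removes the other entries.\<close>

lemma diag_fcard:
  assumes g: "diag g \<in> \<B>" and U: "inj_on (\<phi> ^^ k) U" "\<And>x. x \<in> T \<Longrightarrow> x \<notin> U \<Longrightarrow> g x = 0"
    and V: "bis k k (\<lambda>x. 1) \<in> \<B>"
  shows "diag g \<star> (bis k k (\<lambda>x. 1) \<star> bis k k (\<lambda>x. 1)) \<star> diag g = diag (\<lambda>x. (g x)\<^sup>2 * of_nat (fcard k x))"
proof (rule fun_eq_kerI)
  fix p q :: "'a \<times> int"
  let ?V = "bis k k (\<lambda>x. 1)"
  let ?e = "\<lambda>y. (y, snd p)"
  have inj: "inj_on ?e A" for A by (auto simp: inj_on_def)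
  have kV: "ker ?V p q = (if fst p \<in> T \<and> fst q \<in> T \<and> snd p = snd q \<and> iter k (fst p) = iter k (fst q) then 1 else 0)" for p q
    by (auto simp: ker_def bis_def Eab_iff)
  have VV: "ker (?V \<star> ?V) p q = (\<Sum>r\<in>?e ` fibre k (iter k (fst p)). ker ?V p r * ker ?V r q)"
  proof (intro ker_conv V finite_imageI finite_fibre)
    fix r assume "ker ?V p r \<noteq> 0"
    then show "r \<in> ?e ` fibre k (iter k (fst p))"
      by (intro image_eqI[of _ _ "fst r"]) (auto simp: fibre_def kV prod_eq_iff split: if_splits)
  qed
  have "ker (diag g \<star> (?V \<star> ?V) \<star> diag g) p q = g (fst p) * ker (?V \<star> ?V) p q * g (fst q)"
    by (simp add: ker_conv_diag ker_diag_conv Bc_conv V g)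
  also have "\<dots> = ker (diag (\<lambda>x. (g x)\<^sup>2 * of_nat (fcard k x))) p q"
  proof (cases "p = q \<and> fst p \<in> T")
    case True
    have "ker (?V \<star> ?V) p q = (\<Sum>y\<in>fibre k (iter k (fst p)). 1)"
      unfolding VV sum.reindex[OF inj] using True by (intro sum.cong) (auto simp: kV fibre_def)
    moreover have "fst q \<in> T" using True by auto
    ultimately show ?thesis using True by (simp add: ker_diag power2_eq_square)
  next
    case False
    have "g (fst p) * ker (?V \<star> ?V) p q * g (fst q) = 0"
    proof (rule ccontr)
      assume nz: "g (fst p) * ker (?V \<star> ?V) p q * g (fst q) \<noteq> 0"
      then have T: "fst p \<in> T" "fst q \<in> T" using ker_off[OF Bc_conv[OF V V], of p q] by auto
      have "\<exists>r. ker ?V p r * ker ?V r q \<noteq> 0" using nz unfolding VV by (metis (no_types, lifting) mult_eq_0_iff sum.neutral)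
      then have "snd p = snd q" "iter k (fst p) = iter k (fst q)" by (auto simp: kV split: if_splits)
      moreover have "fst p \<in> U" "fst q \<in> U" using nz T U(2) by auto
      ultimately have "p = q" using U(1) by (auto simp: prod_eq_iff dest: inj_onD)
      then show False using False T by simp
    qed
    then show ?thesis using False by (auto simp: ker_diag)
  qed
  finally show "ker (diag g \<star> (?V \<star> ?V) \<star> diag g) p q = ker (diag (\<lambda>x. (g x)\<^sup>2 * of_nat (fcard k x))) p q" .
qed

text \<open>The plateau \<open>W\<close> supplies an open set on which all powers of
  \<open>g\<close> remain 1, and later a place for a second bump absorbed by the first.\<close>

lemma bump:
  assumes U: "openin X U" "y \<in> U"
  obtains g :: "'a \<Rightarrow> real" and W where "continuous_map X euclidean (\<lambda>x. complex_of_real (g x))"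
    "\<And>x. 0 \<le> g x" "\<And>x. g x \<le> 1" "openin X W" "y \<in> W" "W \<subseteq> U" "\<And>x. x \<in> W \<Longrightarrow> g x = 1"
    "\<And>x. x \<in> T \<Longrightarrow> x \<notin> U \<Longrightarrow> g x = 0"
proof -
  have yT: "y \<in> T" using U openin_subset by blast
  have "normal_space X" by (rule compact_Hausdorff_or_regular_imp_normal_space) (use compact Hausdorff in auto)
  moreover have "closedin X {y}" using Hausdorff yT by (simp add: closedin_Hausdorff_sing_eq)
  moreover have "closedin X (T - U)" using U by blast
  ultimately obtain f where f: "continuous_map X euclideanreal f" "f ` {y} \<subseteq> {1}" "f ` (T - U) \<subseteq> {0}"
    by (rule Urysohn_lemma_alt[of X "{y}" "T - U" 1 0]) (use U in \<open>auto simp: disjnt_def\<close>)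
  \<comment> \<open>Doubling and truncating turns the open set where \<open>f\<close> exceeds 1/2
    into a plateau.\<close>
  define g where "g x = min 1 (max 0 (2 * f x))" for x
  define W where "W = {x \<in> T. f x \<in> {1/2<..}}"
  have "continuous_map X euclideanreal g"
    unfolding g_def by (intro continuous_map_real_min continuous_map_real_max continuous_map_real_mult f) auto
  then have "continuous_map X euclidean (\<lambda>x. complex_of_real (g x))"
    using continuous_map_compose[of X euclideanreal g euclidean complex_of_real]
    by (simp add: o_def continuous_on_of_real_id)
  moreover have "openin X W" unfolding W_def by (rule openin_continuous_map_preimage[OF f(1)]) simp
  moreover have "y \<in> W" using f(2) yT by (simp add: W_def)
  moreover have "W \<subseteq> U" using f(3) by (fastforce simp: W_def)
  moreover have "g x = 1" if "x \<in> W" for x using that by (auto simp: W_def g_def)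
  moreover have "g x = 0" if "x \<in> T" "x \<notin> U" for x using that f(3) by (auto simp: g_def)
  moreover have "0 \<le> g x" "g x \<le> 1" for x by (auto simp: g_def)
  ultimately show thesis by (intro that)
qed

section \<open>Functions that belong to the reduced algebra\<close>

abbreviation "R \<equiv> reduced_Cstar_algebra \<Gamma>"
abbreviation "CR \<equiv> elements R"
abbreviation const_cls :: "('a \<times> int \<times> 'a \<Rightarrow> complex) \<Rightarrow> (nat \<Rightarrow> 'a \<times> int \<times> 'a \<Rightarrow> complex) set" where
  "const_cls f \<equiv> B.cls (\<lambda>n. f)"

lemma CR_eq: "CR = elements (cstar_generated \<C> (to_completion \<A> ` Cc \<Gamma>))"
  by (simp add: reduced_Cstar_algebra_def reduced_B_algebra_def)

lemma R_simps [simp]: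
  "azero R = B.cls (\<lambda>n g. 0)"
  "aadd R = aadd \<C>"
  "ascale R = ascale \<C>"
  "amult R = amult \<C>"
  "astar R = astar \<C>"
  "adist R = adist \<C>"
  by (simp_all add: fun_eq_iff adist_def reduced_Cstar_algebra_def reduced_B_algebra_def cstar_generated_def B.completion_zero)

lemma Cc_subset: "Cc \<Gamma> \<subseteq> elements \<A>"
  by (auto simp: Cc_def)

lemma cstar_subalgebra_CR: "cstar_subalgebra \<C> CR"
  unfolding CR_eq by (rule B.cstar_subalgebra_cstar_generated[OF Cc_subset])

lemma CR_tame: "CR \<subseteq> B.limit_classes tame"
  unfolding CR_eq
  by (rule B.cstar_generated_subset_limit_classes)
    (auto simp: tame_zero tame_add tame_scale tame_conv tame_star tame_Cc[THEN subsetD] elim: tame_cases)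

definition inC :: "('a \<times> int \<times> 'a \<Rightarrow> complex) \<Rightarrow> bool" where
  "inC f \<longleftrightarrow> f \<in> \<B> \<and> const_cls f \<in> CR"

lemma inC_Bc: "inC f \<Longrightarrow> f \<in> \<B>"
  by (simp add: inC_def)

lemma const_cauchy: "f \<in> \<B> \<Longrightarrow> (\<lambda>n. f) \<in> B.cauchy"
  by (rule B.cauchy_const) simp

lemma inC_Cc: "f \<in> Cc \<Gamma> \<Longrightarrow> inC f"
  using B.cstar_generated_superset[of "to_completion \<A> ` Cc \<Gamma>" "\<C>"]
  by (auto simp: inC_def CR_eq Cc_def B.to_completion_eq)

lemma CR_closed:
  shows CR_completion: "CR \<subseteq> elements \<C>"
    and CR_zero: "B.cls (\<lambda>n g. 0) \<in> CR"
    and CR_add: "\<lbrakk>a \<in> CR; b \<in> CR\<rbrakk> \<Longrightarrow> aadd \<C> a b \<in> CR"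
    and CR_scale: "a \<in> CR \<Longrightarrow> ascale \<C> c a \<in> CR"
    and CR_mult: "\<lbrakk>a \<in> CR; b \<in> CR\<rbrakk> \<Longrightarrow> amult \<C> a b \<in> CR"
    and CR_star: "a \<in> CR \<Longrightarrow> astar \<C> a \<in> CR"
  using cstar_subalgebra_CR B.completion_zero unfolding cstar_subalgebra_def linear_subspace_def by simp_all

lemma inC_conv: "inC f \<Longrightarrow> inC h \<Longrightarrow> inC (f \<star> h)"
  using CR_mult[of "const_cls f" "const_cls h"] B.completion_mult[OF const_cauchy const_cauchy, of f h]
  by (simp add: inC_def Bc_conv)

lemma inC_star: "inC f \<Longrightarrow> inC (adj_fun f)"
  using CR_star[of "const_cls f"] B.completion_star[OF const_cauchy, of f]
  by (simp add: inC_def Bc_star)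

lemma inC_add: "inC f \<Longrightarrow> inC h \<Longrightarrow> inC (\<lambda>g. f g + h g)"
  using CR_add[of "const_cls f" "const_cls h"] B.completion_add[OF const_cauchy const_cauchy, of f h]
  by (simp add: inC_def Bc_add)

lemma inC_scale: "inC f \<Longrightarrow> inC (\<lambda>g. c * f g)"
  using CR_scale[of "const_cls f" c] B.completion_scale[OF const_cauchy, of f c]
  by (simp add: inC_def Bc_scale)

lemma inC_bis: "continuous_map X euclidean g \<Longrightarrow> inC (bis a b g)"
  by (intro inC_Cc bis_in_Cc)

lemma inC_diag_mult: "inC (diag d) \<Longrightarrow> inC (diag d') \<Longrightarrow> inC (diag (\<lambda>x. d x * d' x))"
  using inC_conv[of "diag d" "diag d'"] by (simp add: diag_conv_diag inC_Bc)

text \<open>The fibre count is available only multiplied by \<open>g\<close> squared, so each linear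
  factor costs two powers of \<open>g\<close>; one further power comes from the empty
  product.\<close>

lemma inC_diag_fcard:
  assumes g: "continuous_map X euclidean g" and U: "inj_on (\<phi> ^^ k) U" "\<And>x. x \<in> T \<Longrightarrow> x \<notin> U \<Longrightarrow> g x = 0"
    and L: "finite L"
  shows "inC (diag (\<lambda>x. g x ^ (2 * card L + 1) * (\<Prod>l\<in>L. of_nat (fcard k x) - of_nat l)))"
  using L
proof (induction L rule: finite_induct)
  case empty
  then show ?case using inC_bis[OF g] by simp
next
  case (insert l L)
  have V: "inC (bis k k (\<lambda>x. 1))" by (intro inC_bis) simp
  have g': "inC (diag g)" by (rule inC_bis[OF g])
  have 1: "inC (diag (\<lambda>x. (g x)\<^sup>2 * of_nat (fcard k x)))"
    using diag_fcard[OF inC_Bc[OF g'] U inC_Bc[OF V]] inC_conv[OF inC_conv[OF g' inC_conv[OF V V]] g'] by simp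
  have "inC (\<lambda>h. diag (\<lambda>x. (g x)\<^sup>2 * of_nat (fcard k x)) h + (- of_nat l) * diag (\<lambda>x. g x * g x) h)"
    by (intro inC_add 1 inC_scale inC_diag_mult g')
  moreover have "(\<lambda>h. diag (\<lambda>x. (g x)\<^sup>2 * of_nat (fcard k x)) h + (- of_nat l) * diag (\<lambda>x. g x * g x) h) =
      diag (\<lambda>x. (g x)\<^sup>2 * (of_nat (fcard k x) - of_nat l))"
    by (rule ext) (auto simp: bis_def algebra_simps power2_eq_square)
  ultimately have "inC (diag (\<lambda>x. (g x)\<^sup>2 * (of_nat (fcard k x) - of_nat l)))" by simp
  from inC_diag_mult[OF this insert.IH]
  have "inC (diag (\<lambda>x. ((g x)\<^sup>2 * (of_nat (fcard k x) - of_nat l)) *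
      (g x ^ (2 * card L + 1) * (\<Prod>l\<in>L. of_nat (fcard k x) - of_nat l))))" .
  moreover have "(\<lambda>x. ((g x)\<^sup>2 * (of_nat (fcard k x) - of_nat l)) * (g x ^ (2 * card L + 1) * (\<Prod>l\<in>L. of_nat (fcard k x) - of_nat l)))
      = (\<lambda>x. g x ^ (2 * card (insert l L) + 1) * (\<Prod>l\<in>insert l L. of_nat (fcard k x) - of_nat l))"
    using insert.hyps by (simp add: fun_eq_iff power_add power2_eq_square mult_ac)
  ultimately show ?case by (simp only:)
qed

text \<open>The exponent comes from interpolating the indicator function of \<open>{l}\<close> on the finitely
  many values of the fibre counting function, each linear factor being supported on \<open>U\<close>.\<close>

lemma inC_diag_Xkl:
  assumes U: "inj_on (\<phi> ^^ k) U"
  obtains d where "d > 0" "\<And>g :: 'a \<Rightarrow> complex. continuous_map X euclidean g \<Longrightarrow> (\<And>x. x \<in> T \<Longrightarrow> x \<notin> U \<Longrightarrow> g x = 0) \<Longrightarrow>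
    inC (diag (\<lambda>x. g x ^ d * of_bool (x \<in> \<X> k l)))"
proof -
  obtain D where D: "\<And>w. card (fibre k w) \<le> D" by (rule fibre_card_bound[of k]) blast
  let ?L = "{..D} - {l}"
  define c where "c = (\<Prod>l'\<in>?L. (of_nat l - of_nat l' :: complex))"
  have c: "c \<noteq> 0" by (simp add: c_def)
  have eq: "(\<Prod>l'\<in>?L. of_nat (fcard k x) - of_nat l') = c * of_bool (x \<in> \<X> k l)" if "x \<in> T" for x
  proof (cases "fcard k x = l")
    case False
    then have "fcard k x \<in> ?L" using D by auto
    then have "(\<Prod>l'\<in>?L. of_nat (fcard k x) - of_nat l' :: complex) = 0" by (intro prod_zero) auto
    then show ?thesis using False by (simp add: Xkl_fibre)
  qed (use that in \<open>simp add: Xkl_fibre c_def\<close>)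
  show thesis
  proof (rule that[of "2 * card ?L + 1"])
    fix g :: "'a \<Rightarrow> complex" assume g: "continuous_map X euclidean g" "\<And>x. x \<in> T \<Longrightarrow> x \<notin> U \<Longrightarrow> g x = 0"
    have "inC (\<lambda>h. inverse c * diag (\<lambda>x. g x ^ (2 * card ?L + 1) * (\<Prod>l'\<in>?L. of_nat (fcard k x) - of_nat l')) h)"
      by (intro inC_scale inC_diag_fcard[OF g(1) U g(2)]) auto
    moreover have "(\<lambda>h. inverse c * diag (\<lambda>x. g x ^ (2 * card ?L + 1) * (\<Prod>l'\<in>?L. of_nat (fcard k x) - of_nat l')) h) =
        diag (\<lambda>x. g x ^ (2 * card ?L + 1) * of_bool (x \<in> \<X> k l))"
    proof (rule ext)
      fix h :: "'a \<times> int \<times> 'a"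
      show "inverse c * diag (\<lambda>x. g x ^ (2 * card ?L + 1) * (\<Prod>l'\<in>?L. of_nat (fcard k x) - of_nat l')) h =
        diag (\<lambda>x. g x ^ (2 * card ?L + 1) * of_bool (x \<in> \<X> k l)) h"
        using c by (cases h) (simp add: bis_def Eab_iff eq)
    qed
    ultimately show "inC (diag (\<lambda>x. g x ^ (2 * card ?L + 1) * of_bool (x \<in> \<X> k l)))" by simp
  qed simp
qed

section \<open>Ideals\<close>

lemma cauchy_Bc: "u \<in> B.cauchy \<Longrightarrow> u n \<in> \<B>"
  using B.cauchy_in[of u n] by simp

lemma cauchy_bnorm: "u \<in> B.cauchy \<Longrightarrow> 0 < e \<Longrightarrow> \<exists>N. \<forall>m\<ge>N. \<forall>n\<ge>N. bnorm (\<lambda>g. u m g - u n g) < e"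
  using B.cauchyD[of u e] by (simp add: adist_bnorm)

text \<open>Elements are determined by their pointwise limits: in the Cauchy estimate for
  \<open>u n - u m\<close> the index \<open>m\<close> tends to infinity, and
  \<open>opbound_limit\<close> leaves a bound on \<open>u n\<close>.\<close>

lemma cls_zero_if_pointwise:
  assumes u: "u \<in> B.cauchy" and lim: "\<And>g. (\<lambda>n. u n g) \<longlonglongrightarrow> 0"
  shows "B.cls u = B.cls (\<lambda>n g. 0)"
proof -
  have "(\<lambda>n. bnorm (u n)) \<longlonglongrightarrow> 0"
  proof (rule LIMSEQ_I)
    fix e :: real assume e: "e > 0"
    obtain N where N: "\<forall>m\<ge>N. \<forall>n\<ge>N. bnorm (\<lambda>g. u m g - u n g) < e / 2"
      using cauchy_bnorm[OF u, of "e / 2"] e by auto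
    have "norm (bnorm (u n) - 0) < e" if n: "n \<ge> N" for n
    proof -
      have "opbound (\<lambda>g. u n g - u m g) (e / 2)" if "m \<ge> N" for m
      proof -
        have "opbound (\<lambda>g. u n g - u m g) (bnorm (\<lambda>g. u n g - u m g))"
          by (intro opbound_bnorm Bc_diff cauchy_Bc u)
        moreover have "bnorm (\<lambda>g. u n g - u m g) \<le> e / 2" using N n that by (simp add: less_imp_le)
        ultimately show ?thesis
          unfolding opbound_def by (meson mult_right_mono order_trans L2_set_nonneg)
      qed
      then have "\<forall>\<^sub>F m in sequentially. opbound (\<lambda>g. u n g - u m g) (e / 2)"
        by (auto simp: eventually_sequentially)
      moreover have "(\<lambda>m. u n g - u m g) \<longlonglongrightarrow> u n g" for g
        using tendsto_diff[OF tendsto_const lim[of g], of "u n g"] by simp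
      ultimately have "opbound (u n) (e / 2)" by (intro opbound_limit[of "\<lambda>m g. u n g - u m g"])
      then have "bnorm (u n) \<le> e / 2" using e by (intro bnorm_le cauchy_Bc u) auto
      then show ?thesis using e bnorm_nonneg[OF cauchy_Bc[OF u], of n] by simp
    qed
    then show "\<exists>N. \<forall>n\<ge>N. norm (bnorm (u n) - 0) < e" by blast
  qed
  then show ?thesis
    using B.cls_eq_iff[OF u const_cauchy[OF Bc_zero]] by (simp add: adist_bnorm)
qed

lemma closed_idealD:
  assumes I: "closed_ideal R I"
  shows ideal_subset: "I \<subseteq> CR"
    and ideal_zero: "B.cls (\<lambda>n g. 0) \<in> I"
    and ideal_add: "\<lbrakk>u \<in> B.cauchy; v \<in> B.cauchy; B.cls u \<in> I; B.cls v \<in> I\<rbrakk> \<Longrightarrow> B.cls (\<lambda>n g. u n g + v n g) \<in> I"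
    and ideal_scale: "\<lbrakk>u \<in> B.cauchy; B.cls u \<in> I\<rbrakk> \<Longrightarrow> B.cls (\<lambda>n g. c * u n g) \<in> I"
    and ideal_mult_left: "\<lbrakk>u \<in> B.cauchy; v \<in> B.cauchy; B.cls u \<in> CR; B.cls v \<in> I\<rbrakk> \<Longrightarrow> B.cls (\<lambda>n. u n \<star> v n) \<in> I"
    and ideal_mult_right: "\<lbrakk>u \<in> B.cauchy; v \<in> B.cauchy; B.cls u \<in> I; B.cls v \<in> CR\<rbrakk> \<Longrightarrow> B.cls (\<lambda>n. u n \<star> v n) \<in> I"
    and ideal_closed: "\<lbrakk>a \<in> CR; \<And>e. e > 0 \<Longrightarrow> \<exists>b\<in>I. adist \<C> a b < e\<rbrakk> \<Longrightarrow> a \<in> I"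
proof -
  note * = I[unfolded closed_ideal_def linear_subspace_def norm_closed_def R_simps]
  show "I \<subseteq> CR" "B.cls (\<lambda>n g. 0) \<in> I" using * by auto
  show "B.cls (\<lambda>n g. u n g + v n g) \<in> I" if "u \<in> B.cauchy" "v \<in> B.cauchy" "B.cls u \<in> I" "B.cls v \<in> I"
  proof -
    have "aadd \<C> (B.cls u) (B.cls v) \<in> I" using * that by blast
    then show ?thesis using that by (simp add: B.completion_add)
  qed
  show "B.cls (\<lambda>n g. c * u n g) \<in> I" if "u \<in> B.cauchy" "B.cls u \<in> I"
  proof -
    have "ascale \<C> c (B.cls u) \<in> I" using * that by blast
    then show ?thesis using that by (simp add: B.completion_scale)
  qed
  show "B.cls (\<lambda>n. u n \<star> v n) \<in> I" if "u \<in> B.cauchy" "v \<in> B.cauchy" "B.cls u \<in> CR" "B.cls v \<in> I"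
  proof -
    have "amult \<C> (B.cls u) (B.cls v) \<in> I" using * that by blast
    then show ?thesis using that by (simp add: B.completion_mult)
  qed
  show "B.cls (\<lambda>n. u n \<star> v n) \<in> I" if "u \<in> B.cauchy" "v \<in> B.cauchy" "B.cls u \<in> I" "B.cls v \<in> CR"
  proof -
    have "amult \<C> (B.cls u) (B.cls v) \<in> I" using * that by blast
    then show ?thesis using that by (simp add: B.completion_mult)
  qed
  show "a \<in> I" if "a \<in> CR" "\<And>e. e > 0 \<Longrightarrow> \<exists>b\<in>I. adist \<C> a b < e"
    using * that by blast
qed

lemma cauchy_conv: "u \<in> B.cauchy \<Longrightarrow> v \<in> B.cauchy \<Longrightarrow> (\<lambda>n. u n \<star> v n) \<in> B.cauchy"
  using B.cauchy_mult[of u v] by simp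

lemma cauchy_plus: "u \<in> B.cauchy \<Longrightarrow> v \<in> B.cauchy \<Longrightarrow> (\<lambda>n g. u n g + v n g) \<in> B.cauchy"
  using B.cauchy_add[of u v] by simp

lemma cauchy_scaled: "u \<in> B.cauchy \<Longrightarrow> (\<lambda>n g. c * u n g) \<in> B.cauchy"
  using B.cauchy_scale[of u c] by simp

text \<open>If \<open>v \<in> I\<close> approximates \<open>e2\<close> and \<open>u \<in> I\<close> approximates \<open>e\<close>, then
  \<open>v' = e2 u + v e - v u\<close> lies in \<open>I\<close> and \<open>e2 - v' = (e2 - v) (e - u)\<close>.\<close>

lemma mem_ideal_if_near:
  assumes I: "closed_ideal R I" and u: "u \<in> B.cauchy" "B.cls u \<in> I"
    and e: "inC e" and e2: "inC e2" and ee: "e2 \<star> e = e2"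
    and q: "0 \<le> q" "q < 1" "\<forall>\<^sub>F n in sequentially. bnorm (\<lambda>g. e g - u n g) \<le> q"
  shows "const_cls e2 \<in> I"
proof -
  note ec = const_cauchy[OF inC_Bc[OF e]] and e2c = const_cauchy[OF inC_Bc[OF e2]]
  have eC: "const_cls e \<in> CR" and e2C: "const_cls e2 \<in> CR" using e e2 by (simp_all add: inC_def)
  have step: "\<exists>v\<in>B.cauchy. B.cls v \<in> I \<and> (\<forall>\<^sub>F n in sequentially. bnorm (\<lambda>g. e2 g - v n g) \<le> bnorm e2 * q ^ k)" for k
  proof (induction k)
    case 0
    show ?case
      by (rule bexI[of _ "\<lambda>n g. 0"]) (simp_all add: ideal_zero[OF I] const_cauchy Bc_zero)
  next
    case (Suc k)
    then obtain v where v: "v \<in> B.cauchy" "B.cls v \<in> I"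
      "\<forall>\<^sub>F n in sequentially. bnorm (\<lambda>g. e2 g - v n g) \<le> bnorm e2 * q ^ k" by blast
    let ?w = "\<lambda>n g. (e2 \<star> u n) g + ((v n \<star> e) g + (-1) * (v n \<star> u n) g)"
    have uC: "B.cls u \<in> CR" using ideal_subset[OF I] u by blast
    have "?w \<in> B.cauchy" by (intro cauchy_plus cauchy_conv cauchy_scaled ec e2c u v)
    moreover have "B.cls ?w \<in> I"
      by (intro ideal_add[OF I] ideal_scale[OF I] ideal_mult_left[OF I] ideal_mult_right[OF I]
        cauchy_plus cauchy_conv cauchy_scaled ec e2c eC e2C uC u v)
    moreover have "\<forall>\<^sub>F n in sequentially. bnorm (\<lambda>g. e2 g - ?w n g) \<le> bnorm e2 * q ^ Suc k"
      using v(3) q(3)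
    proof eventually_elim
      case (elim n)
      note Bcs = inC_Bc[OF e] inC_Bc[OF e2] cauchy_Bc[OF u(1)] cauchy_Bc[OF v(1)]
      have "(\<lambda>g. e2 g - v n g) \<star> (\<lambda>g. e g - u n g) = (\<lambda>g. e2 g - ?w n g)"
        by (simp add: conv_diff_left conv_diff_right Bcs Bc_diff Bc_conv ee algebra_simps)
      then have "bnorm (\<lambda>g. e2 g - ?w n g) \<le> bnorm (\<lambda>g. e2 g - v n g) * bnorm (\<lambda>g. e g - u n g)"
        using bnorm_conv[of "\<lambda>g. e2 g - v n g" "\<lambda>g. e g - u n g"] Bcs by (simp add: Bc_diff)
      also have "\<dots> \<le> (bnorm e2 * q ^ k) * q"
        using elim q Bcs by (intro mult_mono bnorm_nonneg Bc_diff mult_nonneg_nonneg) auto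
      finally show ?case by (simp add: mult_ac)
    qed
    ultimately show ?case by blast
  qed
  show ?thesis
  proof (rule ideal_closed[OF I e2C])
    fix r :: real assume r: "r > 0"
    have "(\<lambda>k. bnorm e2 * q ^ k) \<longlonglongrightarrow> 0"
      using q by (intro tendsto_mult_right_zero LIMSEQ_realpow_zero) auto
    then obtain k where k: "bnorm e2 * q ^ k < r"
      using order_tendstoD(2)[OF _ r] by (metis (no_types, lifting) eventually_happens' sequentially_bot)
    obtain v where v: "v \<in> B.cauchy" "B.cls v \<in> I"
      "\<forall>\<^sub>F n in sequentially. bnorm (\<lambda>g. e2 g - v n g) \<le> bnorm e2 * q ^ k" using step[of k] by blast
    have "adist \<C> (const_cls e2) (B.cls v) \<le> bnorm e2 * q ^ k"
      by (rule tendsto_upperbound[OF B.completion_dist[OF e2c v(1)]]) (use v(3) in \<open>auto simp: adist_bnorm\<close>)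
    then show "\<exists>b\<in>I. adist \<C> (const_cls e2) b < r" using k v(2) by force
  qed
qed

lemma inC_one: "inC (diag (\<lambda>x. 1))"
  by (rule inC_bis) simp

lemma conv_one: "f \<in> \<B> \<Longrightarrow> f \<star> diag (\<lambda>x. 1) = f"
  by (rule fun_eq_kerI) (simp add: ker_conv_diag inC_Bc[OF inC_one])

lemma const_cls_eq_zero: "f \<in> \<B> \<Longrightarrow> const_cls f = B.cls (\<lambda>n g. 0) \<Longrightarrow> f g = 0"
  using B.cls_eq_iff[OF const_cauchy const_cauchy[OF Bc_zero], of f] bnorm_pointwise[of f g]
  by (simp add: adist_bnorm LIMSEQ_const_iff)

lemma one_neq_zero: "const_cls (diag (\<lambda>x. 1)) \<noteq> B.cls (\<lambda>n g. 0)"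
proof
  obtain w where w: "w \<in> T" using nonempty by blast
  assume "const_cls (diag (\<lambda>x. 1)) = B.cls (\<lambda>n g. 0)"
  from const_cls_eq_zero[OF inC_Bc[OF inC_one] this, of "(w, 0, w)"] w show False by (simp add: bis_def Eab_iff)
qed

lemma ideal_eq_CR:
  assumes I: "closed_ideal R I" and one: "const_cls (diag (\<lambda>x. 1)) \<in> I"
  shows "I = CR"
proof
  show "CR \<subseteq> I"
  proof
    fix a assume a: "a \<in> CR"
    then obtain u where u: "u \<in> B.cauchy" "a = B.cls u" using CR_completion B.completion_cases by blast
    have "B.cls (\<lambda>n. u n \<star> diag (\<lambda>x. 1)) \<in> I"
      using a u one by (intro ideal_mult_left[OF I] const_cauchy inC_Bc[OF inC_one]) auto
    then show "a \<in> I" using u by (simp add: conv_one cauchy_Bc)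
  qed
qed (rule ideal_subset[OF I])

section \<open>From simplicity to the covering condition\<close>

abbreviation minimality :: bool where
  "minimality \<equiv> \<forall>U k l. openin X U \<and> U \<inter> \<X> k l \<noteq> {} \<longrightarrow>
      (\<exists>m. (\<Union>j\<in>{0..m}. iter j ` (U \<inter> \<X> k l)) = T)"

definition reach :: "'a set \<Rightarrow> nat \<Rightarrow> 'a set" where
  "reach V M = {x \<in> T. \<exists>i\<le>M. \<exists>j\<le>M. \<exists>v\<in>V. iter i x = iter j v}"

lemma reach_mono: "M \<le> N \<Longrightarrow> reach V M \<subseteq> reach V N"
  unfolding reach_def using order_trans by blast

text \<open>The two equations compose because iterates commute, so an arrow in \<open>slab n\<close>
  adds at most \<open>n\<close> steps on either side.\<close>

lemma reach_slab:
  assumes "(x, k, y) \<in> slab n" "y \<in> reach V M"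
  shows "x \<in> reach V (n + M)"
proof -
  obtain a b where ab: "x \<in> T" "a \<le> n" "b \<le> n" "iter a x = iter b y" using assms(1) by (auto simp: slab_iff)
  obtain i j v where v: "i \<le> M" "j \<le> M" "v \<in> V" "iter i y = iter j v" using assms(2) by (auto simp: reach_def)
  have "iter (i + a) x = iter i (iter b y)" by (simp only: pow_pow[symmetric] ab)
  also have "\<dots> = iter b (iter i y)" by (simp add: pow_pow add.commute)
  also have "\<dots> = iter (b + j) v" by (simp only: pow_pow v)
  finally have eq: "iter (i + a) x = iter (b + j) v" .
  have "i + a \<le> n + M" "b + j \<le> n + M" using ab v by auto
  then show ?thesis unfolding reach_def using eq ab(1) v(3) by blast
qed

text \<open>The bound \<open>M\<close> depends on \<open>f\<close>, because left convolution by a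
  function supported in \<open>slab n\<close> raises it by \<open>n\<close>.\<close>

definition reach_funs :: "'a set \<Rightarrow> ('a \<times> int \<times> 'a \<Rightarrow> complex) set" where
  "reach_funs V = {f \<in> \<B>. \<exists>M. \<forall>x k y. f (x, k, y) \<noteq> 0 \<longrightarrow> x \<in> reach V M}"

lemma reach_funs_cases:
  assumes "f \<in> reach_funs V"
  obtains M where "f \<in> \<B>" "\<And>N x k y. M \<le> N \<Longrightarrow> f (x, k, y) \<noteq> 0 \<Longrightarrow> x \<in> reach V N"
  using assms reach_mono unfolding reach_funs_def by blast

lemma reach_funsI: "f \<in> \<B> \<Longrightarrow> (\<And>x k y. f (x, k, y) \<noteq> 0 \<Longrightarrow> x \<in> reach V M) \<Longrightarrow> f \<in> reach_funs V"
  by (auto simp: reach_funs_def)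

lemma reach_funs_conv_right:
  assumes f: "f \<in> reach_funs V" and h: "h \<in> \<B>"
  shows "f \<star> h \<in> reach_funs V"
proof -
  obtain M where M: "f \<in> \<B>" "\<And>N x k y. M \<le> N \<Longrightarrow> f (x, k, y) \<noteq> 0 \<Longrightarrow> x \<in> reach V N"
    using reach_funs_cases[OF f] by blast
  show ?thesis
  proof (rule reach_funsI[OF Bc_conv[OF M(1) h]])
    fix x k y assume nz: "(f \<star> h) (x, k, y) \<noteq> 0"
    show "x \<in> reach V M"
    proof (rule ccontr)
      assume "x \<notin> reach V M"
      then have "ker f (x, k) q = 0" for q using M(2)[OF order_refl] by (auto simp: ker_def)
      then have "ker (f \<star> h) (x, k) (y, 0) = (\<Sum>q\<in>{}. ker f (x, k) q * ker h q (y, 0))"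
        by (intro ker_conv M h) auto
      then show False using nz by (simp add: fun_ker)
    qed
  qed
qed

lemma reach_funs_conv_left:
  assumes f: "f \<in> reach_funs V" and h: "h \<in> \<B>"
  shows "h \<star> f \<in> reach_funs V"
proof -
  obtain M where M: "f \<in> \<B>" "\<And>N x k y. M \<le> N \<Longrightarrow> f (x, k, y) \<noteq> 0 \<Longrightarrow> x \<in> reach V N"
    using reach_funs_cases[OF f] by blast
  obtain n where n: "\<And>g. g \<notin> slab n \<Longrightarrow> h g = 0" by (rule Bc_cases[OF h]) blast
  show ?thesis
  proof (rule reach_funsI[OF Bc_conv[OF h M(1)]])
    fix x k y assume nz: "(h \<star> f) (x, k, y) \<noteq> 0"
    show "x \<in> reach V (n + M)"
    proof (rule ccontr)
      assume x: "x \<notin> reach V (n + M)"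
      have "ker h (x, k) q * ker f q (y, 0) = 0" for q
      proof (rule ccontr)
        assume "ker h (x, k) q * ker f q (y, 0) \<noteq> 0"
        then have "(x, k - snd q, fst q) \<in> slab n" "fst q \<in> reach V M"
          using n M(2)[OF order_refl] by (auto simp: ker_def)
        from reach_slab[OF this] x show False by simp
      qed
      then have "ker (h \<star> f) (x, k) (y, 0) = (\<Sum>q\<in>{}. ker h (x, k) q * ker f q (y, 0))"
        by (intro ker_conv M h) auto
      then show False using nz by (simp add: fun_ker)
    qed
  qed
qed

text \<open>Backward steps are absorbed by surjectivity: a point \<open>z\<close> is written as
  \<open>iter M x\<close>, and the equation for \<open>x\<close> reaches \<open>z\<close> from
  \<open>V\<close> by forward steps, at most \<open>2 * M\<close> in number.\<close>

lemma reach_UN: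
  assumes "T \<subseteq> reach V M" "V \<subseteq> T"
  shows "(\<Union>j\<in>{0..2 * M}. iter j ` V) = T"
proof
  show "(\<Union>j\<in>{0..2 * M}. iter j ` V) \<subseteq> T" using assms(2) pow_in by blast
  show "T \<subseteq> (\<Union>j\<in>{0..2 * M}. iter j ` V)"
  proof
    fix z assume "z \<in> T"
    then obtain x where x: "x \<in> T" "iter M x = z" using surj_pow by blast
    then obtain i j v where v: "i \<le> M" "j \<le> M" "v \<in> V" "iter i x = iter j v"
      using assms(1) by (auto simp: reach_def)
    have "z = iter (M - i) (iter i x)" using v(1) x by (simp add: pow_pow)
    also have "\<dots> = iter (M - i + j) v" by (simp add: v(4) pow_pow)
    finally have "z \<in> iter (M - i + j) ` V" using v(3) by blast
    moreover have "M - i + j \<in> {0..2 * M}" using v by simp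
    ultimately show "z \<in> (\<Union>j\<in>{0..2 * M}. iter j ` V)" by blast
  qed
qed

text \<open>Products are controlled against limits of arbitrary functions in \<open>\<B>\<close>.
  The intersection with \<open>CR\<close> is taken because a limit of reach functions need not lie
  in the reduced algebra.\<close>

lemma closed_ideal_reach: "closed_ideal R (CR \<inter> B.limit_classes (reach_funs V))"
proof -
  let ?A = "\<C>" and ?J = "B.limit_classes (reach_funs V)"
  have sub: "reach_funs V \<subseteq> \<B>" by (auto simp: reach_funs_def)
  have J: "linear_subspace ?A ?J"
  proof (rule B.linear_subspace_limit_classes)
    show "azero \<A> \<in> reach_funs V" using Bc_zero by (auto simp: reach_funs_def)
    fix f h assume "f \<in> reach_funs V" "h \<in> reach_funs V"
    then obtain M N where f: "f \<in> \<B>" "\<And>N x k y. M \<le> N \<Longrightarrow> f (x, k, y) \<noteq> 0 \<Longrightarrow> x \<in> reach V N"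
      and h: "h \<in> \<B>" "\<And>M x k y. N \<le> M \<Longrightarrow> h (x, k, y) \<noteq> 0 \<Longrightarrow> x \<in> reach V M"
      by (metis reach_funs_cases)
    have "(\<lambda>g. f g + h g) \<in> reach_funs V"
    proof (rule reach_funsI[OF Bc_add[OF f(1) h(1)], of _ "max M N"])
      fix x k y assume "f (x, k, y) + h (x, k, y) \<noteq> 0"
      then have "f (x, k, y) \<noteq> 0 \<or> h (x, k, y) \<noteq> 0" by auto
      then show "x \<in> reach V (max M N)" using f(2)[of "max M N"] h(2)[of "max M N"] by auto
    qed
    then show "aadd \<A> f h \<in> reach_funs V" by simp
  next
    fix c f assume "f \<in> reach_funs V"
    then obtain M where M: "f \<in> \<B>" "\<And>N x k y. M \<le> N \<Longrightarrow> f (x, k, y) \<noteq> 0 \<Longrightarrow> x \<in> reach V N"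
      using reach_funs_cases by blast
    have "(\<lambda>g. c * f g) \<in> reach_funs V"
      by (rule reach_funsI[OF Bc_scale[OF M(1)]]) (use M(2)[OF order_refl] in auto)
    then show "ascale \<A> c f \<in> reach_funs V" by simp
  qed
  have mult: "amult ?A a x \<in> ?J \<and> amult ?A x a \<in> ?J" if "a \<in> CR" "x \<in> ?J" for a x
  proof -
    have a: "a \<in> B.limit_classes \<B>" using that CR_completion B.elements_completion by auto
    show ?thesis
      using B.limit_classes_mult[of "\<B>" "reach_funs V" "reach_funs V", OF _ a that(2)]
        B.limit_classes_mult[of "reach_funs V" "\<B>" "reach_funs V", OF _ that(2) a]
      by (simp add: reach_funs_conv_left reach_funs_conv_right)
  qed
  have J_closed: "norm_closed ?A ?J" by (rule B.norm_closed_limit_classes) (simp add: sub)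
  show ?thesis
    unfolding closed_ideal_def
  proof (intro conjI)
    show "linear_subspace R (CR \<inter> ?J)"
      using J by (auto simp: linear_subspace_def CR_zero CR_add CR_scale B.completion_zero)
    show "\<forall>a\<in>CR. \<forall>x\<in>CR \<inter> ?J. amult R a x \<in> CR \<inter> ?J \<and> amult R x a \<in> CR \<inter> ?J"
      using mult by (simp add: CR_mult)
    show "norm_closed R (CR \<inter> ?J)"
      unfolding norm_closed_def R_simps
    proof (intro ballI impI IntI)
      fix a assume a: "a \<in> CR" "\<forall>e>0. \<exists>b\<in>CR \<inter> ?J. adist ?A a b < e"
      then have "\<forall>e>0. \<exists>b\<in>?J. adist ?A a b < e" by blast
      then show "a \<in> ?J" using J_closed a(1) CR_completion unfolding norm_closed_def by blast
    qed
  qed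
qed

lemma minimality_if_simple:
  assumes simple: "simple_algebra R"
  shows minimality
proof (intro allI impI, elim conjE)
  fix U k l assume U: "openin X U" "U \<inter> \<X> k l \<noteq> {}"
  let ?V = "U \<inter> \<X> k l" and ?J = "B.limit_classes (reach_funs (U \<inter> \<X> k l))"
  obtain y where y: "y \<in> U" "y \<in> \<X> k l" using U by blast
  then have yT: "y \<in> T" using Xkl_subset by blast
  obtain U1 where U1: "openin X U1" "y \<in> U1" "inj_on (\<phi> ^^ k) U1" by (rule linj_pow[OF yT])
  obtain g W where g: "continuous_map X euclidean (\<lambda>x. complex_of_real (g x))"
    "\<And>x. 0 \<le> g x" "\<And>x. g x \<le> (1 :: real)" "openin X W" "y \<in> W" "W \<subseteq> U \<inter> U1" "\<And>x. x \<in> W \<Longrightarrow> g x = 1"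
    "\<And>x. x \<in> T \<Longrightarrow> x \<notin> U \<inter> U1 \<Longrightarrow> g x = 0"
    using bump[of "U \<inter> U1" y] U U1 y by blast
  have inj: "inj_on (\<phi> ^^ k) (U \<inter> U1)" using U1(3) by (rule inj_on_subset) simp
  obtain d where d: "d > 0" "inC (diag (\<lambda>x. complex_of_real (g x) ^ d * of_bool (x \<in> \<X> k l)))"
    using inC_diag_Xkl[OF inj, of l] g(1,8) by (metis of_real_0)
  let ?h = "diag (\<lambda>x. complex_of_real (g x) ^ d * of_bool (x \<in> \<X> k l))"
  have "?h \<in> reach_funs ?V"
  proof (rule reach_funsI[OF inC_Bc[OF d(2)], of _ 0])
    fix x j z assume "?h (x, j, z) \<noteq> 0"
    then have x: "x = z" "z \<in> T" "g z \<noteq> 0" "z \<in> \<X> k l" using d(1) by (auto simp: bis_def Eab_iff split: if_splits)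
    then have "z \<in> ?V" using g(8) by blast
    then show "x \<in> reach ?V 0" using x by (auto simp: reach_def)
  qed
  then have hJ: "const_cls ?h \<in> CR \<inter> ?J"
    using d(2) by (auto simp: inC_def intro!: B.limit_classesI const_cauchy)
  have "const_cls ?h \<noteq> B.cls (\<lambda>n g. 0)"
  proof
    assume "const_cls ?h = B.cls (\<lambda>n g. 0)"
    from const_cls_eq_zero[OF inC_Bc[OF d(2)] this, of "(y, 0, y)"] show False
      using y yT g(5,7) by (simp add: bis_def Eab_iff)
  qed
  with hJ have "CR \<inter> ?J \<noteq> {azero R}" by auto
  then have "CR \<inter> ?J = CR" using simple closed_ideal_reach unfolding simple_algebra_def by blast
  then have "const_cls (diag (\<lambda>x. 1)) \<in> ?J" using inC_one by (auto simp: inC_def)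
  then obtain u where u: "u \<in> B.cauchy" "\<And>n. u n \<in> reach_funs ?V" "const_cls (diag (\<lambda>x. 1)) = B.cls u"
    by (rule B.limit_classes_cases) blast
  have "(\<lambda>n. bnorm (\<lambda>g. diag (\<lambda>x. 1) g - u n g)) \<longlonglongrightarrow> 0"
    using u B.cls_eq_iff[OF const_cauchy[OF inC_Bc[OF inC_one]] u(1)] by (simp add: adist_bnorm)
  then have "\<forall>\<^sub>F n in sequentially. bnorm (\<lambda>g. diag (\<lambda>x. 1) g - u n g) < 1"
    by (rule order_tendstoD) simp
  then obtain n where n: "bnorm (\<lambda>g. diag (\<lambda>x. 1) g - u n g) < 1"
    by (metis (no_types, lifting) eventually_happens' sequentially_bot)
  obtain M where M: "\<And>N x k y. M \<le> N \<Longrightarrow> u n (x, k, y) \<noteq> 0 \<Longrightarrow> x \<in> reach ?V N"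
    by (rule reach_funs_cases[OF u(2)[of n]]) blast
  have "T \<subseteq> reach ?V M"
  \<comment> \<open>A function at norm distance less than 1 from the unit vanishes at no point of
    the unit space, so each unit is the range of an arrow in its support.\<close>
  proof
    fix x assume x: "x \<in> T"
    have "cmod (diag (\<lambda>x. 1) (x, 0, x) - u n (x, 0, x)) < 1"
      using bnorm_pointwise[OF Bc_diff[OF inC_Bc[OF inC_one] cauchy_Bc[OF u(1), of n]], of "(x, 0, x)"] n by simp
    then have "u n (x, 0, x) \<noteq> 0" using x by (auto simp: bis_def Eab_iff)
    then show "x \<in> reach ?V M" by (rule M[OF order_refl])
  qed
  then show "\<exists>m. (\<Union>j\<in>{0..m}. iter j ` ?V) = T"
    using reach_UN[of ?V M] Xkl_subset by blast
qed

section \<open>Nonzero ideals contain the unit\<close>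

lemma inj_on_pow_le: "inj_on (\<phi> ^^ m) U \<Longrightarrow> j \<le> m \<Longrightarrow> inj_on (\<phi> ^^ j) U"
  using inj_on_imageI2[of "\<phi> ^^ (m - j)" "\<phi> ^^ j" U] by (simp flip: funpow_add)

text \<open>Every point is of the form \<open>iter a x'\<close>, so the equation says that
  \<open>iter (b - a)\<close> is the identity; one step less gives a left inverse of
  \<open>\<phi>\<close>.\<close>

lemma inj_if_pow_eq:
  assumes ab: "a < b" and eq: "\<And>z. z \<in> T \<Longrightarrow> iter a z = iter b z"
  shows "inj_on \<phi> T"
proof -
  define c where "c = b - a - 1"
  have "iter c (\<phi> x) = x" if x: "x \<in> T" for x
  proof -
    obtain x' where x': "x' \<in> T" "iter a x' = x" using surj_pow[OF x] by blast
    have "iter c (\<phi> x) = iter (Suc c) x" by (simp add: funpow_swap1)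
    also have "\<dots> = iter (Suc c + a) x'" by (simp only: x'(2)[symmetric] pow_pow)
    also have "\<dots> = x" using ab eq[OF x'(1)] x'(2) by (simp add: c_def)
    finally show ?thesis .
  qed
  then show ?thesis by (rule inj_on_inverseI)
qed

text \<open>The closed sets where \<open>iter a x = iter b x\<close> are removed one pair at a time.
  If one of them contained the rest of the set in X_{k,l}, the equation would spread along forward
  orbits, which cover the space by minimality, and \<open>\<phi>\<close> would be injective.\<close>

lemma avoid_preperiodic:
  assumes min: minimality and ninj: "\<not> inj_on \<phi> T" and Z: "finite Z" "\<And>a b. (a, b) \<in> Z \<Longrightarrow> a \<noteq> b"
    and U: "openin X U" "U \<inter> \<X> k l \<noteq> {}"
  shows "\<exists>U'. openin X U' \<and> U' \<subseteq> U \<and> U' \<inter> \<X> k l \<noteq> {} \<and>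
    (\<forall>(a, b)\<in>Z. \<forall>x\<in>U'. iter a x \<noteq> iter b x)"
  using Z
proof (induction Z rule: finite_induct)
  case empty
  then show ?case using U by blast
next
  case (insert ab Z)
  obtain a b where ab: "ab = (a, b)" "a \<noteq> b" using insert.prems by (cases ab) auto
  obtain U' where U': "openin X U'" "U' \<subseteq> U" "U' \<inter> \<X> k l \<noteq> {}"
    "\<forall>(a, b)\<in>Z. \<forall>x\<in>U'. iter a x \<noteq> iter b x" using insert by blast
  let ?Q = "{x \<in> T. iter a x = iter b x}"
  have Q: "closedin X ?Q" by (intro closedin_continuous_maps_eq[OF Hausdorff] continuous_pow)
  have "\<not> U' \<inter> \<X> k l \<subseteq> ?Q"
  proof
    assume sub: "U' \<inter> \<X> k l \<subseteq> ?Q"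
    obtain m where m: "(\<Union>j\<in>{0..m}. iter j ` (U' \<inter> \<X> k l)) = T" using min U'(1,3) by blast
    have eq: "iter a z = iter b z" if "z \<in> T" for z
    proof -
      have "z \<in> (\<Union>j\<in>{0..m}. iter j ` (U' \<inter> \<X> k l))" using that by (simp only: m)
      then obtain j x where x: "x \<in> U' \<inter> \<X> k l" "z = iter j x" by (elim UN_E imageE)
      then have "iter a x = iter b x" using sub by blast
      have "iter a z = iter j (iter a x)" unfolding x(2) by (simp add: pow_pow add.commute)
      also have "\<dots> = iter b z" unfolding x(2) \<open>iter a x = iter b x\<close> by (simp add: pow_pow add.commute)
      finally show ?thesis .
    qed
    have "inj_on \<phi> T"
    proof (cases "a < b")
      case True
      then show ?thesis using eq by (rule inj_if_pow_eq)
    next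
      case False
      then have "b < a" using ab by simp
      then show ?thesis using eq[symmetric] by (rule inj_if_pow_eq)
    qed
    then show False using ninj by simp
  qed
  then have ne: "(U' - ?Q) \<inter> \<X> k l \<noteq> {}" by blast
  have op: "openin X (U' - ?Q)" by (rule openin_diff[OF U'(1) Q])
  have "\<forall>x\<in>U' - ?Q. iter a x \<noteq> iter b x" using openin_subset[OF U'(1)] by blast
  moreover have "\<forall>(a, b)\<in>Z. \<forall>x\<in>U' - ?Q. iter a x \<noteq> iter b x"
  proof (rule ballI)
    fix ij assume "ij \<in> Z"
    with U'(4) have "case ij of (a, b) \<Rightarrow> \<forall>x\<in>U'. iter a x \<noteq> iter b x" by (rule bspec)
    then show "case ij of (a, b) \<Rightarrow> \<forall>x\<in>U' - ?Q. iter a x \<noteq> iter b x"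
      unfolding case_prod_unfold by blast
  qed
  ultimately have "\<forall>(a, b)\<in>insert ab Z. \<forall>x\<in>U' - ?Q. iter a x \<noteq> iter b x"
    unfolding ab(1) by (simp only: ball_simps split)
  then show ?case using ne op U'(2) by blast
qed

text \<open>Inequality at one point is strengthened to inequality for all pairs of points near it,
  which is what controls matrix entries between different indices.\<close>

lemma separate_pow:
  assumes x: "x \<in> T" and Z: "finite Z" "\<And>a b. (a, b) \<in> Z \<Longrightarrow> iter a x \<noteq> iter b x"
  shows "\<exists>U. openin X U \<and> x \<in> U \<and> (\<forall>(a, b)\<in>Z. \<forall>y\<in>U. \<forall>z\<in>U. iter a y \<noteq> iter b z)"
  using Z
proof (induction Z rule: finite_induct)
  case empty
  then show ?case using x by blast
next
  case (insert ab Z)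
  obtain a b where ab: "ab = (a, b)" "iter a x \<noteq> iter b x" using insert.prems by (cases ab) auto
  obtain U where U: "openin X U" "x \<in> U" "\<forall>(a, b)\<in>Z. \<forall>y\<in>U. \<forall>z\<in>U. iter a y \<noteq> iter b z"
    using insert by blast
  obtain V V' where V: "openin X V" "openin X V'" "iter a x \<in> V" "iter b x \<in> V'" "V \<inter> V' = {}"
    using separate_points[OF pow_in[OF x] pow_in[OF x] ab(2)] .
  let ?U = "U \<inter> ({y \<in> T. iter a y \<in> V} \<inter> {y \<in> T. iter b y \<in> V'})"
  have "openin X ?U"
    by (intro openin_Int U openin_continuous_map_preimage[OF continuous_pow] V)
  moreover have "x \<in> ?U" using x U V by simp
  moreover have "\<forall>(a, b)\<in>insert ab Z. \<forall>y\<in>?U. \<forall>z\<in>?U. iter a y \<noteq> iter b z"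
  proof (rule ballI)
    fix ij assume ij: "ij \<in> insert ab Z"
    show "case ij of (a, b) \<Rightarrow> \<forall>y\<in>?U. \<forall>z\<in>?U. iter a y \<noteq> iter b z"
    proof (cases "ij = ab")
      case True
      have "iter a y \<noteq> iter b z" if "y \<in> ?U" "z \<in> ?U" for y z
      proof
        assume "iter a y = iter b z"
        moreover have "iter a y \<in> V" "iter b z \<in> V'" using that by simp_all
        ultimately have "iter a y \<in> V \<inter> V'" by simp
        then show False by (simp only: V(5) empty_iff)
      qed
      then show ?thesis by (simp only: True ab(1) split) blast
    next
      case False
      with ij have "ij \<in> Z" by simp
      with U(3) have "case ij of (a, b) \<Rightarrow> \<forall>y\<in>U. \<forall>z\<in>U. iter a y \<noteq> iter b z" by (rule bspec)
      then show ?thesis unfolding case_prod_unfold by blast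
    qed
  qed
  ultimately show ?case by blast
qed

text \<open>The diagonal entry is the sum of the squared absolute values along a row, so a single
  nonzero value of \<open>f\<close> already bounds it from below.\<close>

lemma conv_star_diag_ge:
  assumes f: "f \<in> \<B>"
  shows "(cmod (f (x, k, y)))\<^sup>2 \<le> cmod ((f \<star> adj_fun f) (x, 0, x))"
proof -
  obtain n where n: "\<And>g. g \<notin> slab n \<Longrightarrow> f g = 0" by (rule Bc_cases[OF f]) blast
  let ?p = "(x, 0 :: int)" and ?r = "(y, - k)"
  have "(f \<star> adj_fun f) (x, 0, x) = ker (f \<star> adj_fun f) ?p ?p" by (simp add: ker_def)
  also have "\<dots> = (\<Sum>r\<in>adj n ?p. ker f ?p r * ker (adj_fun f) r ?p)"
    by (rule conv_sum_adj[OF f Bc_star[OF f]]) (rule n)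
  also have "\<dots> = complex_of_real (\<Sum>r\<in>adj n ?p. (cmod (ker f ?p r))\<^sup>2)"
    unfolding of_real_sum by (intro sum.cong refl) (simp only: ker_star[OF f] complex_norm_square)
  finally have eq: "cmod ((f \<star> adj_fun f) (x, 0, x)) = (\<Sum>r\<in>adj n ?p. (cmod (ker f ?p r))\<^sup>2)"
    by (simp only: norm_of_real) (simp add: sum_nonneg)
  have kf: "ker f ?p ?r = f (x, k, y)" by (simp add: ker_def)
  show ?thesis
  proof (cases "?r \<in> adj n ?p")
    case True
    have "(cmod (ker f ?p ?r))\<^sup>2 \<le> (\<Sum>r\<in>adj n ?p. (cmod (ker f ?p r))\<^sup>2)"
      by (rule member_le_sum[OF True]) (auto simp: finite_adj)
    then show ?thesis by (simp only: eq kf)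
  next
    case False
    then have "f (x, k, y) = 0" using n by (simp add: adj_def)
    then show ?thesis by simp
  qed
qed

text \<open>Values at an arrow converge because the norm dominates them, and some limit value is
  nonzero by \<open>cls_zero_if_pointwise\<close>. The result is one lower bound for all late
  approximants.\<close>

lemma tame_nonzero:
  assumes a: "a \<in> CR" "a \<noteq> B.cls (\<lambda>n g. 0)"
  obtains u x k y r where "u \<in> B.cauchy" "\<And>n. u n \<in> tame" "a = B.cls u" "r > 0" "x \<in> T"
    "\<forall>\<^sub>F n in sequentially. r < (cmod (u n (x, k, y)))\<^sup>2"
proof -
  obtain u where u: "u \<in> B.cauchy" "\<And>n. u n \<in> tame" "a = B.cls u"
    using CR_tame a(1) by (blast elim: B.limit_classes_cases)
  obtain g where g: "\<not> (\<lambda>n. u n g) \<longlonglongrightarrow> 0" using cls_zero_if_pointwise[OF u(1)] a(2) u(3) by blast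
  have "Cauchy (\<lambda>n. u n g)"
  proof (rule metric_CauchyI)
    fix e :: real assume "e > 0"
    then obtain N where N: "\<forall>m\<ge>N. \<forall>n\<ge>N. bnorm (\<lambda>g. u m g - u n g) < e" using cauchy_bnorm[OF u(1)] by blast
    have "dist (u m g) (u n g) < e" if "m \<ge> N" "n \<ge> N" for m n
      using bnorm_pointwise[OF Bc_diff[OF cauchy_Bc[OF u(1), of m] cauchy_Bc[OF u(1), of n]], of g] N that
      by (fastforce simp: dist_norm)
    then show "\<exists>N. \<forall>m\<ge>N. \<forall>n\<ge>N. dist (u m g) (u n g) < e" by blast
  qed
  then obtain L where L: "(\<lambda>n. u n g) \<longlonglongrightarrow> L" using Cauchy_convergent convergent_def by blast
  then have "L \<noteq> 0" using g by blast
  define r where "r = (cmod L)\<^sup>2 / 2"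
  have r: "r > 0" "r < (cmod L)\<^sup>2" using \<open>L \<noteq> 0\<close> by (simp_all add: r_def)
  have ev: "\<forall>\<^sub>F n in sequentially. r < (cmod (u n g))\<^sup>2"
    by (rule order_tendstoD(1)[OF _ r(2)]) (intro tendsto_intros L)
  obtain x k y where xky: "g = (x, k, y)" by (cases g)
  have "x \<in> T"
  proof (rule ccontr)
    assume "x \<notin> T"
    then have "u n g = 0" for n using Bc_zero_off[OF cauchy_Bc[OF u(1), of n], of g] by (auto simp: xky Gamma_set_iff)
    then show False using g by simp
  qed
  then show thesis using that[OF u r(1) _ ev[unfolded xky]] by blast
qed

text \<open>A nonzero entry between indices over \<open>U\<close> gives an equation of
  \<open>i + N\<close> and \<open>j + N\<close> iterations. Separation excludes distinct
  \<open>i\<close> and \<open>j\<close>, and for \<open>i = j\<close> injectivity forces the two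
  indices to agree.\<close>

lemma compression_diag:
  assumes b: "b \<in> \<B>" "\<And>g. g \<notin> slab n \<Longrightarrow> b g = 0" and V: "bis 0 N G \<in> \<B>" and E: "diag d \<in> \<B>"
    and real: "\<And>x. cnj (G x) = G x" and GU: "\<And>x. x \<in> T \<Longrightarrow> x \<notin> U \<Longrightarrow> G x = 0"
    and inj: "inj_on (\<phi> ^^ (n + N)) U"
    and sep: "\<And>i j x y. i \<le> n \<Longrightarrow> j \<le> n \<Longrightarrow> i \<noteq> j \<Longrightarrow> x \<in> U \<Longrightarrow> y \<in> U \<Longrightarrow> iter (i + N) x \<noteq> iter (j + N) y"
  shows "adj_fun (bis 0 N G) \<star> b \<star> bis 0 N G \<star> diag d =
    diag (\<lambda>x. (G x)\<^sup>2 * d x * b (iter N x, 0, iter N x))" (is "?l = ?r")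
proof (rule fun_eq_kerI)
  fix p q :: "'a \<times> int"
  have l: "ker ?l p q = (if fst p \<in> T \<and> fst q \<in> T then G (fst p) * ker b (shift N p) (shift N q) * G (fst q) * d (fst q) else 0)"
    by (simp add: ker_conv_diag ker_conv_shift ker_adj_shift_conv Bc_conv Bc_star b V E real)
  show "ker ?l p q = ker ?r p q"
  proof (cases "p = q")
    case True
    then show ?thesis unfolding l ker_diag by (simp add: ker_def power2_eq_square)
  next
    case False
    have "G (fst p) * ker b (shift N p) (shift N q) * G (fst q) = 0" if T: "fst p \<in> T" "fst q \<in> T"
    proof (rule ccontr)
      assume nz: "G (fst p) * ker b (shift N p) (shift N q) * G (fst q) \<noteq> 0"
      then have U: "fst p \<in> U" "fst q \<in> U" using GU T by auto
      have "(iter N (fst p), snd p - snd q, iter N (fst q)) \<in> slab n" using nz b(2) by (auto simp: ker_def)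
      then obtain i j where ij: "i \<le> n" "j \<le> n" "snd p - snd q = int i - int j"
        "iter (i + N) (fst p) = iter (j + N) (fst q)"
        by (auto simp: slab_iff pow_pow)
      then have "i = j" using sep[OF ij(1,2) _ U] by blast
      moreover have "inj_on (\<phi> ^^ (i + N)) U" using inj by (rule inj_on_pow_le) (use ij in simp)
      ultimately have "fst p = fst q" "snd p = snd q" using ij U by (auto dest: inj_onD)
      then show False using False by (simp add: prod_eq_iff)
    qed
    then show ?thesis unfolding l ker_diag using False by simp
  qed
qed

text \<open>The function is real and nonnegative so that nothing cancels when it is later summed
  over fibres.\<close>

lemma ideal_contains_local_element:
  assumes min: minimality and ninj: "\<not> inj_on \<phi> T" and I: "closed_ideal R I"
    and a: "a \<in> I" "a \<noteq> B.cls (\<lambda>n g. 0)"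
  obtains W k l and h :: "'a \<Rightarrow> real" where "openin X W" "W \<inter> \<X> k l \<noteq> {}"
    "diag (\<lambda>x. complex_of_real (h x)) \<in> \<B>" "const_cls (diag (\<lambda>x. complex_of_real (h x))) \<in> I"
    "\<And>x. 0 \<le> h x" "\<And>x. x \<in> W \<inter> \<X> k l \<Longrightarrow> h x = 1"
proof -
  have aC: "a \<in> CR" using a ideal_subset[OF I] by blast
  obtain u x0 k0 z0 r where u: "u \<in> B.cauchy" "\<And>n. u n \<in> tame" "a = B.cls u" "r > 0" "x0 \<in> T"
    "\<forall>\<^sub>F n in sequentially. r < (cmod (u n (x0, k0, z0)))\<^sup>2"
    by (rule tame_nonzero[OF aC a(2)]) blast
  define v where "v n = u n \<star> adj_fun (u n)" for n
  have us: "(\<lambda>n. adj_fun (u n)) \<in> B.cauchy" by (rule B.cauchy_star[OF u(1)])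
  have v: "v \<in> B.cauchy" unfolding v_def by (rule cauchy_conv[OF u(1) us])
  have "B.cls (\<lambda>n. adj_fun (u n)) \<in> CR"
    using CR_star[OF aC] unfolding u(3) B.completion_star[OF u(1)] .
  then have vI: "B.cls v \<in> I"
    unfolding v_def using a(1) u(3) by (intro ideal_mult_right[OF I u(1) us]) auto
  \<comment> \<open>The value \<open>c\<close> exceeds \<open>r\<close> in modulus. An error
    \<open>r / 3\<close> here and another \<open>r / 3\<close> for the variation of \<open>b\<close>
    near \<open>y0\<close> become at most 1/3 each after division by \<open>c\<close>.\<close>
  obtain N1 where N1: "\<forall>m\<ge>N1. \<forall>n\<ge>N1. bnorm (\<lambda>g. v m g - v n g) < r / 3"
    using cauchy_bnorm[OF v, of "r / 3"] u(4) by auto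
  obtain N2 where N2: "\<And>n. n \<ge> N2 \<Longrightarrow> r < (cmod (u n (x0, k0, z0)))\<^sup>2"
    using u(6) by (auto simp: eventually_sequentially)
  define n0 where "n0 = max N1 N2"
  define b where "b = v n0"
  define c where "c = b (x0, 0, x0)"
  have c: "r < cmod c"
    unfolding c_def b_def v_def
    by (rule less_le_trans[OF N2 conv_star_diag_ge[OF cauchy_Bc[OF u(1)]]]) (simp add: n0_def)
  have "b \<in> tame" unfolding b_def v_def by (intro tame_conv tame_star u)
  then obtain N where b: "b \<in> \<B>" "tame_at N b" by (rule tame_cases)
  let ?b = "\<lambda>x. b (iter N x, 0, iter N x)"
  obtain n where n: "\<And>g. g \<notin> slab n \<Longrightarrow> b g = 0" by (rule Bc_cases[OF b(1)]) blast
  \<comment> \<open>The unit \<open>x0\<close> is pulled back along \<open>iter N\<close>, since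
    \<open>b\<close> is known to be continuous only after this pull-back and inside a set X_{2N,l};
    \<open>l\<close> is then chosen so that \<open>y0\<close> lies in it.\<close>
  obtain y0 where y0: "y0 \<in> T" "iter N y0 = x0" using surj_pow[OF u(5)] by blast
  define l where "l = fcard (2 * N) y0"
  let ?S = "\<X> (2 * N) l"
  have y0S: "y0 \<in> ?S" using y0 by (simp add: Xkl_fibre l_def)
  obtain U where U: "openin X U" "y0 \<in> U"
    "\<And>y. y \<in> U \<inter> ?S \<Longrightarrow> cmod (?b y - b (iter N y0, 0, iter N y0)) < r / 3"
    using tame_near[OF b(2) y0S, of "r / 3"] u(4) by auto
  \<comment> \<open>The exponents are shifted by \<open>N\<close> because the entries of
    \<open>b\<close> are taken at the images \<open>iter N x\<close> of points of the small
    set.\<close>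
  define Z where "Z = (\<lambda>(i, j). (i + N, j + N)) ` {(i, j). i \<le> n \<and> j \<le> n \<and> i \<noteq> j}"
  have "finite {(i, j). i \<le> n \<and> j \<le> n \<and> i \<noteq> j}" by (rule finite_subset[of _ "{..n} \<times> {..n}"]) auto
  then have Z: "finite Z" "\<And>i j. (i, j) \<in> Z \<Longrightarrow> i \<noteq> j" by (auto simp: Z_def)
  have "U \<inter> ?S \<noteq> {}" using U(2) y0S by blast
  from avoid_preperiodic[OF min ninj Z U(1) this]
  obtain U1 where U1: "openin X U1" "U1 \<subseteq> U" "U1 \<inter> ?S \<noteq> {}"
    "\<forall>(i, j)\<in>Z. \<forall>x\<in>U1. iter i x \<noteq> iter j x" by blast
  obtain y1 where y1: "y1 \<in> U1" "y1 \<in> ?S" using U1(3) by blast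
  have y1T: "y1 \<in> T" using y1(2) Xkl_subset by blast
  obtain U2 where U2: "openin X U2" "y1 \<in> U2" "\<forall>(i, j)\<in>Z. \<forall>y\<in>U2. \<forall>z\<in>U2. iter i y \<noteq> iter j z"
    using separate_pow[OF y1T Z(1)] U1(4) y1(1) by blast
  \<comment> \<open>The exponent \<open>n + 2 * N\<close> covers \<open>n + N\<close> for the
    compression and \<open>2 * N\<close> for the indicator of X_{2N,l}.\<close>
  obtain U3 where U3: "openin X U3" "y1 \<in> U3" "inj_on (\<phi> ^^ (n + 2 * N)) U3" by (rule linj_pow[OF y1T])
  define V where "V = U1 \<inter> (U2 \<inter> U3)"
  have V: "openin X V" "y1 \<in> V" unfolding V_def using U1 U2 U3 y1 by auto
  have injV: "inj_on (\<phi> ^^ j) V" if "j \<le> n + 2 * N" for j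
    by (rule inj_on_pow_le[OF inj_on_subset[OF U3(3)] that]) (auto simp: V_def)
  have sepV: "iter (i + N) x \<noteq> iter (j + N) y" if "i \<le> n" "j \<le> n" "i \<noteq> j" "x \<in> V" "y \<in> V" for i j x y
  proof -
    have "(i + N, j + N) \<in> Z" unfolding Z_def using that(1-3) by (intro image_eqI[of _ _ "(i, j)"]) auto
    then show ?thesis using U2(3) that(4,5) by (auto simp: V_def)
  qed
  obtain g W where g: "continuous_map X euclidean (\<lambda>x. complex_of_real (g x))"
    "\<And>x. 0 \<le> g x" "\<And>x. g x \<le> (1 :: real)" "openin X W" "y1 \<in> W" "W \<subseteq> V" "\<And>x. x \<in> W \<Longrightarrow> g x = 1"
    "\<And>x. x \<in> T \<Longrightarrow> x \<notin> V \<Longrightarrow> g x = 0"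
    using bump[OF V] by blast
  \<comment> \<open>The second bump is supported where the first equals 1. Therefore
    \<open>E2\<close> is absorbed by the local unit \<open>?e\<close>, as the Neumann series
    argument requires.\<close>
  obtain g2 W2 where g2: "continuous_map X euclidean (\<lambda>x. complex_of_real (g2 x))"
    "\<And>x. 0 \<le> g2 x" "\<And>x. g2 x \<le> (1 :: real)" "openin X W2" "y1 \<in> W2" "W2 \<subseteq> W" "\<And>x. x \<in> W2 \<Longrightarrow> g2 x = 1"
    "\<And>x. x \<in> T \<Longrightarrow> x \<notin> W \<Longrightarrow> g2 x = 0"
    using bump[OF g(4,5)] by blast
  have inj2N: "inj_on (\<phi> ^^ (2 * N)) V" by (rule injV) simp
  obtain d where d: "d > 0" "\<And>g :: 'a \<Rightarrow> complex. continuous_map X euclidean g \<Longrightarrow>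
      (\<And>x. x \<in> T \<Longrightarrow> x \<notin> V \<Longrightarrow> g x = 0) \<Longrightarrow> inC (diag (\<lambda>x. g x ^ d * of_bool (x \<in> ?S)))"
    by (rule inC_diag_Xkl[OF inj2N]) blast
  define G where "G x = complex_of_real (g x)" for x
  define E0 where "E0 x = G x ^ d * of_bool (x \<in> ?S)" for x
  define E2 where "E2 x = complex_of_real (g2 x) ^ d * of_bool (x \<in> ?S)" for x
  let ?V = "bis 0 N G" and ?e = "diag (\<lambda>x. G x * G x * E0 x)"
  have VC: "inC ?V" unfolding G_def by (intro inC_bis g)
  have E0C: "inC (diag E0)" unfolding E0_def G_def using g(1,8) by (intro d(2)) auto
  have E2C: "inC (diag E2)" unfolding E2_def
  proof (rule d(2)[OF g2(1)])
    fix x assume "x \<in> T" "x \<notin> V"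
    then show "complex_of_real (g2 x) = 0" using g2(8)[of x] g(6) by auto
  qed
  have eC: "inC ?e" by (intro inC_diag_mult E0C) (auto simp: G_def intro!: inC_bis g)
  have ee: "diag E2 \<star> ?e = diag E2"
  proof -
    have "bis 0 0 (\<lambda>x. E2 x * (G x * G x * E0 x)) h = diag E2 h" for h :: "'a \<times> int \<times> 'a"
    proof -
      have "E2 x * (G x * G x * E0 x) = E2 x" if "x \<in> T" for x
        using g2(8)[OF that] g(7)[of x] d(1) by (cases "x \<in> W") (auto simp: E2_def E0_def G_def)
      then show ?thesis by (cases h) (auto simp: bis_def Eab_iff)
    qed
    then show ?thesis using diag_conv_diag[OF inC_Bc[OF E2C] inC_Bc[OF eC]] by auto
  qed
  have cG: "cmod (G x) \<le> 1" for x using g(2,3)[of x] by (simp add: G_def)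
  have cE0: "cmod (E0 x) \<le> 1" for x using cG[of x] by (auto simp: E0_def norm_mult norm_power power_le_one)
  have nV: "bnorm ?V \<le> 1"
    by (rule bnorm_shift[of 1 G N V]) (use cG g(8) injV[of N] in \<open>auto simp: G_def\<close>)
  have nE0: "bnorm (diag E0) \<le> 1" by (rule bnorm_diag) (use cE0 in auto)
  \<comment> \<open>Besides moving \<open>b\<close> to the small set, this map multiplies by
    \<open>E0\<close>, which cuts down to X_{2N,l}, where \<open>b\<close> pulled back is close to
    \<open>c\<close>. All factors have norm at most 1, so approximation errors do not grow.\<close>
  define \<kappa> where "\<kappa> f = adj_fun ?V \<star> f \<star> ?V \<star> diag E0" for f
  note Bcs = inC_Bc[OF VC] inC_Bc[OF E0C]
  have \<kappa>_norm: "bnorm (\<kappa> f) \<le> bnorm f" if f: "f \<in> \<B>" for f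
  proof -
    have mono: "bnorm (f' \<star> h) \<le> bnorm f'" if "f' \<in> \<B>" "h \<in> \<B>" "bnorm h \<le> 1" for f' h
      using bnorm_conv[OF that(1,2)] mult_left_mono[OF that(3) bnorm_nonneg[OF that(1)]] by simp
    have "bnorm (adj_fun ?V \<star> f) \<le> bnorm (adj_fun ?V) * bnorm f" by (intro bnorm_conv Bc_star Bcs f)
    also have "\<dots> \<le> 1 * bnorm f"
      using order_trans[OF bnorm_star[OF Bcs(1)] nV] by (intro mult_right_mono bnorm_nonneg f)
    finally show ?thesis
      unfolding \<kappa>_def
      using mono[of "adj_fun ?V \<star> f" ?V] mono[of "adj_fun ?V \<star> f \<star> ?V" "diag E0"] nV nE0
      by (simp add: Bc_conv Bc_star Bcs f)
  qed
  have \<kappa>_diff: "\<kappa> (\<lambda>g. f g - f' g) = (\<lambda>g. \<kappa> f g - \<kappa> f' g)" if "f \<in> \<B>" "f' \<in> \<B>" for f f'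
    by (simp add: \<kappa>_def conv_diff_left conv_diff_right Bc_conv Bc_star Bcs that)
  have \<kappa>b: "\<kappa> b = diag (\<lambda>x. (G x)\<^sup>2 * E0 x * ?b x)"
    unfolding \<kappa>_def
  proof (rule compression_diag[OF b(1) _ Bcs])
    show "inj_on (\<phi> ^^ (n + N)) V" by (rule injV) simp
  qed (use n g(8) sepV in \<open>auto simp: G_def\<close>)
  define w where "w m g = inverse c * \<kappa> (v m) g" for m g
  have constV: "(\<lambda>m. adj_fun ?V) \<in> B.cauchy" "(\<lambda>m. ?V) \<in> B.cauchy" "(\<lambda>m. diag E0) \<in> B.cauchy"
    by (intro const_cauchy Bc_star Bcs)+
  have constC: "const_cls (adj_fun ?V) \<in> CR" "const_cls ?V \<in> CR" "const_cls (diag E0) \<in> CR"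
    using inC_star[OF VC] VC E0C by (simp_all add: inC_def)
  have \<kappa>I: "(\<lambda>m. \<kappa> (v m)) \<in> B.cauchy" "B.cls (\<lambda>m. \<kappa> (v m)) \<in> I"
    unfolding \<kappa>_def
    by (intro cauchy_conv constV v ideal_mult_right[OF I] ideal_mult_left[OF I] constC vI)+
  have wI: "w \<in> B.cauchy" "B.cls w \<in> I"
    unfolding w_def by (intro cauchy_scaled ideal_scale[OF I] \<kappa>I)+
  have c0: "c \<noteq> 0" using c u(4) by auto
  have "r / cmod c \<le> 1" using c u(4) by (subst divide_le_eq_1_pos) auto
  moreover have "inverse (cmod c) * (r / 3) = (r / cmod c) / 3" by (simp only: divide_inverse mult_ac)
  ultimately have rc: "inverse (cmod c) * (r / 3) \<le> 1 / 3" by simp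
  have near: "bnorm (\<lambda>g. ?e g - w m g) \<le> 2 / 3" if m: "m \<ge> n0" for m
  proof -
    have vm: "v m \<in> \<B>" by (rule cauchy_Bc[OF v])
    have bv: "bnorm (\<lambda>g. b g - v m g) \<le> r / 3" using N1 m by (simp add: b_def n0_def less_imp_le)
    have 1: "bnorm (diag (\<lambda>x. (G x)\<^sup>2 * E0 x * (1 - inverse c * ?b x))) \<le> 1 / 3"
    proof (rule bnorm_diag)
      fix x assume x: "x \<in> T"
      show "cmod ((G x)\<^sup>2 * E0 x * (1 - inverse c * ?b x)) \<le> 1 / 3"
      proof (cases "x \<in> V \<inter> ?S")
        case True
        then have "x \<in> U \<inter> ?S" using U1(2) by (auto simp: V_def)
        from U(3)[OF this] have lt: "cmod (?b x - c) < r / 3" by (simp add: c_def y0(2))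
        have eq: "1 - inverse c * ?b x = - inverse c * (?b x - c)"
          using c0 by (simp add: algebra_simps)
        have "cmod (1 - inverse c * ?b x) =
            inverse (cmod c) * cmod (?b x - c)"
          unfolding eq by (simp only: norm_mult norm_minus_cancel norm_inverse)
        also have "\<dots> \<le> inverse (cmod c) * (r / 3)"
          by (intro mult_left_mono less_imp_le[OF lt]) simp
        also have "\<dots> \<le> 1 / 3" by (rule rc)
        finally have le: "cmod (1 - inverse c * ?b x) \<le> 1 / 3" .
        have "cmod ((G x)\<^sup>2 * E0 x) \<le> 1"
          using cG[of x] cE0[of x] by (simp add: norm_mult norm_power mult_le_one power_le_one)
        then have "cmod ((G x)\<^sup>2 * E0 x) * cmod (1 - inverse c * ?b x) \<le> 1 * (1 / 3)"
          by (intro mult_mono le) auto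
        then show ?thesis by (simp add: norm_mult)
      next
        case False
        then have "E0 x = 0" using g(8)[OF x] d(1) by (auto simp: E0_def G_def)
        then show ?thesis by simp
      qed
    qed simp
    have "bnorm (\<lambda>g. inverse c * \<kappa> (\<lambda>g. b g - v m g) g) \<le> cmod (inverse c) * bnorm (\<kappa> (\<lambda>g. b g - v m g))"
      unfolding \<kappa>_def by (intro bnorm_scale_le Bc_conv Bc_star Bcs Bc_diff b vm)
    also have "\<dots> \<le> cmod (inverse c) * (r / 3)"
      by (intro mult_left_mono order_trans[OF \<kappa>_norm bv] Bc_diff b vm) simp
    also have "\<dots> \<le> 1 / 3" unfolding norm_inverse by (rule rc)
    finally have 2: "bnorm (\<lambda>g. inverse c * \<kappa> (\<lambda>g. b g - v m g) g) \<le> 1 / 3" .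
    have "?e h - w m h = diag (\<lambda>x. (G x)\<^sup>2 * E0 x * (1 - inverse c * ?b x)) h
        + inverse c * \<kappa> (\<lambda>g. b g - v m g) h" for h
    proof -
      have "?e h - inverse c * \<kappa> b h = diag (\<lambda>x. (G x)\<^sup>2 * E0 x * (1 - inverse c * ?b x)) h"
        unfolding \<kappa>b by (cases h) (simp add: bis_def power2_eq_square algebra_simps)
      then show ?thesis
        unfolding w_def \<kappa>_diff[OF b(1) vm] by (simp only: right_diff_distrib) (simp add: diff_eq_eq)
    qed
    moreover have "diag (\<lambda>x. (G x)\<^sup>2 * E0 x * (1 - inverse c * ?b x)) \<in> \<B>"
    proof -
      have "(\<lambda>h. ?e h - inverse c * \<kappa> b h) \<in> \<B>"
        unfolding \<kappa>_def by (intro Bc_diff inC_Bc[OF eC] Bc_scale Bc_conv Bc_star Bcs b)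
      moreover have "(\<lambda>h. ?e h - inverse c * \<kappa> b h) = diag (\<lambda>x. (G x)\<^sup>2 * E0 x * (1 - inverse c * ?b x))"
        unfolding \<kappa>b by (rule ext) (auto simp: bis_def power2_eq_square algebra_simps)
      ultimately show ?thesis by simp
    qed
    moreover have "(\<lambda>g. inverse c * \<kappa> (\<lambda>g. b g - v m g) g) \<in> \<B>"
      unfolding \<kappa>_def by (intro Bc_scale Bc_conv Bc_star Bcs Bc_diff b vm)
    ultimately have "bnorm (\<lambda>g. ?e g - w m g) \<le> 1 / 3 + 1 / 3"
      using 1 2 by (simp only:) (rule order_trans[OF bnorm_add add_mono])
    then show ?thesis by simp
  qed
  have "const_cls (diag E2) \<in> I"
    by (rule mem_ideal_if_near[OF I wI eC E2C ee, of "2 / 3"])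
      (use near in \<open>auto simp: eventually_sequentially\<close>)
  moreover have E2_eq: "E2 = (\<lambda>x. complex_of_real (g2 x ^ d * of_bool (x \<in> ?S)))" by (auto simp: E2_def)
  moreover have "W2 \<inter> ?S \<noteq> {}" using g2(5) y1(2) by blast
  ultimately show thesis
    using that[of W2 "2 * N" l "\<lambda>x. g2 x ^ d * of_bool (x \<in> ?S)"] g2(2,4,7) inC_Bc[OF E2C] by simp
qed

section \<open>From a local element of an ideal to the unit\<close>

lemma simple_if_minimality:
  assumes min: minimality and ninj: "\<not> inj_on \<phi> T"
  shows "simple_algebra R"
  unfolding simple_algebra_def
proof (intro conjI allI impI)
  show "CR \<noteq> {azero R}" using one_neq_zero inC_one by (auto simp: inC_def)
  fix I assume I: "closed_ideal R I"
  show "I = {azero R} \<or> I = CR"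
  proof (cases "I = {azero R}")
    case False
    then obtain a where a: "a \<in> I" "a \<noteq> B.cls (\<lambda>n g. 0)" using ideal_zero[OF I] by auto
    obtain W k l and h :: "'a \<Rightarrow> real" where W: "openin X W" "W \<inter> \<X> k l \<noteq> {}"
      and h: "diag (\<lambda>x. complex_of_real (h x)) \<in> \<B>" "const_cls (diag (\<lambda>x. complex_of_real (h x))) \<in> I"
        "\<And>x. 0 \<le> h x" "\<And>x. x \<in> W \<inter> \<X> k l \<Longrightarrow> h x = 1"
      by (rule ideal_contains_local_element[OF min ninj I a]) blast
    obtain m where m: "(\<Union>j\<in>{0..m}. iter j ` (W \<inter> \<X> k l)) = T" using min W by blast
    define H where "H m x = (\<Sum>j\<le>m. \<Sum>y\<in>fibre j x. h y)" for m x
    let ?D = "\<lambda>m. diag (\<lambda>x. complex_of_real (H m x))"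
    have V: "inC (bis 0 j (\<lambda>x. 1))" for j by (rule inC_bis) simp
    have push: "diag (\<lambda>x. complex_of_real (\<Sum>y\<in>fibre j x. h y)) \<in> \<B> \<and>
        const_cls (diag (\<lambda>x. complex_of_real (\<Sum>y\<in>fibre j x. h y))) \<in> I" for j
    proof -
      let ?V = "bis 0 j (\<lambda>x. 1)"
      have VB: "?V \<in> \<B>" by (rule inC_Bc[OF V])
      have eq: "?V \<star> diag (\<lambda>x. complex_of_real (h x)) \<star> adj_fun ?V = diag (\<lambda>x. complex_of_real (\<Sum>y\<in>fibre j x. h y))"
        by (simp add: push_forward_diag[OF h(1) VB])
      have "const_cls (?V \<star> diag (\<lambda>x. complex_of_real (h x)) \<star> adj_fun ?V) \<in> I"
        using V[of j] inC_star[OF V[of j]] h(2)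
        by (intro ideal_mult_right[OF I] ideal_mult_left[OF I] cauchy_conv const_cauchy Bc_star VB h(1)) (auto simp: inC_def)
      moreover have "?V \<star> diag (\<lambda>x. complex_of_real (h x)) \<star> adj_fun ?V \<in> \<B>" by (intro Bc_conv Bc_star VB h(1))
      ultimately show ?thesis unfolding eq by simp
    qed
    have DI: "?D m \<in> \<B> \<and> const_cls (?D m) \<in> I" for m
    proof (induction m)
      case 0
      then show ?case using push[of 0] by (simp add: H_def)
    next
      case (Suc m)
      let ?d = "diag (\<lambda>x. complex_of_real (\<Sum>y\<in>fibre (Suc m) x. h y))"
      have eq: "?D (Suc m) = (\<lambda>g. ?D m g + ?d g)" by (rule ext) (auto simp: bis_def H_def)
      show ?case
        unfolding eq using Suc push[of "Suc m"]
        by (auto intro!: Bc_add ideal_add[OF I] const_cauchy)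
    qed
    obtain C0 where C0: "\<And>x. x \<in> T \<Longrightarrow> cmod (complex_of_real (H m x)) \<le> C0"
      by (rule bis_bounded[OF conjunct1[OF DI[of m]]]) auto
    \<comment> \<open>With \<open>H m x\<close> between 1 and \<open>C\<close>, the values of
      \<open>1 - H m x / C\<close> lie between 0 and \<open>1 - 1 / C\<close>. This is the distance
      below 1 that puts the unit into the ideal.\<close>
    define C where "C = max C0 1"
    have C: "C \<ge> 1" "\<And>x. x \<in> T \<Longrightarrow> H m x \<le> C" using C0 by (auto simp: C_def intro: order_trans[OF abs_ge_self] max.coboundedI1)
    have H1: "1 \<le> H m x" if "x \<in> T" for x
    proof -
      have "x \<in> (\<Union>j\<in>{0..m}. iter j ` (W \<inter> \<X> k l))" using that by (simp only: m)
      then obtain j y where y: "j \<le> m" "y \<in> W \<inter> \<X> k l" "x = iter j y"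
        by (elim UN_E imageE) simp
      have yT: "y \<in> fibre j x" using y Xkl_subset by (auto simp: fibre_def)
      have "1 = h y" using h(4)[OF y(2)] by simp
      also have "\<dots> \<le> (\<Sum>y\<in>fibre j x. h y)" by (rule member_le_sum[OF yT]) (auto simp: h(3) finite_fibre)
      also have "\<dots> \<le> H m x" unfolding H_def
        by (rule member_le_sum[of j]) (use y in \<open>auto simp: h(3) sum_nonneg\<close>)
      finally show ?thesis .
    qed
    let ?w = "\<lambda>g. complex_of_real (1 / C) * ?D m g"
    have wI: "(\<lambda>n. ?w) \<in> B.cauchy" "const_cls ?w \<in> I"
      by (intro const_cauchy Bc_scale ideal_scale[OF I] conjunct1[OF DI] conjunct2[OF DI])+
    have one: "diag (\<lambda>x. 1) \<star> diag (\<lambda>x. 1) = diag (\<lambda>x. 1)" by (rule conv_one[OF inC_Bc[OF inC_one]])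
    have "const_cls (diag (\<lambda>x. 1)) \<in> I"
    proof (rule mem_ideal_if_near[OF I wI inC_one inC_one one, of "1 - 1 / C"])
      have eq: "(\<lambda>g. diag (\<lambda>x. 1) g - ?w g) = diag (\<lambda>x. complex_of_real (1 - H m x / C))"
        by (rule ext) (auto simp: bis_def)
      have "bnorm (diag (\<lambda>x. complex_of_real (1 - H m x / C))) \<le> 1 - 1 / C"
      proof (rule bnorm_diag)
        fix x assume x: "x \<in> T"
        have "1 / C \<le> H m x / C" "H m x / C \<le> 1" using H1[OF x] C(1) C(2)[OF x] by (simp_all add: divide_right_mono)
        then show "cmod (complex_of_real (1 - H m x / C)) \<le> 1 - 1 / C" unfolding norm_of_real by simp
      qed (use C in simp)
      then show "\<forall>\<^sub>F n in sequentially. bnorm (\<lambda>g. diag (\<lambda>x. 1) g - ?w g) \<le> 1 - 1 / C"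
        unfolding eq by (rule always_eventually[OF allI])
    qed (use C(1) in auto)
    then show ?thesis using ideal_eq_CR[OF I] by blast
  qed simp
qed

end

theorem theorem4p14:
  fixes X :: "'a topology" and \<phi> :: "'a \<Rightarrow> 'a"
  assumes "compact_space X" and "metrizable_space X" and "Hausdorff_space X"
    and "continuous_map X X \<phi>" and "locally_injective X \<phi>"
    and "\<phi> ` topspace X = topspace X" and "\<not> inj_on \<phi> (topspace X)"
  shows "simple_algebra (reduced_Cstar_algebra (Gamma_groupoid X \<phi>)) \<longleftrightarrow>
    (\<forall>U k l. openin X U \<and> U \<inter> Xkl X \<phi> k l \<noteq> {} \<longrightarrow>
      (\<exists>m. (\<Union>j\<in>{0..m}. (\<phi> ^^ j) ` (U \<inter> Xkl X \<phi> k l)) = topspace X))"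
proof -
  \<comment> \<open>On an empty space every map would be injective.\<close>
  have "topspace X \<noteq> {}" using assms(7) by auto
  then interpret locally_injective_surjection X \<phi>
    by (unfold_locales) (use assms in auto)
  show ?thesis
    using minimality_if_simple simple_if_minimality assms(7) by blast
qed

end
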